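(* Suppose $X_1, X_2, \ldots$ are i.i.d. draws from a distribution $\mu$ that satisfies Assumption A (see context) with $-0.095 < \alpha < 0$, let $\ell_n = \omega(1)$ be a sequence of positive integers with $\ell_n < \sqrt{\log n}$, and fix $\delta \in (0, -\alpha)$. Then there is a constant $C > 0$ so that with probability $1 - O(\ell_n^{-1})$, the following are true statements concerning the polynomial $p_n(z) := \prod_{j=1}^n (z - X_j)$ and its roots and critical points that lie in the annulus $$\mathcal{A}_n^- := \left\{ z \in \mathbb{C} : 1 - \frac{\ell_n}{n} \le |z| \le 1 \right\}:$$ (i) There are at least $n^\delta$ critical points of $p_n$ in $\mathcal{A}_n^-$. (ii) Within distance $3/n$ of each root $X_i \in \mathcal{A}_n^-$, $i \in [n]$, there is precisely one critical point $W_i^{(n)}$ of $p_n$, and these critical points satisfy $$\max_{i : X_i \in \mathcal{A}_n^-} \left| W_i^{(n)} - X_i + \frac{1}{n}\, \frac{1}{\frac{1}{n-1}\sum_{j \ne i}\frac{1}{X_i - X_j}} \right| < C \ell_n n^{-\frac{5\alpha+3}{2(\alpha+1)}}$$ and $$\max_{i : X_i \in \mathcal{A}_n^-} \left| W_i^{(n)} - X_i(1 - n^{-1}) \right| < C \left( \frac{1}{\ell_n^4 n} \right)^{1/(\alpha+1)}.$$ (iii) There is an injection $\iota$ from the set of critical points of $p_n$ that lie in $\mathcal{A}_n^-$ to the set of indices $[n]$ of the roots of $p_n$, so that each critical point $W \in \mathcal{A}_n^-$ corresponds to precisely one root $X_{\iota(W)} \in \mathcal{A}_n^-$ according to the relationship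 $$W = X_{\iota(W)}\left(1 - n^{-1} + o(n^{-1})\right).$$ More specifically, $$\max_{W \in \mathcal{A}_n^-,\ p_n'(W)=0} \left| W - X_{\iota(W)}(1 - n^{-1}) \right| < C \left( \frac{1}{\ell_n^4 n} \right)^{1/(\alpha+1)},$$ so the asymptotic notation in the preceding display is uniform over critical points $W \in \mathcal{A}_n^-$. (iv) The largest $\ell_n$ roots of $p_n$ satisfy $$1 - \left( \frac{\ell_n^2}{n} \right)^{\frac{1}{\alpha+1}} \le |X^{\downarrow}_{(i)}| \le 1 - \left( \frac{1}{n \ell_n} \right)^{\frac{1}{\alpha+1}}, \quad 1 \le i \le \ell_n,$$ and, denoting the largest $\ell_n$ critical points of $p_n$ in order of decreasing magnitude by $W^{\downarrow}_{(1)}, \ldots, W^{\downarrow}_{(\ell_n)}$, we have $$\max_{1 \le i \le \ell_n} \left| W^{\downarrow}_{(i)} - X^{\downarrow}_{(i)}(1 - n^{-1}) \right| < C \left( \frac{1}{\ell_n^4 n} \right)^{1/(\alpha+1)};$$ $$\max_{1 \le i \le \ell_n} \left| W^{\downarrow}_{(i)} - X^{\downarrow}_{(i)} + \frac{1}{n}\, \frac{1}{\frac{1}{n-1}\sum_{j=1, j\ne i}^n \frac{1}{X^{\downarrow}_{(i)} - X^{\downarrow}_{(j)}}} \right| < C \ell_n n^{-\frac{5\alpha+3}{2(\alpha+1)}};$$ and for each $i \in \{1, \ldots, \ell_n\}$, $W^{\downarrow}_{(i)}$ is the unique critical point of $p_n$ that is within a distance $3/n$ of $X^{\downarrow}_{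(i)}$.
   Context: Assumption A (with parameter $\alpha > -1$): $\mu$ is a radially symmetric (rotation-invariant about $0$) probability measure supported on the unit disk centered at the origin in $\mathbb{C}$ such that (a) there is $\varepsilon \in (0,1]$ so that in the annulus $\{z : 1 - \varepsilon \le |z| \le 1\}$, $\mu$ has a density $f_\mu(z)$ with respect to Lebesgue measure on $\mathbb{C}$; (b) there are constants $c_\mu, C_\mu > 0$ so that the radial density $f_R(r) := 2\pi r f_\mu(r e^{\sqrt{-1}\theta})$ (which does not depend on $\theta$) satisfies $c_\mu \le \frac{f_R(r)}{(1-r)^\alpha} \le C_\mu$ for $1-\varepsilon \le r < 1$. Critical points of a polynomial are the roots of its derivative. $\arg$ is the principal argument with values in $(-\pi,\pi]$. Order $\mathbb{C}$ by: $0 \preceq z$ for all $z$; for nonzero $z,w$, $z \preceq w$ iff $|z|<|w|$, or $|z|=|w|$ and $\arg z \le \arg w$. $X^{\downarrow}_{(k)}$ denotes the $k$th largest element of $X_1,\ldots,X_n$ in this order. $[n]=\{1,\ldots,n\}$. Asymptotic notation is as $n \to \infty$; $\ell_n=\omega(1)$ means $\ell_n\to\infty$. "With probability $1-O(a_n)$" means the complementary event has probability $O(a_n)$. *)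

theory Defs
  imports
    "HOL-Probability.Probability"
    "HOL-Computational_Algebra.Fundamental_Theorem_Algebra"
begin

(* The density f is a representative that is radial on the whole annulus, so that the
   radial density f\<^sub>R is well defined pointwise. *)
definition assumption_A :: "real \<Rightarrow> complex measure \<Rightarrow> bool" where
  "assumption_A \<alpha> \<mu> \<longleftrightarrow>
     -1 < \<alpha> \<and> prob_space \<mu> \<and> sets \<mu> = sets borel \<and>
     (\<forall>\<theta>. distr \<mu> borel (\<lambda>z. cis \<theta> * z) = \<mu>) \<and>
     (AE z in \<mu>. norm z \<le> 1) \<and>
     (\<exists>\<epsilon> f f\<^sub>R c C.
        0 < \<epsilon> \<and> \<epsilon> \<le> 1 \<and>
        f \<in> borel_measurable borel \<and> (\<forall>z. 0 \<le> f z) \<and>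
        (\<forall>B \<in> sets borel. B \<subseteq> {z. 1 - \<epsilon> \<le> norm z \<and> norm z \<le> 1} \<longrightarrow>
           emeasure \<mu> B = (\<integral>\<^sup>+ z \<in> B. ennreal (f z) \<partial>lborel)) \<and>
        (\<forall>r \<theta>. 1 - \<epsilon> \<le> r \<and> r \<le> 1 \<longrightarrow>
           f\<^sub>R r = 2 * pi * r * f (complex_of_real r * cis \<theta>)) \<and>
        0 < c \<and> 0 < C \<and>
        (\<forall>r. 1 - \<epsilon> \<le> r \<and> r < 1 \<longrightarrow>
           c \<le> f\<^sub>R r / (1 - r) powr \<alpha> \<and> f\<^sub>R r / (1 - r) powr \<alpha> \<le> C))"

definition cpx_le :: "complex \<Rightarrow> complex \<Rightarrow> bool" where
  "cpx_le z w \<longleftrightarrow>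
     z = 0 \<or>
     (z \<noteq> 0 \<and> w \<noteq> 0 \<and> (norm z < norm w \<or> (norm z = norm w \<and> Arg z \<le> Arg w)))"

definition cpx_less :: "complex \<Rightarrow> complex \<Rightarrow> bool" where
  "cpx_less z w \<longleftrightarrow> cpx_le z w \<and> z \<noteq> w"

lemma cpx_le_refl: "cpx_le z z"
  by (simp add: cpx_le_def)

lemma cpx_le_antisym: "z = w" if "cpx_le z w" "cpx_le w z"
proof (cases "z = 0 \<or> w = 0")
  case True
  then show ?thesis using that by (auto simp: cpx_le_def)
next
  case False
  then have "norm z = norm w" "Arg z = Arg w"
    using that by (auto simp: cpx_le_def)
  then have "rcis (norm z) (Arg z) = rcis (norm w) (Arg w)"
    by simp
  then show ?thesis
    by (simp add: rcis_cmod_Arg)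
qed

interpretation cpx: linorder cpx_le cpx_less
proof
  fix x y z :: complex
  show "cpx_less x y \<longleftrightarrow> cpx_le x y \<and> \<not> cpx_le y x"
    unfolding cpx_less_def using cpx_le_antisym [of x y] cpx_le_refl by blast
  show "cpx_le x x"
    by (rule cpx_le_refl)
  show "cpx_le x z" if "cpx_le x y" "cpx_le y z"
    using that unfolding cpx_le_def by linarith
  show "x = y" if "cpx_le x y" "cpx_le y x"
    using that by (rule cpx_le_antisym)
  show "cpx_le x y \<or> cpx_le y x"
    unfolding cpx_le_def by linarith
qed

(* k counts from 1, and elements are counted with multiplicity; unspecified unless
   1 \<le> k \<le> size A. *)
definition kth_largest :: "complex multiset \<Rightarrow> nat \<Rightarrow> complex" where
  "kth_largest A k = rev (cpx.sorted_list_of_multiset A) ! (k - 1)"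

definition root_poly :: "(nat \<Rightarrow> complex) \<Rightarrow> nat \<Rightarrow> complex poly" where
  "root_poly x n = (\<Prod>j = 1..n. [:- x j, 1:])"

(* Critical points with multiplicity. *)
definition crit_pts :: "complex poly \<Rightarrow> complex multiset" where
  "crit_pts p = proots (pderiv p)"

definition roots_desc :: "(nat \<Rightarrow> complex) \<Rightarrow> nat \<Rightarrow> nat \<Rightarrow> complex" where
  "roots_desc x n k = kth_largest (image_mset x (mset_set {1..n})) k"

definition crit_desc :: "(nat \<Rightarrow> complex) \<Rightarrow> nat \<Rightarrow> nat \<Rightarrow> complex" where
  "crit_desc x n k = kth_largest (crit_pts (root_poly x n)) k"

(* As an equation between multisets, this says that w is the only critical point within
   distance r of x and that it has multiplicity one. *)
definition only_crit_within :: "complex poly \<Rightarrow> real \<Rightarrow> complex \<Rightarrow> complex \<Rightarrow> bool" where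
  "only_crit_within p r x w \<longleftrightarrow> {# v \<in># crit_pts p. dist v x \<le> r #} = {# w #}"

definition annulus :: "nat \<Rightarrow> nat \<Rightarrow> complex set" where
  "annulus l n = {z. 1 - real l / real n \<le> norm z \<and> norm z \<le> 1}"

definition root_mean :: "(nat \<Rightarrow> complex) \<Rightarrow> nat \<Rightarrow> nat \<Rightarrow> complex" where
  "root_mean x n i = (1 / of_nat (n - 1)) * (\<Sum>j \<in> {1..n} - {i}. 1 / (x i - x j))"

(* The events P n hold with probability 1 - O(a n): the failure of P n is covered by a
   measurable set of probability O(a n). For measurable P n this is the usual notion. *)
definition with_prob_1_minus_O ::
  "'a measure \<Rightarrow> (nat \<Rightarrow> real) \<Rightarrow> (nat \<Rightarrow> 'a \<Rightarrow> bool) \<Rightarrow> bool" where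
  "with_prob_1_minus_O M a P \<longleftrightarrow>
     (\<exists>E. (\<forall>n. E n \<in> sets M \<and> {\<omega> \<in> space M. \<not> P n \<omega>} \<subseteq> E n) \<and>
          (\<lambda>n. measure M (E n)) \<in> O(a))"

end

theory Submission
  imports Defs "HOL-Real_Asymp.Real_Asymp"
begin

text \<open>Near the unit circle the mean field \<open>1/n \<Sum>\<^sub>j 1/(z - X\<^sub>j)\<close> is close to its expectation \<open>1/z\<close>.
  A critical point \<open>w\<close> close to a root \<open>X\<^sub>i\<close> solves \<open>w = X\<^sub>i - 1/G\<^sub>i(w)\<close>, where \<open>G\<^sub>i \<approx> n/w\<close> is
  the field of the other roots, and \<open>z \<mapsto> X\<^sub>i - 1/G\<^sub>i(z)\<close> is a contraction, so each root is paired
  with exactly one critical point \<open>w \<approx> X\<^sub>i(1 - 1/n)\<close>; away from the roots the field does not vanish.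

  To control the field on the whole annulus at once, it is evaluated at the points \<open>c\<close> of a mesh on
  a circle of radius \<open>1 + h\<close>, where \<open>1/(c - X)\<close> is bounded and has mean exactly \<open>1/c\<close> by rotation
  invariance. The Chebyshev inequality for \<open>1/(c - X)\<close> and for \<open>1/\<bar>c - X\<bar>\<^sup>2\<close> survives a union bound
  over the mesh. Passing from \<open>c\<close> to \<open>z\<close> costs a multiple of \<open>h \<Sum>\<^sub>j 1/\<bar>c - X\<^sub>j\<bar>\<^sup>2\<close> from the distant
  roots, while the roots at distance \<open>O(h)\<close> are few (exponential tail bound) and, all but one, not too
  close to \<open>z\<close>. The moduli of the largest roots have gaps that exceed the pairing error, so the pairing
  preserves their order.\<close>

section \<open>Radial laws with a power-law edge\<close>

text \<open>For \<alpha> < 0 the density blows up at the circle, and the largest roots lie at depth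
  about n^(-1/(1+\<alpha>)), much closer to the circle than the distance 1/n by which a critical
  point is displaced from its root. Part (iv) therefore cannot follow from a displacement of order
  1/n alone: the displacement must be the common factor 1 - 1/n up to an error smaller than the gaps
  between the top moduli. That error is about 4 E / n^2, where \<open>E\<close> bounds the error of
  the field, so \<open>E\<close> has to stay a definite power of n below n; the bound -0.095 <
  \<alpha> makes room for this.

  The loss 1/l in the probability comes from the upper bound on the largest moduli: the expected
  number of roots beyond depth (1/(n l))^(1/(1+\<alpha>)) is of order 1/l. Apart from this and the
  count of the top roots, every comparison of scales has a power of n to spare, so the constant C =
  1 suffices and powers of l, being at most powers of log n, are absorbed.\<close>

lemma emeasure_lborel_annulus:
  assumes "0 \<le> r1" "r1 \<le> r2"
  shows "emeasure lborel {z::complex. r1 \<le> norm z \<and> norm z \<le> r2} = ennreal (pi * (r2\<^sup>2 - r1\<^sup>2))"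
proof -
  have eq: "{z::complex. r1 \<le> norm z \<and> norm z \<le> r2} = cball 0 r2 - ball 0 r1"
    by (auto simp: dist_norm)
  have "emeasure lborel (cball 0 r2 - ball (0::complex) r1)
      = emeasure lborel (cball (0::complex) r2) - emeasure lborel (ball (0::complex) r1)"
    using assms by (intro emeasure_Diff) (auto simp: emeasure_ball)
  also have "\<dots> = ennreal (pi * r2\<^sup>2) - ennreal (pi * r1\<^sup>2)"
    using assms by (simp add: emeasure_ball emeasure_cball unit_ball_vol_2)
  also have "\<dots> = ennreal (pi * r2\<^sup>2 - pi * r1\<^sup>2)"
    by (rule ennreal_minus) simp
  finally show ?thesis by (simp add: eq right_diff_distrib)
qed

text \<open>Besides the support in the disk and the rotation invariance, these estimates are all
  that is used of the law. As \<alpha> is negative, (1 - r)^\<alpha> increases with r, so an upper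
  bound on a ring is read off at its outer radius and a lower bound at its inner radius.\<close>

lemma assumption_A_radial_bounds:
  assumes A: "assumption_A \<alpha> \<mu>" and neg: "\<alpha> < 0"
  obtains \<epsilon> K k where "0 < \<epsilon>" "0 < K" "0 < k"
    and "\<And>r1 r2. 1 - \<epsilon> \<le> r1 \<Longrightarrow> r1 \<le> r2 \<Longrightarrow> r2 < 1 \<Longrightarrow>
      measure \<mu> {z. r1 \<le> norm z \<and> norm z \<le> r2} \<le> K * (r2 - r1) * (1 - r2) powr \<alpha>"
    and "\<And>t. 0 < t \<Longrightarrow> measure \<mu> {z. 1 - t \<le> norm z} \<le> K * t powr (1 + \<alpha>)"
    and "\<And>t. 0 < t \<Longrightarrow> t \<le> \<epsilon> \<Longrightarrow> k * t powr (1 + \<alpha>) \<le> measure \<mu> {z. 1 - t \<le> norm z}"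
proof -
  from A have gt: "-1 < \<alpha>" and pr: "prob_space \<mu>" and sets[measurable_cong]: "sets \<mu> = sets borel"
    and disk: "AE z in \<mu>. norm z \<le> 1" by (simp_all only: assumption_A_def)
  from A obtain \<epsilon>0 f fR c C where e0: "0 < \<epsilon>0" and f[measurable]: "f \<in> borel_measurable borel"
    and dens: "\<forall>B \<in> sets borel. B \<subseteq> {z. 1 - \<epsilon>0 \<le> norm z \<and> norm z \<le> 1} \<longrightarrow>
           emeasure \<mu> B = (\<integral>\<^sup>+ z \<in> B. ennreal (f z) \<partial>lborel)"
    and fR: "\<forall>r \<theta>. 1 - \<epsilon>0 \<le> r \<and> r \<le> 1 \<longrightarrow>
           fR r = 2 * pi * r * f (complex_of_real r * cis \<theta>)"
    and c0: "0 < c" and C0: "0 < C"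
    and fRb: "\<forall>r. 1 - \<epsilon>0 \<le> r \<and> r < 1 \<longrightarrow>
           c \<le> fR r / (1 - r) powr \<alpha> \<and> fR r / (1 - r) powr \<alpha> \<le> C"
    unfolding assumption_A_def by (elim conjE exE) (rule that)
  interpret prob_space \<mu> by fact
  \<comment> \<open>The cap 1/2 keeps |z| \<ge> 1/2 on the annulus, so the factor 1/|z| between the
    radial and the planar density is at most 2.\<close>
  define \<epsilon> where "\<epsilon> = min \<epsilon>0 (1/2)"
  have e: "0 < \<epsilon>" "\<epsilon> \<le> \<epsilon>0" "\<epsilon> \<le> 1/2" using e0 by (auto simp: \<epsilon>_def)
  have fz: "f z = fR (norm z) / (2 * pi * norm z)" if "1 - \<epsilon> \<le> norm z" "norm z \<le> 1" for z
  proof -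
    have "fR (norm z) = 2 * pi * norm z * f (complex_of_real (norm z) * cis (Arg z))"
      using that e by (intro fR[rule_format]) auto
    also have "complex_of_real (norm z) * cis (Arg z) = z"
      using rcis_cmod_Arg[of z] by (simp add: rcis_def)
    finally show ?thesis using that e by auto
  qed
  define K1 where "K1 = 2 * C"
  have K1: "0 < K1" using C0 by (simp add: K1_def)
  have ring: "measure \<mu> {z. r1 \<le> norm z \<and> norm z \<le> r2} \<le> K1 * (r2 - r1) * (1 - r2) powr \<alpha>"
    if r: "1 - \<epsilon> \<le> r1" "r1 \<le> r2" "r2 < 1" for r1 r2
  proof -
    let ?R = "{z::complex. r1 \<le> norm z \<and> norm z \<le> r2}"
    have [measurable]: "?R \<in> sets borel" by measurable
    have fb: "f z \<le> C * (1 - r2) powr \<alpha> / pi" if z: "z \<in> ?R" for z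
    proof -
      have z1: "1 - \<epsilon> \<le> norm z" "norm z < 1" "1/2 \<le> norm z" using z r e by auto
      have "fR (norm z) \<le> C * (1 - norm z) powr \<alpha>"
        using fRb[rule_format, of "norm z"] z1 e by (auto simp: divide_le_eq)
      also have "\<dots> \<le> C * (1 - r2) powr \<alpha>"
        using z r C0 neg by (intro mult_left_mono powr_mono2') auto
      finally have *: "fR (norm z) \<le> C * (1 - r2) powr \<alpha>" .
      have "f z = fR (norm z) / (2 * pi * norm z)" using z1 by (intro fz) auto
      also have "\<dots> \<le> C * (1 - r2) powr \<alpha> / (2 * pi * norm z)"
        using * z1 by (intro divide_right_mono) auto
      also have "\<dots> \<le> C * (1 - r2) powr \<alpha> / pi"
        using z1 C0 by (intro divide_left_mono mult_pos_pos) auto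
      finally show ?thesis .
    qed
    have "emeasure \<mu> ?R = (\<integral>\<^sup>+ z \<in> ?R. ennreal (f z) \<partial>lborel)"
      using r e by (intro dens[rule_format]) auto
    also have "\<dots> \<le> (\<integral>\<^sup>+ z \<in> ?R. ennreal (C * (1 - r2) powr \<alpha> / pi) \<partial>lborel)"
      using fb by (intro nn_integral_mono) (auto split: split_indicator intro!: ennreal_leI)
    also have "\<dots> = ennreal (C * (1 - r2) powr \<alpha> / pi) * ennreal (pi * (r2\<^sup>2 - r1\<^sup>2))"
      using r e by (subst nn_integral_cmult_indicator) (auto simp: emeasure_lborel_annulus)
    also have "\<dots> = ennreal (C * (1 - r2) powr \<alpha> / pi * (pi * (r2\<^sup>2 - r1\<^sup>2)))"
      using C0 r e by (subst ennreal_mult) (auto simp: power_mono)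
    also have "C * (1 - r2) powr \<alpha> / pi * (pi * (r2\<^sup>2 - r1\<^sup>2)) = C * (1 - r2) powr \<alpha> * (r2 - r1) * (r2 + r1)"
      by (simp add: power2_eq_square algebra_simps)
    also have "ennreal \<dots> \<le> ennreal (C * (1 - r2) powr \<alpha> * (r2 - r1) * 2)"
      using C0 r by (intro ennreal_leI mult_left_mono) auto
    finally have "emeasure \<mu> ?R \<le> ennreal (C * (1 - r2) powr \<alpha> * (r2 - r1) * 2)" .
    then have "measure \<mu> ?R \<le> C * (1 - r2) powr \<alpha> * (r2 - r1) * 2"
      using C0 r by (simp add: emeasure_eq_measure ennreal_le_iff)
    then show ?thesis by (simp add: K1_def algebra_simps)
  qed
  \<comment> \<open>Only the inner half of the collar is counted; there the density is at least c
    t^\<alpha> / (2 pi), and the area is at least pi t / 2 because t \<le> 1/2.\<close>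
  have low: "c / 4 * t powr (1 + \<alpha>) \<le> measure \<mu> {z. 1 - t \<le> norm z}" if t: "0 < t" "t \<le> \<epsilon>" for t
  proof -
    let ?R = "{z::complex. 1 - t \<le> norm z \<and> norm z \<le> 1 - t/2}"
    have [measurable]: "?R \<in> sets borel" by measurable
    have fb: "c * t powr \<alpha> / (2 * pi) \<le> f z" if z: "z \<in> ?R" for z
    proof -
      have z1: "1 - \<epsilon> \<le> norm z" "norm z < 1" "1/2 \<le> norm z" using z t e by auto
      have "c * t powr \<alpha> \<le> c * (1 - norm z) powr \<alpha>"
        using z t c0 neg by (intro mult_left_mono powr_mono2') auto
      also have "\<dots> \<le> fR (norm z)"
        using fRb[rule_format, of "norm z"] z1 e by (auto simp: le_divide_eq)
      finally have *: "c * t powr \<alpha> \<le> fR (norm z)" .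
      have "c * t powr \<alpha> / (2 * pi) \<le> c * t powr \<alpha> / (2 * pi * norm z)"
        using z1 c0 by (intro divide_left_mono mult_pos_pos) auto
      also have "\<dots> \<le> fR (norm z) / (2 * pi * norm z)"
        using * by (intro divide_right_mono) auto
      also have "\<dots> = f z" using z1 by (intro fz[symmetric]) auto
      finally show ?thesis .
    qed
    have "ennreal (c / 4 * t powr (1 + \<alpha>)) = ennreal (c * t powr \<alpha> / (2 * pi) * (pi * (t / 2)))"
      using t by (simp add: powr_add mult_ac)
    also have "\<dots> \<le> ennreal (c * t powr \<alpha> / (2 * pi) * (pi * ((1 - t/2)\<^sup>2 - (1 - t)\<^sup>2)))"
    proof (intro ennreal_leI mult_left_mono)
      have "(1 - t/2)\<^sup>2 - (1 - t)\<^sup>2 = t/2 * (2 - 3 * t / 2)"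
        by (simp add: power2_eq_square algebra_simps)
      moreover have "t/2 * 1 \<le> t/2 * (2 - 3 * t / 2)"
        using t e by (intro mult_left_mono) auto
      ultimately show "t / 2 \<le> (1 - t/2)\<^sup>2 - (1 - t)\<^sup>2" by simp
    qed (use c0 in auto)
    also have "\<dots> = ennreal (c * t powr \<alpha> / (2 * pi)) * ennreal (pi * ((1 - t/2)\<^sup>2 - (1 - t)\<^sup>2))"
      using c0 t e by (subst ennreal_mult) (auto simp: power_mono)
    also have "\<dots> = (\<integral>\<^sup>+ z \<in> ?R. ennreal (c * t powr \<alpha> / (2 * pi)) \<partial>lborel)"
      using t e by (subst nn_integral_cmult_indicator) (auto simp: emeasure_lborel_annulus)
    also have "\<dots> \<le> (\<integral>\<^sup>+ z \<in> ?R. ennreal (f z) \<partial>lborel)"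
      using fb by (intro nn_integral_mono) (auto split: split_indicator intro!: ennreal_leI)
    also have "\<dots> = emeasure \<mu> ?R"
      using t e by (intro dens[rule_format, symmetric]) auto
    also have "\<dots> \<le> emeasure \<mu> {z. 1 - t \<le> norm z}"
      by (intro emeasure_mono) auto
    finally show ?thesis using c0 by (simp add: emeasure_eq_measure)
  qed
  \<comment> \<open>The ring estimate degenerates as the outer radius tends to 1, so the collar is
    cut into dyadic shells between depths t/2^k and t/2^(k+1). Their bounds form a geometric series
    with ratio \<open>q\<close>, and \<open>K2\<close> comes from its sum.\<close>
  define q where "q = 2 powr (- (1 + \<alpha>))"
  have q: "0 < q" "q < 1" using gt by (auto simp: q_def powr_less_one)
  define K2 where "K2 = K1 * (q / (1 - q))"
  have K2: "0 < K2" using K1 q by (simp add: K2_def)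
  \<comment> \<open>The shells exhaust the open collar but miss the unit circle, a Lebesgue null set
    inside the closed annulus on which \<mu> has a density.\<close>
  have sphere0: "measure \<mu> {z. norm z = 1} = 0"
  proof -
    have [measurable]: "{z::complex. norm z = 1} \<in> sets borel" by measurable
    have "emeasure \<mu> {z. norm z = 1} = (\<integral>\<^sup>+ z \<in> {z. norm z = 1}. ennreal (f z) \<partial>lborel)"
      using e by (intro dens[rule_format]) auto
    also have "\<dots> = 0"
    proof -
      have "emeasure lborel {z::complex. norm z = 1} = 0"
      proof -
        have "{z::complex. norm z = 1} = {z. 1 \<le> norm z \<and> norm z \<le> 1}" by auto
        then show ?thesis using emeasure_lborel_annulus[of 1 1] by simp
      qed
      then have "AE z in lborel. (z::complex) \<notin> {z. norm z = 1}"
        by (intro AE_not_in) (auto simp: null_sets_def)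
      then show ?thesis by (subst nn_integral_0_iff_AE) (auto elim!: eventually_mono)
    qed
    finally show ?thesis by (simp add: measure_def)
  qed
  have tail1: "measure \<mu> {z. 1 - t \<le> norm z} \<le> K2 * t powr (1 + \<alpha>)" if t: "0 < t" "t \<le> \<epsilon>" for t
  proof -
    define R where "R = (\<lambda>k::nat. {z::complex. 1 - t / 2^k \<le> norm z \<and> norm z \<le> 1 - t / 2 ^ Suc k})"
    have Rm[measurable]: "R k \<in> sets borel" for k unfolding R_def by measurable
    have Rk: "measure \<mu> (R k) \<le> K1 * t powr (1 + \<alpha>) * q ^ Suc k" for k
    proof -
      have "t / 2 ^ k \<le> t" using t by (simp add: divide_le_eq)
      then have "t / 2 ^ k \<le> \<epsilon>" using t by linarith
      then have "measure \<mu> (R k) \<le> K1 * ((1 - t / 2 ^ Suc k) - (1 - t / 2^k)) * (1 - (1 - t / 2 ^ Suc k)) powr \<alpha>"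
        unfolding R_def using t e by (intro ring) (auto intro!: divide_left_mono)
      also have "(1 - t / 2 ^ Suc k) - (1 - t / 2^k) = t / 2 ^ Suc k"
        by (simp add: field_simps)
      also have "K1 * (t / 2 ^ Suc k) * (1 - (1 - t / 2 ^ Suc k)) powr \<alpha> = K1 * (t / 2 ^ Suc k) powr (1 + \<alpha>)"
        using t by (simp add: powr_add)
      also have "(t / 2 ^ Suc k) powr (1 + \<alpha>) = t powr (1 + \<alpha>) * q ^ Suc k"
      proof -
        have p: "(2::real) ^ Suc k = 2 powr real (Suc k)"
          by (rule powr_realpow[symmetric]) simp
        have "q ^ Suc k = 2 powr (- (1 + \<alpha>) * real (Suc k))"
          unfolding q_def by (subst powr_power) (simp_all add: mult.commute)
        also have "\<dots> = inverse (2 powr (real (Suc k) * (1 + \<alpha>)))"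
          by (simp only: powr_minus[symmetric]) (simp add: algebra_simps)
        also have "\<dots> = inverse ((2 ^ Suc k) powr (1 + \<alpha>))"
          unfolding p by (simp only: powr_powr)
        finally have "q ^ Suc k = 1 / (2 ^ Suc k) powr (1 + \<alpha>)"
          by (simp only: inverse_eq_divide)
        then show ?thesis using t by (simp add: powr_divide del: power_Suc)
      qed
      finally show ?thesis by (simp add: mult_ac)
    qed
    have sm: "summable (\<lambda>k. K1 * t powr (1 + \<alpha>) * q ^ Suc k)"
      using q by (intro summable_mult) (auto simp: summable_mult)
    have cover: "\<exists>k. z \<in> R k" if z: "1 - t \<le> norm z" "norm z < 1" for z
    proof -
      define y where "y = (1 - norm z) / t"
      have y: "0 < y" "y \<le> 1" using z t by (auto simp: y_def)
      obtain k where k: "(1/2)^k < y" using real_arch_pow_inv[of y "1/2"] y by auto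
      define P where "P = (\<lambda>k. (1/2)^k < y)"
      have Pk: "P k" using k by (simp add: P_def)
      define j where "j = (LEAST k. P k)"
      have Pj: "P j" unfolding j_def using Pk by (rule LeastI)
      have "j \<noteq> 0" using Pj y by (intro notI) (simp add: P_def)
      then obtain i where i: "j = Suc i" by (cases j) auto
      have "\<not> P i" using not_less_Least[of i P] i by (simp add: j_def)
      then have "y \<le> (1/2)^i" "(1/2)^Suc i < y" using Pj i by (auto simp: P_def)
      then have "1 - norm z \<le> t * (1/2)^i" "t * (1/2)^Suc i \<le> 1 - norm z"
        using t by (auto simp: y_def field_simps)
      then have "z \<in> R i" by (auto simp: R_def power_divide field_simps)
      then show ?thesis by blast
    qed
    have "measure \<mu> {z. 1 - t \<le> norm z} \<le> measure \<mu> ((\<Union>k. R k) \<union> {z. norm z = 1})"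
      using disk cover by (intro finite_measure_mono_AE) (auto elim!: eventually_mono simp: less_le)
    also have "\<dots> \<le> measure \<mu> (\<Union>k. R k) + measure \<mu> {z. norm z = 1}"
      by (intro measure_Un_le) auto
    also have "measure \<mu> (\<Union>k. R k) \<le> (\<Sum>k. measure \<mu> (R k))"
    proof (intro finite_measure_subadditive_countably)
      show "summable (\<lambda>k. measure \<mu> (R k))"
        using Rk by (intro summable_comparison_test'[OF sm, of 0]) auto
    qed (auto simp: sets)
    also have "\<dots> \<le> (\<Sum>k. K1 * t powr (1 + \<alpha>) * q ^ Suc k)"
    proof (intro suminf_le)
      show "summable (\<lambda>k. measure \<mu> (R k))"
        using Rk by (intro summable_comparison_test'[OF sm, of 0]) auto
    qed (use Rk sm in auto)
    also have "\<dots> = K2 * t powr (1 + \<alpha>)"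
    proof -
      have "(\<lambda>k. q ^ k) sums (1 / (1 - q))" using q by (intro geometric_sums) auto
      from sums_mult[OF this, of "K1 * t powr (1 + \<alpha>) * q"]
      have "(\<lambda>k. K1 * t powr (1 + \<alpha>) * q ^ Suc k) sums (K1 * t powr (1 + \<alpha>) * q * (1 / (1 - q)))"
        by (simp add: mult_ac)
      then show ?thesis by (simp add: sums_iff K2_def mult_ac)
    qed
    finally show ?thesis using sphere0 by simp
  qed
  \<comment> \<open>The last entry makes the tail bound at least 1, hence trivial, for depths beyond
    \<open>\<epsilon>\<close>.\<close>
  define K where "K = max (max K1 K2) (1 / \<epsilon> powr (1 + \<alpha>))"
  have K: "0 < K" "K1 \<le> K" "K2 \<le> K" "1 / \<epsilon> powr (1 + \<alpha>) \<le> K" using K1 by (auto simp: K_def)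
  show ?thesis
  proof (rule that[of \<epsilon> K "c / 4"])
    show "measure \<mu> {z. r1 \<le> norm z \<and> norm z \<le> r2} \<le> K * (r2 - r1) * (1 - r2) powr \<alpha>"
      if "1 - \<epsilon> \<le> r1" "r1 \<le> r2" "r2 < 1" for r1 r2
      using that K by (intro order_trans[OF ring[OF that]] mult_right_mono) auto
    show "measure \<mu> {z. 1 - t \<le> norm z} \<le> K * t powr (1 + \<alpha>)" if "0 < t" for t
    proof (cases "t \<le> \<epsilon>")
      case True
      with that K show ?thesis by (intro order_trans[OF tail1] mult_right_mono) auto
    next
      case False
      have "measure \<mu> {z. 1 - t \<le> norm z} \<le> 1" by simp
      also have "1 = 1 / \<epsilon> powr (1 + \<alpha>) * \<epsilon> powr (1 + \<alpha>)" using e by simp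
      also have "\<dots> \<le> K * t powr (1 + \<alpha>)"
        using K False e gt by (intro mult_mono powr_mono2) auto
      finally show ?thesis .
    qed
  qed (use e K c0 low in auto)
qed

section \<open>Rotation-invariant laws on the disk: small balls and resolvent moments\<close>

lemma dist_sgn: "x \<noteq> 0 \<Longrightarrow> dist (sgn x) x = \<bar>norm x - 1\<bar>" for x :: "'a :: real_normed_vector"
proof -
  assume x: "x \<noteq> 0"
  have "sgn x - x = (1 - norm x) *\<^sub>R sgn x" using x by (simp add: sgn_div_norm algebra_simps)
  then show ?thesis using x by (simp add: dist_norm norm_sgn abs_minus_commute)
qed

text \<open>\<open>\<beta>\<close> stands for 1 + \<alpha>. Small balls and resolvent moments are
  governed by the upper tail bound; the lower bound and the ring estimate join later, for the counts
  and gaps of the outer roots.\<close>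

locale radial_disk = prob_space \<mu> for \<mu> :: "complex measure" +
  fixes K \<beta> :: real
  assumes sets_mu[measurable_cong]: "sets \<mu> = sets borel"
    and rotation: "distr \<mu> borel (\<lambda>z. cis \<theta> * z) = \<mu>"
    and disk: "AE z in \<mu>. norm z \<le> 1"
    and K_pos: "0 < K" and beta: "0 < \<beta>" "\<beta> \<le> 1"
    and tail: "0 < t \<Longrightarrow> measure \<mu> {z. 1 - t \<le> norm z} \<le> K * t powr \<beta>"
begin

lemma space_mu[simp]: "space \<mu> = UNIV"
  using sets_eq_imp_space_eq[OF sets_mu] by simp

lemma prob_UNIV[simp]: "prob UNIV = 1"
  using prob_space by simp

lemma measure_cball_rotate:
  "measure \<mu> (cball (cis \<theta> * c) s) = measure \<mu> (cball c s)"
proof -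
  have "measure \<mu> (cball (cis \<theta> * c) s) = measure (distr \<mu> borel (\<lambda>z. cis \<theta> * z)) (cball (cis \<theta> * c) s)"
    by (simp only: rotation)
  also have "\<dots> = measure \<mu> ((\<lambda>z. cis \<theta> * z) -` cball (cis \<theta> * c) s \<inter> space \<mu>)"
    by (rule measure_distr) auto
  also have "(\<lambda>z. cis \<theta> * z) -` cball (cis \<theta> * c) s \<inter> space \<mu> = cball c s"
    by (auto simp: dist_norm norm_mult simp flip: right_diff_distrib)
  finally show ?thesis .
qed

lemma integral_rotate:
  fixes g :: "complex \<Rightarrow> complex"
  assumes "g \<in> borel_measurable borel"
  shows "(\<integral>z. g (cis \<theta> * z) \<partial>\<mu>) = (\<integral>z. g z \<partial>\<mu>)"
proof -
  have "(\<integral>z. g z \<partial>\<mu>) = (\<integral>z. g z \<partial>distr \<mu> borel (\<lambda>z. cis \<theta> * z))"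
    by (simp only: rotation)
  also have "\<dots> = (\<integral>z. g (cis \<theta> * z) \<partial>\<mu>)"
    using assms by (intro integral_distr) auto
  finally show ?thesis ..
qed


text \<open>The imaginary part sin t is already large enough: sin y - y/2 increases on [0,1], since
  cos y \<ge> cos (pi/3) = 1/2 there.\<close>

lemma (in -) norm_cis_minus_1_ge:
  assumes "\<bar>t\<bar> \<le> 1"
  shows "\<bar>t\<bar> / 2 \<le> norm (cis t - 1)"
proof -
  have sin_ge: "x / 2 \<le> sin x" if x: "0 \<le> x" "x \<le> 1" for x :: real
  proof -
    have "(\<lambda>y. sin y - y / 2) 0 \<le> (\<lambda>y. sin y - y / 2) x"
    proof (rule DERIV_nonneg_imp_nondecreasing[OF x(1)])
      fix y assume y: "0 \<le> y" "y \<le> x"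
      have "cos (pi / 3) \<le> cos y"
        using y x pi_gt3 by (intro cos_monotone_0_pi_le) auto
      then have "0 \<le> cos y - 1 / 2" by (simp add: cos_60)
      then show "\<exists>d. ((\<lambda>y. sin y - y / 2) has_real_derivative d) (at y) \<and> 0 \<le> d"
        by (intro exI[of _ "cos y - 1 / 2"] conjI) (auto intro!: derivative_eq_intros)
    qed
    then show ?thesis by simp
  qed
  have "\<bar>t\<bar> / 2 \<le> \<bar>sin t\<bar>"
    using sin_ge[of t] sin_ge[of "-t"] assms by (cases "t \<ge> 0") auto
  also have "\<dots> = \<bar>Im (cis t - 1)\<bar>" by simp
  also have "\<dots> \<le> norm (cis t - 1)" by (rule abs_Im_le_cmod)
  finally show ?thesis .
qed

text \<open>By rotation invariance all rotated copies of the ball have the same mass. About 1/(5 s)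
  disjoint copies fit into the collar of depth s, whose mass is at most K s^\<beta>, and each gets
  an equal share; this gains a factor of order s over the tail bound.\<close>

lemma cball_bound_unit:
  assumes c: "norm c = 1" and s: "0 < s"
  shows "measure \<mu> (cball c s) \<le> 10 * K * s powr (1 + \<beta>)"
proof -
  have sub: "cball (cis \<theta> * c) s \<subseteq> {z. 1 - s \<le> norm z}" for \<theta>
  proof
    fix z assume "z \<in> cball (cis \<theta> * c) s"
    moreover have "norm (cis \<theta> * c) \<le> norm z + norm (cis \<theta> * c - z)"
      by (rule norm_triangle_sub)
    ultimately show "z \<in> {z. 1 - s \<le> norm z}" using c by (simp add: dist_norm norm_mult)
  qed
  show ?thesis
  proof (cases "s \<le> 1 / 5")
    case True
    define N where "N = nat \<lfloor>1 / (5 * s)\<rfloor>"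
    have N: "real N \<le> 1 / (5 * s)" "1 / (5 * s) < real N + 1" "1 \<le> real N"
      using s True unfolding N_def by (linarith | simp add: le_floor_iff le_nat_iff field_simps)+
    have N2: "1 / (10 * s) \<le> real N"
    proof -
      have "1 / (10 * s) = 1 / (5 * s) / 2" by simp
      with N show ?thesis by linarith
    qed
    \<comment> \<open>Angles 5 s apart give chords of length at least 5 s / 2, more than the
      diameter 2 s; the choice of \<open>N\<close> keeps all angles within 1, where the chord
      estimate is valid.\<close>
    define D where "D = (\<lambda>k::nat. cball (cis (real k * (5 * s)) * c) s)"
    have "D i \<inter> D j = {}" if ij: "i < j" "j < N" for i j
    proof (rule ccontr)
      assume "D i \<inter> D j \<noteq> {}"
      then obtain z where z: "z \<in> D i" "z \<in> D j" by blast
      define t where "t = (real j - real i) * (5 * s)"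
      have "t \<le> real N * (5 * s)" unfolding t_def using ij s by (intro mult_right_mono) auto
      also have "\<dots> \<le> 1" using N s by (simp add: field_simps)
      finally have t: "5 * s \<le> t" "t \<le> 1" using ij s by (auto simp: t_def)
      have "norm (cis t - 1) = norm (cis (real i * (5 * s)) * c * (cis t - 1))"
        by (simp add: norm_mult c)
      also have "cis (real i * (5 * s)) * c * (cis t - 1) = cis (real j * (5 * s)) * c - cis (real i * (5 * s)) * c"
        by (simp add: t_def algebra_simps cis_mult)
      also have "norm \<dots> \<le> s + s"
        using z dist_triangle_le[of "cis (real j * (5 * s)) * c" z "cis (real i * (5 * s)) * c" "s + s"]
        by (simp add: D_def dist_norm norm_minus_commute)
      finally show False using norm_cis_minus_1_ge[of t] t s by simp
    qed
    then have disj: "disjoint_family_on D {..<N}"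
      unfolding disjoint_family_on_def by (metis Int_commute lessThan_iff linorder_neqE_nat)
    have "real N * measure \<mu> (cball c s) = (\<Sum>k<N. measure \<mu> (D k))"
      by (simp add: D_def measure_cball_rotate)
    also have "\<dots> = measure \<mu> (\<Union>k<N. D k)"
      using disj by (intro finite_measure_finite_Union[symmetric]) (auto simp: D_def sets_mu)
    also have "\<dots> \<le> measure \<mu> {z. 1 - s \<le> norm z}"
      using sub by (intro finite_measure_mono) (auto simp: D_def)
    also have "\<dots> \<le> K * s powr \<beta>" using s by (rule tail)
    finally have *: "real N * measure \<mu> (cball c s) \<le> K * s powr \<beta>" .
    have "1 / (10 * s) * measure \<mu> (cball c s) \<le> real N * measure \<mu> (cball c s)"
      using N2 by (intro mult_right_mono) auto
    with * have "1 / (10 * s) * measure \<mu> (cball c s) \<le> K * s powr \<beta>" by linarith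
    then show ?thesis using s by (simp add: field_simps powr_add)
  next
    case False
    have "measure \<mu> (cball c s) \<le> measure \<mu> {z. 1 - s \<le> norm z}"
      using sub[of 0] by (intro finite_measure_mono) auto
    also have "\<dots> \<le> K * s powr \<beta>" using s by (rule tail)
    \<comment> \<open>For s > 1/5 the factor 10 s exceeds 1, so the tail bound alone is
      enough.\<close>
    also have "\<dots> \<le> 10 * K * s powr \<beta> * s" using s False K_pos by simp
    finally show ?thesis using s by (simp add: powr_add mult_ac)
  qed
qed

text \<open>Recentring at the nearest point of the circle doubles the radius, which costs
  2^(1+\<beta>) \<le> 4.\<close>

lemma cball_bound:
  assumes x: "\<bar>norm x - 1\<bar> \<le> s" and s: "0 < s" "s < 1"
  shows "measure \<mu> (cball x s) \<le> 40 * K * s powr (1 + \<beta>)"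
proof -
  have "x \<noteq> 0" using x s by auto
  with dist_sgn[of x] x have "cball x s \<subseteq> cball (sgn x) (2 * s)"
    using dist_triangle_le[of "sgn x" x _ "2 * s"] by (force simp: dist_commute)
  then have "measure \<mu> (cball x s) \<le> measure \<mu> (cball (sgn x) (2 * s))"
    by (intro finite_measure_mono) auto
  also have "\<dots> \<le> 10 * K * (2 * s) powr (1 + \<beta>)"
    using \<open>x \<noteq> 0\<close> s by (intro cball_bound_unit) (auto simp: norm_sgn)
  also have "\<dots> = 10 * K * (2 powr (1 + \<beta>) * s powr (1 + \<beta>))" using s by (simp add: powr_mult)
  also have "2 powr (1 + \<beta>) \<le> 2 powr 2" using beta by (intro powr_mono) auto
  finally show ?thesis using K_pos by (simp add: mult_left_mono mult_right_mono)
qed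

lemma integrable_bounded:
  fixes g :: "complex \<Rightarrow> 'b::{banach, second_countable_topology}"
  assumes "g \<in> borel_measurable borel" "\<And>z. norm z \<le> 1 \<Longrightarrow> norm (g z) \<le> B"
  shows "integrable \<mu> g"
  using disk assms by (intro integrable_const_bound[of _ B]) (auto elim!: eventually_mono)

text \<open>Rotation by pi/k turns z^k into -z^k and leaves \<phi> unchanged, so the integral equals
  its own negative.\<close>

lemma radial_moment_zero:
  fixes \<phi> :: "complex \<Rightarrow> real"
  assumes [measurable]: "\<phi> \<in> borel_measurable borel"
    and rad: "\<And>\<theta> z. \<phi> (cis \<theta> * z) = \<phi> z" and k: "0 < k"
  shows "(\<integral>z. of_real (\<phi> z) * z ^ k \<partial>\<mu>) = 0"
proof -
  have "cis (pi / k) ^ k = -1" using k by (simp add: Complex.DeMoivre cis_pi)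
  then have "(\<integral>z. of_real (\<phi> z) * z ^ k \<partial>\<mu>) = (\<integral>z. - (of_real (\<phi> z) * z ^ k) \<partial>\<mu>)"
    by (subst integral_rotate[of _ "pi / k", symmetric]) (auto simp: rad power_mult_distrib)
  then show ?thesis by (simp add: complex_eq_iff)
qed

lemma norm_diff_ge:
  assumes "norm z \<le> 1" "1 < norm c"
  shows "norm c - 1 \<le> norm (c - z)" "c \<noteq> z"
  using norm_triangle_ineq2[of c z] assms by auto

text \<open>In the expansion of 1/(c - z) in powers of z/c the moments of positive order vanish by
  rotation invariance, and the remainder decays like |c|^(-N). The radial weight allows two uses:
  \<phi> = 1 gives the mean of the resolvent, and a weight of Poisson type gives its second
  moment.\<close>

lemma radial_resolvent:
  fixes \<phi> :: "complex \<Rightarrow> real"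
  assumes [measurable]: "\<phi> \<in> borel_measurable borel"
    and rad: "\<And>\<theta> z. \<phi> (cis \<theta> * z) = \<phi> z"
    and bd: "\<And>z. norm z \<le> 1 \<Longrightarrow> \<bar>\<phi> z\<bar> \<le> B" and c: "1 < norm c"
  shows "(\<integral>z. of_real (\<phi> z) / (c - z) \<partial>\<mu>) = of_real (\<integral>z. \<phi> z \<partial>\<mu>) / c"
proof -
  let ?I = "\<integral>z. of_real (\<phi> z) / (c - z) \<partial>\<mu>" and ?J = "of_real (\<integral>z. \<phi> z \<partial>\<mu>) / c :: complex"
  have c0: "c \<noteq> 0" using c by auto
  have B: "0 \<le> B" using bd[of 0] by auto
  let ?D = "B / (norm c - 1)"
  have est: "norm (?I - ?J) \<le> ?D * (1 / norm c) ^ Suc N" for N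
  proof -
    let ?r = "\<lambda>z. of_real (\<phi> z) * z ^ Suc N / (c ^ Suc N * (c - z))"
    have expand: "of_real (\<phi> z) / (c - z) = (\<Sum>k\<le>N. of_real (\<phi> z) * z ^ k / c ^ Suc k) + ?r z"
      if "norm z \<le> 1" for z
    proof -
      have "c \<noteq> z" using norm_diff_ge[OF that c] by auto
      then have "1 / (c - z) = (\<Sum>k\<le>N. z ^ k / c ^ Suc k) + z ^ Suc N / (c ^ Suc N * (c - z))"
      proof (induction N)
        case (Suc N)
        have "z ^ Suc N / (c ^ Suc N * (c - z)) = z ^ Suc N / c ^ Suc (Suc N)
          + z ^ Suc (Suc N) / (c ^ Suc (Suc N) * (c - z))"
          using \<open>c \<noteq> z\<close> c0 by (simp add: divide_simps) (simp add: algebra_simps)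
        with Suc show ?case by simp
      qed (use \<open>c \<noteq> z\<close> c0 in \<open>simp add: divide_simps\<close>)
      then have "of_real (\<phi> z) * (1 / (c - z))
          = of_real (\<phi> z) * ((\<Sum>k\<le>N. z ^ k / c ^ Suc k) + z ^ Suc N / (c ^ Suc N * (c - z)))" by simp
      then show ?thesis by (simp add: distrib_left sum_distrib_left)
    qed
    have rb: "norm (?r z) \<le> ?D * (1 / norm c) ^ Suc N" if z: "norm z \<le> 1" for z
    proof -
      have "norm (?r z) = \<bar>\<phi> z\<bar> * norm z ^ Suc N / (norm c ^ Suc N * norm (c - z))"
        by (simp add: norm_mult norm_divide norm_power)
      also have "\<dots> \<le> B * 1 / (norm c ^ Suc N * (norm c - 1))"
        using z c B bd[OF z] norm_diff_ge[OF z c]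
        by (intro frac_le mult_mono power_le_one mult_pos_pos zero_less_power) auto
      finally show ?thesis by (simp add: power_one_over field_simps)
    qed
    have int: "integrable \<mu> (\<lambda>z. of_real (\<phi> z) * z ^ k / c ^ Suc k)" for k
    proof (rule integrable_bounded)
      show "norm (of_real (\<phi> z) * z ^ k / c ^ Suc k) \<le> B" if "norm z \<le> 1" for z
      proof -
        have "norm (of_real (\<phi> z) * z ^ k / c ^ Suc k) = \<bar>\<phi> z\<bar> * norm z ^ k / norm c ^ Suc k"
          by (simp add: norm_mult norm_divide norm_power)
        also have "\<dots> \<le> B * 1 / 1"
          using that c B bd[OF that] by (intro frac_le mult_mono power_le_one) (auto simp: one_le_power simp del: power_Suc)
        finally show ?thesis by simp
      qed
    qed measurable
    have intr: "integrable \<mu> ?r"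
      by (rule integrable_bounded[OF _ rb]) measurable
    have "?I = (\<integral>z. (\<Sum>k\<le>N. of_real (\<phi> z) * z ^ k / c ^ Suc k) + ?r z \<partial>\<mu>)"
    proof (rule integral_cong_AE)
      show "AE z in \<mu>. of_real (\<phi> z) / (c - z) = (\<Sum>k\<le>N. of_real (\<phi> z) * z ^ k / c ^ Suc k) + ?r z"
        using disk by eventually_elim (rule expand)
    qed measurable
    also have "\<dots> = (\<Sum>k\<le>N. \<integral>z. of_real (\<phi> z) * z ^ k / c ^ Suc k \<partial>\<mu>) + (\<integral>z. ?r z \<partial>\<mu>)"
      using int intr by (subst Bochner_Integration.integral_add) (auto intro!: Bochner_Integration.integrable_sum)
    also have "(\<Sum>k\<le>N. \<integral>z. of_real (\<phi> z) * z ^ k / c ^ Suc k \<partial>\<mu>) = (\<Sum>k\<le>N. if k = 0 then ?J else 0)"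
    proof (intro sum.cong refl)
      fix k
      show "(\<integral>z. of_real (\<phi> z) * z ^ k / c ^ Suc k \<partial>\<mu>) = (if k = 0 then ?J else 0)"
        using radial_moment_zero[OF assms(1) rad, of k] by (cases "k = 0") (auto simp del: power_Suc)
    qed
    finally have "?I - ?J = (\<integral>z. ?r z \<partial>\<mu>)" by simp
    also have "norm \<dots> \<le> (\<integral>z. norm (?r z) \<partial>\<mu>)" by (rule integral_norm_bound)
    also have "\<dots> \<le> (\<integral>z. ?D * (1 / norm c) ^ Suc N \<partial>\<mu>)"
    proof (rule integral_mono_AE)
      show "AE z in \<mu>. norm (?r z) \<le> ?D * (1 / norm c) ^ Suc N"
        using disk by eventually_elim (rule rb)
    qed (use intr in auto)
    also have "\<dots> = ?D * (1 / norm c) ^ Suc N" by (simp add: prob_space del: power_Suc)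
    finally show ?thesis .
  qed
  have "(\<lambda>N. ?D * (1 / norm c) ^ Suc N) \<longlonglongrightarrow> ?D * 0"
    using c by (intro tendsto_mult[OF tendsto_const] LIMSEQ_Suc LIMSEQ_power_zero)
      (simp add: divide_less_eq)
  then have "norm (?I - ?J) \<le> ?D * 0"
    by (rule LIMSEQ_le_const) (use est in auto)
  then show ?thesis by simp
qed

lemma resolvent_mean: "1 < norm c \<Longrightarrow> (\<integral>z. 1 / (c - z) \<partial>\<mu>) = 1 / c"
  using radial_resolvent[of "\<lambda>_. 1" 1 c] by (simp add: prob_space)

text \<open>On each circle, \<open>1 / \<bar>c - z\<bar>\<^sup>2\<close> is a multiple of the Poisson kernel, so averaging over the
  circle replaces it by \<open>1 / (\<bar>c\<bar>\<^sup>2 - \<bar>z\<bar>\<^sup>2)\<close>.\<close>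
lemma resolvent_second_moment:
  assumes c: "norm c = 1 + h" and h: "0 < h" and u: "0 < u"
  shows "(\<integral>z. 1 / (norm (c - z))\<^sup>2 \<partial>\<mu>) \<le> 1 / u + K * u powr \<beta> / h"
proof -
  define \<phi> where "\<phi> = (\<lambda>z::complex. if norm z \<le> 1 then 1 / ((norm c)\<^sup>2 - (norm z)\<^sup>2) else 0)"
  have [measurable]: "\<phi> \<in> borel_measurable borel" unfolding \<phi>_def by measurable
  have c1: "1 < norm c" "c \<noteq> 0" using c h by auto
  have gap: "(norm c)\<^sup>2 - (norm z)\<^sup>2 \<ge> h + (1 - norm z)" if z: "norm z \<le> 1" for z
  proof -
    have "(norm c)\<^sup>2 - (norm z)\<^sup>2 = (norm c - norm z) * (norm c + norm z)"
      by (simp add: power2_eq_square algebra_simps)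
    also have "\<dots> \<ge> (norm c - norm z) * 1" using z c h by (intro mult_left_mono) auto
    finally show ?thesis using c by simp
  qed
  have \<phi>0: "0 \<le> \<phi> z" for z
  proof (cases "norm z \<le> 1")
    case True
    then have "0 \<le> (norm c)\<^sup>2 - (norm z)\<^sup>2" using gap[OF True] h by linarith
    then show ?thesis by (simp add: \<phi>_def del: diff_ge_0_iff_ge)
  qed (simp add: \<phi>_def)
  have \<phi>b: "\<phi> z \<le> 1 / h" for z
    using gap[of z] h by (auto simp: \<phi>_def intro!: divide_left_mono mult_pos_pos)
  \<comment> \<open>2 Re(c/(c - z)) - 1 is the Poisson kernel (|c|^2 - |z|^2)/|c - z|^2. Written
    this way, 1/|c - z|^2 is linear in the weighted resolvent, whose integral is known.\<close>
  have poisson: "1 / (norm (c - z))\<^sup>2 = Re (of_real (\<phi> z) / (c - z) * (2 * c)) - \<phi> z" if z: "norm z \<le> 1" for z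
  proof -
    have cz: "c \<noteq> z" using norm_diff_ge[OF z c1(1)] by auto
    have D: "(norm c)\<^sup>2 - (norm z)\<^sup>2 \<noteq> 0" using gap[OF z] h z by linarith
    have cz0: "norm (c - z) \<noteq> 0" using cz by simp
    have "Re (of_real (\<phi> z) / (c - z) * (2 * c)) - \<phi> z = \<phi> z * (2 * Re (c / (c - z)) - 1)"
    proof -
      have "of_real (\<phi> z) / (c - z) * (2 * c) = of_real (2 * \<phi> z) * (c / (c - z))"
        by simp
      then have "Re (of_real (\<phi> z) / (c - z) * (2 * c)) = 2 * \<phi> z * Re (c / (c - z))"
        by (simp only: Re_complex_of_real Im_complex_of_real times_complex.sel)
      then show ?thesis by (simp add: algebra_simps)
    qed
    also have "2 * Re (c / (c - z)) - 1 = ((norm c)\<^sup>2 - (norm z)\<^sup>2) / (norm (c - z))\<^sup>2"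
    proof -
      have "c / (c - z) = c * cnj (c - z) / of_real ((norm (c - z))\<^sup>2)"
        using complex_div_cnj by blast
      then have "Re (c / (c - z)) = Re (c * cnj (c - z)) / (norm (c - z))\<^sup>2"
        by (simp only: Re_divide_of_real)
      moreover have "2 * Re (c * cnj (c - z)) - (norm (c - z))\<^sup>2 = (norm c)\<^sup>2 - (norm z)\<^sup>2"
        unfolding cmod_power2 by (simp add: algebra_simps power2_eq_square)
      ultimately show ?thesis using cz0 by (simp add: field_simps)
    qed
    also have "\<phi> z * \<dots> = 1 / (norm (c - z))\<^sup>2" using z D cz0
      by (simp add: \<phi>_def del: power_eq_iff_eq_base power2_eq_iff_nonneg)
    finally show ?thesis ..
  qed
  have int\<phi>: "integrable \<mu> \<phi>" using \<phi>0 \<phi>b by (intro integrable_bounded[of _ "1 / h"]) auto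
  have int: "integrable \<mu> (\<lambda>z. of_real (\<phi> z) / (c - z))"
  proof (rule integrable_bounded)
    show "norm (of_real (\<phi> z) / (c - z)) \<le> (1 / h) / h" if "norm z \<le> 1" for z
    proof -
      have "norm (of_real (\<phi> z) / (c - z)) = \<phi> z / norm (c - z)"
        using \<phi>0[of z] by (simp add: norm_divide)
      also have "\<dots> \<le> (1 / h) / h"
        using \<phi>0[of z] \<phi>b[of z] norm_diff_ge[OF that c1(1)] c h by (intro frac_le) auto
      finally show ?thesis .
    qed
  qed measurable
  have "(\<integral>z. 1 / (norm (c - z))\<^sup>2 \<partial>\<mu>) = (\<integral>z. Re (of_real (\<phi> z) / (c - z) * (2 * c)) - \<phi> z \<partial>\<mu>)"
  proof (rule integral_cong_AE)
    show "AE z in \<mu>. 1 / (norm (c - z))\<^sup>2 = Re (of_real (\<phi> z) / (c - z) * (2 * c)) - \<phi> z"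
      using disk by eventually_elim (rule poisson)
  qed measurable
  also have "\<dots> = Re ((\<integral>z. of_real (\<phi> z) / (c - z) \<partial>\<mu>) * (2 * c)) - (\<integral>z. \<phi> z \<partial>\<mu>)"
  proof -
    have i2: "integrable \<mu> (\<lambda>z. of_real (\<phi> z) / (c - z) * (2 * c))"
      using int by (rule integrable_mult_left)
    have "(\<integral>z. Re (of_real (\<phi> z) / (c - z) * (2 * c)) - \<phi> z \<partial>\<mu>)
        = (\<integral>z. Re (of_real (\<phi> z) / (c - z) * (2 * c)) \<partial>\<mu>) - (\<integral>z. \<phi> z \<partial>\<mu>)"
      using integrable_Re[OF i2] int\<phi> by (rule Bochner_Integration.integral_diff)
    also have "(\<integral>z. Re (of_real (\<phi> z) / (c - z) * (2 * c)) \<partial>\<mu>)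
        = Re (\<integral>z. of_real (\<phi> z) / (c - z) * (2 * c) \<partial>\<mu>)"
      using i2 by (rule integral_Re)
    also have "(\<integral>z. of_real (\<phi> z) / (c - z) * (2 * c) \<partial>\<mu>)
        = (\<integral>z. of_real (\<phi> z) / (c - z) \<partial>\<mu>) * (2 * c)"
      by (rule integral_mult_left_zero)
    finally show ?thesis .
  qed
  also have "(\<integral>z. of_real (\<phi> z) / (c - z) \<partial>\<mu>) = of_real (\<integral>z. \<phi> z \<partial>\<mu>) / c"
  proof (rule radial_resolvent)
    show "\<bar>\<phi> z\<bar> \<le> 1 / h" for z using \<phi>0[of z] \<phi>b[of z] by simp
  qed (use c1 in \<open>auto simp: \<phi>_def norm_mult\<close>)
  also have "Re (of_real (\<integral>z. \<phi> z \<partial>\<mu>) / c * (2 * c)) - (\<integral>z. \<phi> z \<partial>\<mu>) = (\<integral>z. \<phi> z \<partial>\<mu>)"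
    using c1 by simp
  \<comment> \<open>At depth more than u the weight is at most 1/u; the collar of depth u has mass
    at most K u^\<beta> and weight at most 1/h. The parameter u stays free so that the two can be
    balanced.\<close>
  also have "\<dots> \<le> (\<integral>z. 1 / u + 1 / h * indicator {z. 1 - u \<le> norm z} z \<partial>\<mu>)"
  proof (rule integral_mono_AE)
    show "AE z in \<mu>. \<phi> z \<le> 1 / u + 1 / h * indicator {z. 1 - u \<le> norm z} z"
      using disk
    proof eventually_elim
      case (elim z)
      have "\<phi> z \<le> 1 / u" if "norm z < 1 - u"
        using gap[OF elim] elim that h u by (auto simp: \<phi>_def intro!: divide_left_mono mult_pos_pos)
      then show ?case using \<phi>b[of z] u by (auto simp: indicator_def not_le intro: add_increasing)
    qed
  qed (use int\<phi> in \<open>auto intro!: integrable_add integrable_mult_right simp: integrable_indicator_iff less_top[symmetric]\<close>)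
  also have "\<dots> = 1 / u + 1 / h * measure \<mu> {z. 1 - u \<le> norm z}"
    by (subst Bochner_Integration.integral_add) (auto simp: prob_space less_top[symmetric])
  also have "\<dots> \<le> 1 / u + 1 / h * (K * u powr \<beta>)"
    using tail[OF u] h by (intro add_left_mono mult_left_mono) auto
  finally show ?thesis by simp
qed

end

section \<open>Sums of independent variables\<close>

text \<open>Fubini for the product law: once X = x in S is fixed, independence leaves the pair
  condition as an event about Y of probability at most b.\<close>

lemma (in prob_space) indep_pair_bound:
  fixes X Y :: "'a \<Rightarrow> complex"
  assumes ind: "indep_var borel X borel Y" and N: "distr M borel Y = N"
    and S[measurable]: "S \<in> sets borel" and T[measurable]: "T \<in> sets (borel \<Otimes>\<^sub>M borel)"
    and b: "\<And>x. x \<in> S \<Longrightarrow> measure N {y. (x, y) \<in> T} \<le> b"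
  shows "prob {\<omega> \<in> space M. X \<omega> \<in> S \<and> (X \<omega>, Y \<omega>) \<in> T} \<le> prob {\<omega> \<in> space M. X \<omega> \<in> S} * b"
proof -
  have [measurable]: "X \<in> borel_measurable M" "Y \<in> borel_measurable M"
    using ind by (auto dest: indep_var_rv1 indep_var_rv2)
  interpret N: prob_space N unfolding N[symmetric] by (rule prob_space_distr) simp
  have sN[measurable_cong]: "sets N = sets borel" using N by auto
  show ?thesis
  proof (cases "S = {}")
    case False
    have b0: "0 \<le> b" using b False measure_nonneg order_trans by (metis all_not_in_conv)
    let ?PX = "distr M borel X"
    interpret PX: prob_space ?PX by (rule prob_space_distr) simp
    have D: "?PX \<Otimes>\<^sub>M N = distr M (borel \<Otimes>\<^sub>M borel) (\<lambda>x. (X x, Y x))"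
      using ind unfolding indep_var_distribution_eq N by blast
    let ?U = "{p. fst p \<in> S \<and> p \<in> T}"
    have [measurable]: "?U \<in> sets (borel \<Otimes>\<^sub>M borel)"
    proof -
      have "?U = {p \<in> space (borel \<Otimes>\<^sub>M borel). fst p \<in> S \<and> p \<in> T}" by (auto simp: space_pair_measure)
      also have "\<dots> \<in> sets (borel \<Otimes>\<^sub>M borel)" by measurable
      finally show ?thesis .
    qed
    have "emeasure M {\<omega> \<in> space M. X \<omega> \<in> S \<and> (X \<omega>, Y \<omega>) \<in> T}
        = emeasure (distr M (borel \<Otimes>\<^sub>M borel) (\<lambda>x. (X x, Y x))) ?U"
      by (subst emeasure_distr) (auto intro!: arg_cong[where f="emeasure M"])
    also have "\<dots> = emeasure (?PX \<Otimes>\<^sub>M N) ?U" by (simp only: D)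
    also have "\<dots> = (\<integral>\<^sup>+ x. emeasure N (Pair x -` ?U) \<partial>?PX)"
      by (rule N.emeasure_pair_measure_alt) simp
    also have "\<dots> \<le> (\<integral>\<^sup>+ x. ennreal b * indicator S x \<partial>?PX)"
    proof (rule nn_integral_mono)
      fix x
      have "Pair x -` ?U = (if x \<in> S then {y. (x, y) \<in> T} else {})" by auto
      then show "emeasure N (Pair x -` ?U) \<le> ennreal b * indicator S x"
        using b[of x] by (auto simp: N.emeasure_eq_measure intro!: ennreal_leI)
    qed
    also have "\<dots> = ennreal b * emeasure ?PX S" by (simp add: nn_integral_cmult_indicator)
    also have "emeasure ?PX S = emeasure M {\<omega> \<in> space M. X \<omega> \<in> S}"
      by (subst emeasure_distr) (auto intro!: arg_cong[where f="emeasure M"])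
    finally show ?thesis
      using b0 by (simp add: emeasure_eq_measure ennreal_mult[symmetric] mult.commute)
  qed simp
qed

text \<open>Independence and zero means kill the off-diagonal terms of the double sum; the uniform
  bound B supplies integrability.\<close>

lemma (in prob_space) expectation_sum_square:
  fixes Y :: "'i \<Rightarrow> 'a \<Rightarrow> real"
  assumes fin: "finite I" and ind: "indep_vars (\<lambda>_. borel) Y I"
    and Yb: "\<And>i \<omega>. i \<in> I \<Longrightarrow> \<omega> \<in> space M \<Longrightarrow> \<bar>Y i \<omega>\<bar> \<le> B"
    and mean: "\<And>i. i \<in> I \<Longrightarrow> expectation (Y i) = 0"
  shows "expectation (\<lambda>\<omega>. (\<Sum>i\<in>I. Y i \<omega>)\<^sup>2) = (\<Sum>i\<in>I. expectation (\<lambda>\<omega>. (Y i \<omega>)\<^sup>2))"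
proof -
  have m[measurable]: "Y i \<in> borel_measurable M" if "i \<in> I" for i
    using ind that by (auto simp: indep_vars_def)
  have int: "integrable M (Y i)" if "i \<in> I" for i
    using Yb that m by (intro integrable_const_bound[of _ B]) auto
  have intp: "integrable M (\<lambda>\<omega>. Y i \<omega> * Y j \<omega>)" if "i \<in> I" "j \<in> I" for i j
    using Yb that m by (intro integrable_const_bound[of _ "B * B"])
      (auto simp: abs_mult intro!: AE_I2 mult_mono order_trans[OF abs_ge_zero])
  have cross: "expectation (\<lambda>\<omega>. Y i \<omega> * Y j \<omega>) = (if i = j then expectation (\<lambda>\<omega>. (Y i \<omega>)\<^sup>2) else 0)"
    if "i \<in> I" "j \<in> I" for i j
  proof (cases "i = j")
    case False
    have "expectation (\<lambda>\<omega>. \<Prod>k\<in>{i, j}. Y k \<omega>) = (\<Prod>k\<in>{i, j}. expectation (Y k))"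
      using that int by (intro indep_vars_lebesgue_integral indep_vars_subset[OF ind]) auto
    with False mean[OF that(1)] show ?thesis by simp
  qed (simp add: power2_eq_square)
  have "expectation (\<lambda>\<omega>. (\<Sum>i\<in>I. Y i \<omega>)\<^sup>2) = expectation (\<lambda>\<omega>. \<Sum>i\<in>I. \<Sum>j\<in>I. Y i \<omega> * Y j \<omega>)"
    by (simp add: power2_eq_square sum_product)
  also have "\<dots> = (\<Sum>i\<in>I. \<Sum>j\<in>I. expectation (\<lambda>\<omega>. Y i \<omega> * Y j \<omega>))"
    using intp by (subst Bochner_Integration.integral_sum | rule Bochner_Integration.integrable_sum sum.cong refl)+ auto
  also have "\<dots> = (\<Sum>i\<in>I. expectation (\<lambda>\<omega>. (Y i \<omega>)\<^sup>2))"
    using fin by (intro sum.cong refl) (simp add: cross)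
  finally show ?thesis .
qed

text \<open>V bounds the raw second moment, which dominates the variance and is what the resolvent
  estimates deliver.\<close>

lemma (in prob_space) Chebyshev_indep_sum:
  fixes Y :: "'i \<Rightarrow> 'a \<Rightarrow> real"
  assumes fin: "finite I" and ind: "indep_vars (\<lambda>_. borel) Y I"
    and Yb: "\<And>i \<omega>. i \<in> I \<Longrightarrow> \<omega> \<in> space M \<Longrightarrow> \<bar>Y i \<omega>\<bar> \<le> B"
    and sq: "\<And>i. i \<in> I \<Longrightarrow> expectation (\<lambda>\<omega>. (Y i \<omega>)\<^sup>2) \<le> V"
    and mean: "\<And>i. i \<in> I \<Longrightarrow> expectation (Y i) = m"
    and t: "0 < t"
  shows "prob {\<omega> \<in> space M. t \<le> \<bar>(\<Sum>i\<in>I. Y i \<omega>) - real (card I) * m\<bar>} \<le> real (card I) * V / t\<^sup>2"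
proof -
  have ym[measurable]: "Y i \<in> borel_measurable M" if "i \<in> I" for i
    using ind that by (auto simp: indep_vars_def)
  have int: "integrable M (Y i)" if "i \<in> I" for i
    using Yb that ym by (intro integrable_const_bound[of _ B]) auto
  have int2: "integrable M (\<lambda>\<omega>. (Y i \<omega>)\<^sup>2)" if "i \<in> I" for i
  proof (rule integrable_const_bound[of _ "B\<^sup>2"])
    have "(Y i \<omega>)\<^sup>2 \<le> B\<^sup>2" if "\<omega> \<in> space M" for \<omega>
      using Yb[OF \<open>i \<in> I\<close> that] power_mono[of "\<bar>Y i \<omega>\<bar>" B 2] by simp
    then show "AE \<omega> in M. norm ((Y i \<omega>)\<^sup>2) \<le> B\<^sup>2" by simp
  qed (use that ym in measurable)
  define Z where "Z = (\<lambda>i \<omega>. Y i \<omega> - m)"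
  have indZ: "indep_vars (\<lambda>_. borel) Z I"
    unfolding Z_def by (rule indep_vars_compose2[OF ind]) auto
  have Zm: "expectation (Z i) = 0" if "i \<in> I" for i
    using int[OF that] mean[OF that] by (simp add: Z_def prob_space)
  have ZV: "expectation (\<lambda>\<omega>. (Z i \<omega>)\<^sup>2) \<le> V" if i: "i \<in> I" for i
  proof -
    have "expectation (\<lambda>\<omega>. (Z i \<omega>)\<^sup>2) = expectation (\<lambda>\<omega>. (Y i \<omega>)\<^sup>2) - (expectation (Y i))\<^sup>2"
      unfolding Z_def mean[OF i, symmetric] by (rule variance_eq) (use int[OF i] int2[OF i] in auto)
    then show ?thesis using sq[OF i] by (simp add: add_increasing2 diff_le_eq)
  qed
  have Zb: "\<bar>Z i \<omega>\<bar> \<le> B + \<bar>m\<bar>" if "i \<in> I" "\<omega> \<in> space M" for i \<omega>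
    using Yb[OF that] by (simp add: Z_def)
  have Zmeas[measurable]: "Z i \<in> borel_measurable M" if "i \<in> I" for i
    using that by (simp add: Z_def)
  let ?S = "\<lambda>\<omega>. \<Sum>i\<in>I. Z i \<omega>"
  have S0: "expectation ?S = 0"
    using Zm int by (subst Bochner_Integration.integral_sum) (auto simp: Z_def)
  have eq: "(\<Sum>i\<in>I. Y i \<omega>) - real (card I) * m = ?S \<omega>" for \<omega>
    by (simp add: Z_def sum_subtractf)
  have Sm: "?S \<in> borel_measurable M" by measurable
  have "prob {\<omega> \<in> space M. t \<le> \<bar>?S \<omega> - expectation ?S\<bar>} \<le> variance ?S / t\<^sup>2"
  proof (rule Chebyshev_inequality[OF Sm _ t])
    have "\<bar>?S \<omega>\<bar> \<le> real (card I) * (B + \<bar>m\<bar>)" if "\<omega> \<in> space M" for \<omega>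
      using Zb that by (intro order_trans[OF sum_abs] sum_bounded_above) auto
    then have "(?S \<omega>)\<^sup>2 \<le> (real (card I) * (B + \<bar>m\<bar>))\<^sup>2" if "\<omega> \<in> space M" for \<omega>
      using that by (subst abs_le_square_iff[symmetric]) (meson abs_ge_self order_trans)
    then show "integrable M (\<lambda>\<omega>. (?S \<omega>)\<^sup>2)"
      by (intro integrable_const_bound[of _ "(real (card I) * (B + \<bar>m\<bar>))\<^sup>2"]) auto
  qed
  also have "variance ?S = (\<Sum>i\<in>I. expectation (\<lambda>\<omega>. (Z i \<omega>)\<^sup>2))"
    unfolding S0 using expectation_sum_square[OF fin indZ Zb Zm] by simp
  also have "\<dots> \<le> real (card I) * V" using ZV by (intro sum_bounded_above) auto
  finally show ?thesis using t S0 by (simp add: eq divide_right_mono)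
qed

text \<open>If the modulus of the deviation reaches t, its real or its imaginary part reaches t/2;
  two real estimates at t/2 give the factor 2 * 4 = 8.\<close>

lemma (in prob_space) Chebyshev_indep_sum_complex:
  fixes Y :: "'i \<Rightarrow> 'a \<Rightarrow> complex"
  assumes fin: "finite I" and ind: "indep_vars (\<lambda>_. borel) Y I"
    and Yb: "\<And>i \<omega>. i \<in> I \<Longrightarrow> \<omega> \<in> space M \<Longrightarrow> norm (Y i \<omega>) \<le> B"
    and sq: "\<And>i. i \<in> I \<Longrightarrow> expectation (\<lambda>\<omega>. (norm (Y i \<omega>))\<^sup>2) \<le> V"
    and mean: "\<And>i. i \<in> I \<Longrightarrow> expectation (Y i) = m"
    and t: "0 < t"
  shows "prob {\<omega> \<in> space M. t \<le> norm ((\<Sum>i\<in>I. Y i \<omega>) - of_nat (card I) * m)} \<le> 8 * real (card I) * V / t\<^sup>2"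
proof -
  have ym[measurable]: "Y i \<in> borel_measurable M" if "i \<in> I" for i
    using ind that by (auto simp: indep_vars_def)
  have int: "integrable M (Y i)" if "i \<in> I" for i
    using Yb that ym by (intro integrable_const_bound[of _ B]) auto
  have int2: "integrable M (\<lambda>\<omega>. (norm (Y i \<omega>))\<^sup>2)" if "i \<in> I" for i
    using Yb that ym by (intro integrable_const_bound[of _ "B * B"])
      (auto simp: abs_mult power2_eq_square intro!: AE_I2 mult_mono order_trans[OF norm_ge_zero])
  have part: "prob {\<omega> \<in> space M. t / 2 \<le> \<bar>(\<Sum>i\<in>I. f (Y i \<omega>)) - real (card I) * f m\<bar>} \<le> real (card I) * V / (t / 2)\<^sup>2"
    if f: "f = Re \<or> f = Im" for f
  proof (rule Chebyshev_indep_sum[OF fin])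
    have [measurable]: "f \<in> borel_measurable borel" using f by auto
    have le: "\<bar>f z\<bar> \<le> norm z" for z using f by (auto simp: abs_Re_le_cmod abs_Im_le_cmod)
    show "indep_vars (\<lambda>_. borel) (\<lambda>i \<omega>. f (Y i \<omega>)) I"
      by (rule indep_vars_compose2[OF ind]) auto
    show "\<bar>f (Y i \<omega>)\<bar> \<le> B" if "i \<in> I" "\<omega> \<in> space M" for i \<omega>
      using Yb[OF that] le order_trans by blast
    show "expectation (\<lambda>\<omega>. (f (Y i \<omega>))\<^sup>2) \<le> V" if i: "i \<in> I" for i
    proof -
      have "expectation (\<lambda>\<omega>. (f (Y i \<omega>))\<^sup>2) \<le> expectation (\<lambda>\<omega>. (norm (Y i \<omega>))\<^sup>2)"
      proof (rule integral_mono)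
        have p: "(f (Y i \<omega>))\<^sup>2 \<le> (norm (Y i \<omega>))\<^sup>2" for \<omega>
          using le[of "Y i \<omega>"] by (metis abs_le_square_iff abs_norm_cancel)
        then show "(f (Y i \<omega>))\<^sup>2 \<le> (norm (Y i \<omega>))\<^sup>2" for \<omega> .
        show "integrable M (\<lambda>\<omega>. (f (Y i \<omega>))\<^sup>2)"
          using p i by (intro Bochner_Integration.integrable_bound[OF int2[OF i]]) auto
      qed (use int2[OF i] in auto)
      then show ?thesis using sq[OF i] by linarith
    qed
    show "expectation (\<lambda>\<omega>. f (Y i \<omega>)) = f m" if i: "i \<in> I" for i
      using f int[OF i] mean[OF i] by auto
  qed (use t in auto)
  have "prob {\<omega> \<in> space M. t \<le> norm ((\<Sum>i\<in>I. Y i \<omega>) - of_nat (card I) * m)}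
     \<le> prob ({\<omega> \<in> space M. t / 2 \<le> \<bar>(\<Sum>i\<in>I. Re (Y i \<omega>)) - real (card I) * Re m\<bar>}
         \<union> {\<omega> \<in> space M. t / 2 \<le> \<bar>(\<Sum>i\<in>I. Im (Y i \<omega>)) - real (card I) * Im m\<bar>})"
  proof (rule finite_measure_mono)
    have "norm ((\<Sum>i\<in>I. Y i \<omega>) - of_nat (card I) * m)
        \<le> \<bar>(\<Sum>i\<in>I. Re (Y i \<omega>)) - real (card I) * Re m\<bar> + \<bar>(\<Sum>i\<in>I. Im (Y i \<omega>)) - real (card I) * Im m\<bar>" for \<omega>
      using cmod_le[of "(\<Sum>i\<in>I. Y i \<omega>) - of_nat (card I) * m"] by simp
    from order_trans[OF _ this] show "{\<omega> \<in> space M. t \<le> norm ((\<Sum>i\<in>I. Y i \<omega>) - of_nat (card I) * m)}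
       \<subseteq> {\<omega> \<in> space M. t / 2 \<le> \<bar>(\<Sum>i\<in>I. Re (Y i \<omega>)) - real (card I) * Re m\<bar>}
         \<union> {\<omega> \<in> space M. t / 2 \<le> \<bar>(\<Sum>i\<in>I. Im (Y i \<omega>)) - real (card I) * Im m\<bar>}"
      by fastforce
  qed measurable
  also have "\<dots> \<le> real (card I) * V / (t / 2)\<^sup>2 + real (card I) * V / (t / 2)\<^sup>2"
    using part[of Re] part[of Im] by (intro order_trans[OF measure_Un_le] add_mono) auto
  finally show ?thesis by (simp add: power2_eq_square mult_ac)
qed

text \<open>Markov's inequality for the exponential of the count, each factor having mean at most 1
  + (e - 1) q \<le> exp(2 q). An exponential bound is called for by the union over the mesh: there
  the mean is about n^0.114 against the threshold n^0.12, and a variance bound of about n^(-0.126)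
  would be beaten by the n^0.465 mesh points.\<close>

lemma (in prob_space) binomial_upper_tail:
  fixes X :: "'i \<Rightarrow> 'a \<Rightarrow> 'b::topological_space"
  assumes fin: "finite I" and ind: "indep_vars (\<lambda>_. borel) X I"
    and B[measurable]: "B \<in> sets borel"
    and q: "\<And>i. i \<in> I \<Longrightarrow> prob {\<omega> \<in> space M. X i \<omega> \<in> B} \<le> q"
  shows "prob {\<omega> \<in> space M. t \<le> real (card {i \<in> I. X i \<omega> \<in> B})} \<le> exp (2 * real (card I) * q - t)"
proof -
  have xm[measurable]: "X i \<in> borel_measurable M" if "i \<in> I" for i
    using ind that by (auto simp: indep_vars_def)
  let ?Y = "\<lambda>i \<omega>. exp (indicator B (X i \<omega>)) :: real"
  have indY: "indep_vars (\<lambda>_. borel) ?Y I"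
    by (rule indep_vars_compose2[OF ind]) auto
  have intY: "integrable M (?Y i)" if "i \<in> I" for i
    using that by (intro integrable_const_bound[of _ "exp 1"]) (auto simp: indicator_def)
  have EY: "expectation (?Y i) \<le> exp (2 * q)" if i: "i \<in> I" for i
  proof -
    have "expectation (?Y i) = expectation (\<lambda>\<omega>. 1 + (exp 1 - 1) * indicator {\<omega> \<in> space M. X i \<omega> \<in> B} \<omega>)"
      by (intro Bochner_Integration.integral_cong) (auto simp: indicator_def)
    also have "\<dots> = 1 + (exp 1 - 1) * prob {\<omega> \<in> space M. X i \<omega> \<in> B}"
      using i by (subst Bochner_Integration.integral_add) (auto simp: prob_space less_top[symmetric])
    also have "\<dots> \<le> 1 + 2 * q"
      using q[OF i] exp_le by (intro add_left_mono mult_mono) auto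
    also have "\<dots> \<le> exp (2 * q)" by (rule exp_ge_add_one_self)
    finally show ?thesis .
  qed
  let ?N = "\<lambda>\<omega>. real (card {i \<in> I. X i \<omega> \<in> B})"
  have N: "?N \<omega> = (\<Sum>i\<in>I. indicator B (X i \<omega>))" for \<omega>
    using fin by (simp add: indicator_def sum.If_cases Int_def)
  have expN: "exp (?N \<omega>) = (\<Prod>i\<in>I. ?Y i \<omega>)" for \<omega>
    unfolding N using fin by (rule exp_sum)
  have intN: "integrable M (\<lambda>\<omega>. exp (?N \<omega>))"
    unfolding expN using intY by (intro indep_vars_integrable fin indY)
  have "prob {\<omega> \<in> space M. t \<le> ?N \<omega>} = prob {\<omega> \<in> space M. exp t \<le> exp (?N \<omega>)}" by simp
  also have "\<dots> \<le> expectation (\<lambda>\<omega>. exp (?N \<omega>)) / exp t"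
    by (rule integral_Markov_inequality_measure[OF intN, where A="{}"]) auto
  also have "expectation (\<lambda>\<omega>. exp (?N \<omega>)) = (\<Prod>i\<in>I. expectation (?Y i))"
    unfolding expN using intY by (intro indep_vars_lebesgue_integral fin indY)
  also have "\<dots> \<le> (\<Prod>i\<in>I. exp (2 * q))"
    using EY by (intro prod_mono) (auto intro!: integral_nonneg_AE)
  also have "\<dots> = exp (2 * real (card I) * q)"
    by (simp add: exp_of_nat_mult[symmetric] mult_ac)
  finally show ?thesis by (simp add: exp_diff divide_right_mono)
qed

text \<open>A threshold at most half the mean forces a deviation of at least half the mean, and the
  second moment of an indicator is p.\<close>

lemma (in prob_space) binomial_lower_tail:
  fixes X :: "'i \<Rightarrow> 'a \<Rightarrow> 'b::topological_space"
  assumes fin: "finite I" and ind: "indep_vars (\<lambda>_. borel) X I"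
    and B[measurable]: "B \<in> sets borel"
    and p: "\<And>i. i \<in> I \<Longrightarrow> prob {\<omega> \<in> space M. X i \<omega> \<in> B} = p" and p0: "0 < p" and ne: "I \<noteq> {}"
    and t: "2 * t \<le> real (card I) * p"
  shows "prob {\<omega> \<in> space M. real (card {i \<in> I. X i \<omega> \<in> B}) \<le> t} \<le> 4 / (real (card I) * p)"
proof -
  have xm[measurable]: "X i \<in> borel_measurable M" if "i \<in> I" for i
    using ind that by (auto simp: indep_vars_def)
  let ?Y = "\<lambda>i \<omega>. indicator B (X i \<omega>) :: real"
  have indY: "indep_vars (\<lambda>_. borel) ?Y I"
    by (rule indep_vars_compose2[OF ind]) auto
  have EY: "expectation (?Y i) = p" if i: "i \<in> I" for i
  proof -
    have "expectation (?Y i) = expectation (indicator {\<omega> \<in> space M. X i \<omega> \<in> B})"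
      by (intro Bochner_Integration.integral_cong) (auto simp: indicator_def)
    then show ?thesis using i p[OF i] by simp
  qed
  let ?N = "\<lambda>\<omega>. real (card {i \<in> I. X i \<omega> \<in> B})"
  let ?n = "real (card I)"
  have n: "0 < ?n" using fin ne by (simp add: card_gt_0_iff)
  have N: "?N \<omega> = (\<Sum>i\<in>I. ?Y i \<omega>)" for \<omega>
    using fin by (simp add: indicator_def sum.If_cases Int_def)
  have sq: "(?Y i \<omega>)\<^sup>2 = ?Y i \<omega>" for i \<omega> by (simp add: indicator_def)
  have "prob {\<omega> \<in> space M. ?N \<omega> \<le> t} \<le> prob {\<omega> \<in> space M. ?n * p / 2 \<le> \<bar>(\<Sum>i\<in>I. ?Y i \<omega>) - ?n * p\<bar>}"
  proof (rule finite_measure_mono)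
    have "?n * p / 2 \<le> \<bar>s - ?n * p\<bar>" if "s \<le> t" for s using t that by linarith
    then show "{\<omega> \<in> space M. ?N \<omega> \<le> t} \<subseteq> {\<omega> \<in> space M. ?n * p / 2 \<le> \<bar>(\<Sum>i\<in>I. ?Y i \<omega>) - ?n * p\<bar>}"
      unfolding N by blast
  qed measurable
  also have "\<dots> \<le> ?n * p / (?n * p / 2)\<^sup>2"
  proof (rule Chebyshev_indep_sum[OF fin indY])
    show "\<bar>?Y i \<omega>\<bar> \<le> 1" for i \<omega> by (simp add: indicator_def)
    show "expectation (\<lambda>\<omega>. (?Y i \<omega>)\<^sup>2) \<le> p" if "i \<in> I" for i
      unfolding sq using EY[OF that] by simp
  qed (use EY n p0 in auto)
  also have "\<dots> = 4 / (?n * p)" using n p0 by (simp add: power2_eq_square field_simps)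
  finally show ?thesis .
qed

section \<open>Critical points of polynomials\<close>

lemma poly_prod_linear:
  "finite J \<Longrightarrow> poly (\<Prod>j\<in>J. [:- x j, 1:]) z = (\<Prod>j\<in>J. z - x j)" for z :: "'a :: comm_ring_1"
  by (simp add: poly_prod)

text \<open>With S the sum of the 1/(z - x_j) and T that of their squares, q'/q = S and S' = -T,
  hence q''/q = S^2 - T.\<close>

lemma poly_pderiv_prod_linear:
  fixes x :: "'i \<Rightarrow> 'a :: field"
  assumes "finite J" "\<And>j. j \<in> J \<Longrightarrow> z \<noteq> x j"
  defines "q \<equiv> \<lambda>J. \<Prod>j\<in>J. [:- x j, 1:]"
  shows "poly (pderiv (q J)) z = poly (q J) z * (\<Sum>j\<in>J. 1 / (z - x j))"
    and "poly (pderiv (pderiv (q J))) z = poly (q J) z * ((\<Sum>j\<in>J. 1 / (z - x j))\<^sup>2 - (\<Sum>j\<in>J. 1 / (z - x j)\<^sup>2))"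
  using assms(1,2)
proof (induction J)
  case empty
  { case 1 show ?case by (simp add: q_def) next case 2 show ?case by (simp add: q_def) }
next
  case (insert a J)
  have q: "q (insert a J) = [:- x a, 1:] * q J" using insert by (simp add: q_def)
  have d1: "pderiv (q (insert a J)) = q J + [:- x a, 1:] * pderiv (q J)"
    unfolding q by (simp only: pderiv_mult) (simp add: pderiv_pCons algebra_simps)
  have d2: "pderiv (pderiv (q (insert a J))) = 2 * pderiv (q J) + [:- x a, 1:] * pderiv (pderiv (q J))"
    unfolding d1 pderiv_add by (simp only: pderiv_mult) (simp add: pderiv_pCons algebra_simps)
  { case 1
    then show ?case using insert.IH(1) insert.hyps
      by (simp only: d1) (simp add: q divide_simps, simp add: algebra_simps)
  next
    case 2
    then have za: "z - x a \<noteq> 0" and IH: "poly (pderiv (q J)) z = poly (q J) z * (\<Sum>j\<in>J. 1 / (z - x j))"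
      "poly (pderiv (pderiv (q J))) z = poly (q J) z * ((\<Sum>j\<in>J. 1 / (z - x j))\<^sup>2 - (\<Sum>j\<in>J. 1 / (z - x j)\<^sup>2))"
      using insert.IH by auto
    show ?case using insert.hyps za
      by (simp only: d2) (simp add: q IH power2_eq_square divide_simps, simp add: algebra_simps)
  }
qed


lemma degree_root_poly: "degree (root_poly x n) = n"
  unfolding root_poly_def by (subst degree_prod_eq_sum_degree) auto

lemma pderiv_root_poly_nonzero: "1 \<le> n \<Longrightarrow> pderiv (root_poly x n) \<noteq> 0"
  by (simp add: pderiv_eq_0_iff degree_root_poly)

lemma root_poly_split:
  assumes "i \<in> {1..n}"
  shows "root_poly x n = [:- x i, 1:] * (\<Prod>j\<in>{1..n} - {i}. [:- x j, 1:])"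
  unfolding root_poly_def using assms by (subst prod.remove[of _ i]) auto

lemma pderiv_root_poly_off_roots:
  assumes "\<And>j. j \<in> {1..n} \<Longrightarrow> z \<noteq> x j"
  shows "poly (pderiv (root_poly x n)) z = 0 \<longleftrightarrow> (\<Sum>j\<in>{1..n}. 1 / (z - x j)) = 0"
proof -
  have "poly (root_poly x n) z \<noteq> 0"
    using assms by (simp add: root_poly_def poly_prod_linear)
  then show ?thesis unfolding root_poly_def
    using poly_pderiv_prod_linear(1)[of "{1..n}" z x] assms by simp
qed

text \<open>With one factor split off, p = (z - x_i) q gives p'/q = 1 + (z - x_i) S. At a critical
  point (z - x_i) S = -1, and p''/q = 2 S + (z - x_i)(S^2 - T) collapses to S - (z - x_i) T; its
  nonvanishing makes the critical point simple.\<close>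

lemma pderiv_root_poly_at:
  assumes i: "i \<in> {1..n}" and z: "\<And>j. j \<in> {1..n} - {i} \<Longrightarrow> z \<noteq> x j"
  shows "poly (pderiv (root_poly x n)) z = 0 \<longleftrightarrow> 1 + (z - x i) * (\<Sum>j\<in>{1..n} - {i}. 1 / (z - x j)) = 0"
    and "poly (pderiv (root_poly x n)) z = 0 \<Longrightarrow>
      (\<Sum>j\<in>{1..n} - {i}. 1 / (z - x j)) \<noteq> (z - x i) * (\<Sum>j\<in>{1..n} - {i}. 1 / (z - x j)\<^sup>2) \<Longrightarrow>
      poly (pderiv (pderiv (root_poly x n))) z \<noteq> 0"
proof -
  define J where "J = {1..n} - {i}"
  have fin: "finite J" by (simp add: J_def)
  let ?q = "\<Prod>j\<in>J. [:- x j, 1:]"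
  let ?S = "\<Sum>j\<in>J. 1 / (z - x j)" and ?T = "\<Sum>j\<in>J. 1 / (z - x j)\<^sup>2"
  note z = z[folded J_def]
  have q0: "poly ?q z \<noteq> 0" using z fin by (simp add: poly_prod_linear)
  have d1: "pderiv (root_poly x n) = ?q + [:- x i, 1:] * pderiv ?q"
    unfolding root_poly_split[OF i] J_def by (simp only: pderiv_mult) (simp add: pderiv_pCons algebra_simps)
  have d2: "pderiv (pderiv (root_poly x n)) = 2 * pderiv ?q + [:- x i, 1:] * pderiv (pderiv ?q)"
    unfolding d1 pderiv_add by (simp only: pderiv_mult) (simp add: pderiv_pCons algebra_simps)
  have pq: "poly (pderiv ?q) z = poly ?q z * ?S" "poly (pderiv (pderiv ?q)) z = poly ?q z * (?S\<^sup>2 - ?T)"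
    using poly_pderiv_prod_linear[OF fin z] by auto
  have lin: "poly [:- x i, 1:] z = z - x i" by simp
  have "poly (pderiv (root_poly x n)) z = poly ?q z * (1 + (z - x i) * ?S)"
    unfolding d1 poly_add poly_mult lin pq by (simp add: distrib_left mult_ac)
  with q0 have *: "poly (pderiv (root_poly x n)) z = 0 \<longleftrightarrow> 1 + (z - x i) * ?S = 0" by simp
  then show "poly (pderiv (root_poly x n)) z = 0 \<longleftrightarrow> 1 + (z - x i) * (\<Sum>j\<in>{1..n} - {i}. 1 / (z - x j)) = 0"
    unfolding J_def .
  assume "poly (pderiv (root_poly x n)) z = 0"
    "(\<Sum>j\<in>{1..n} - {i}. 1 / (z - x j)) \<noteq> (z - x i) * (\<Sum>j\<in>{1..n} - {i}. 1 / (z - x j)\<^sup>2)"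
  then have S: "(z - x i) * ?S = -1" and ne: "?S \<noteq> (z - x i) * ?T"
    using * by (auto simp: J_def add_eq_0_iff)
  have "poly (pderiv (pderiv (root_poly x n))) z = poly ?q z * (2 * ?S + (z - x i) * ?S * ?S - (z - x i) * ?T)"
    unfolding d2 poly_add poly_mult lin pq by (simp add: distrib_left right_diff_distrib power2_eq_square mult_ac)
  also have "\<dots> = poly ?q z * (?S - (z - x i) * ?T)" unfolding S by simp
  finally show "poly (pderiv (pderiv (root_poly x n))) z \<noteq> 0" using q0 ne by simp
qed

lemma order_eq_1:
  fixes p :: "'a :: field poly"
  assumes "poly p a = 0" "poly (pderiv p) a \<noteq> 0"
  shows "order a p = 1"
proof -
  have p0: "p \<noteq> 0" using assms by auto
  then have "order a p \<noteq> 0" using assms order_root by blast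
  moreover have "\<not> 2 \<le> order a p"
  proof
    assume "2 \<le> order a p"
    then have "[:- a, 1:] ^ 2 dvd p" using order_1 power_le_dvd by blast
    then obtain q where "p = [:- a, 1:] ^ 2 * q" by (elim dvdE)
    then have "p = [:- a, 1:] * ([:- a, 1:] * q)" by (simp add: power2_eq_square mult.assoc del: mult_pCons_left)
    then have "poly (pderiv p) a = 0" by (simp only: pderiv_mult) (simp add: pderiv_mult del: mult_pCons_left)
    with assms show False by simp
  qed
  ultimately show ?thesis by simp
qed

lemma mem_crit_pts: "1 \<le> n \<Longrightarrow> w \<in># crit_pts (root_poly x n) \<longleftrightarrow> poly (pderiv (root_poly x n)) w = 0"
  by (simp add: crit_pts_def pderiv_root_poly_nonzero)

lemma count_crit_pts: "1 \<le> n \<Longrightarrow> count (crit_pts (root_poly x n)) w = order w (pderiv (root_poly x n))"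
  by (simp add: crit_pts_def pderiv_root_poly_nonzero)

text \<open>A special case of the Gauss-Lucas theorem.\<close>
lemma crit_pts_unit_disk:
  assumes n: "1 \<le> n" and disk: "\<And>j. j \<in> {1..n} \<Longrightarrow> norm (x j) \<le> 1"
    and w: "poly (pderiv (root_poly x n)) w = 0"
  shows "norm w \<le> 1"
proof (rule ccontr)
  assume w1: "\<not> norm w \<le> 1"
  then have ne: "w \<noteq> x j" if "j \<in> {1..n}" for j using disk[OF that] by auto
  \<comment> \<open>Since |x_j| \<le> 1 < |w|, all w/(w - x_j) lie in the open right half-plane, so
    their sum cannot vanish.\<close>
  have pos: "0 < Re (w / (w - x j))" if j: "j \<in> {1..n}" for j
  proof -
    have "Re (w * cnj (x j)) \<le> norm w * norm (x j)"
      by (metis complex_Re_le_cmod norm_mult complex_mod_cnj)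
    also have "\<dots> \<le> norm w * 1" using disk[OF j] by (intro mult_left_mono) auto
    also have "\<dots> < norm w * norm w" using w1 by (intro mult_strict_left_mono) auto
    finally have "0 < Re (w * cnj (w - x j))"
      by (simp add: right_diff_distrib complex_norm_square[symmetric] power2_eq_square[symmetric] cmod_power2)
    moreover have "w / (w - x j) = w * cnj (w - x j) / of_real ((norm (w - x j))\<^sup>2)"
      using complex_div_cnj by blast
    ultimately show ?thesis using ne[OF j] by (simp only: Re_divide_of_real) simp
  qed
  have "(\<Sum>j\<in>{1..n}. 1 / (w - x j)) = 0"
    using w ne pderiv_root_poly_off_roots[of n w x] by simp
  then have "w * (\<Sum>j\<in>{1..n}. 1 / (w - x j)) = 0" by simp
  then have "(\<Sum>j\<in>{1..n}. w / (w - x j)) = 0" by (simp add: sum_distrib_left)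
  then have "(\<Sum>j\<in>{1..n}. Re (w / (w - x j))) = 0" by (metis Re_sum zero_complex.sel(1))
  moreover have "0 < (\<Sum>j\<in>{1..n}. Re (w / (w - x j)))" using n pos by (intro sum_pos) auto
  ultimately show False by simp
qed

text \<open>The difference of two terms is (w - z)/((z - x_j)(w - x_j)). The arithmetic-geometric
  mean inequality splits the product, so the bound H is used at the two endpoints and not along the
  segment between them.\<close>

lemma resolvent_sum_diff_le:
  fixes z w :: complex
  assumes z: "\<And>j. j \<in> J \<Longrightarrow> z \<noteq> x j" "\<And>j. j \<in> J \<Longrightarrow> w \<noteq> x j"
    and H: "(\<Sum>j\<in>J. 1 / (norm (z - x j))\<^sup>2) \<le> H" "(\<Sum>j\<in>J. 1 / (norm (w - x j))\<^sup>2) \<le> H"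
  shows "norm ((\<Sum>j\<in>J. 1 / (z - x j)) - (\<Sum>j\<in>J. 1 / (w - x j))) \<le> H * norm (z - w)"
proof -
  have "norm ((\<Sum>j\<in>J. 1 / (z - x j)) - (\<Sum>j\<in>J. 1 / (w - x j))) \<le> (\<Sum>j\<in>J. norm (1 / (z - x j) - 1 / (w - x j)))"
    unfolding sum_subtractf[symmetric] by (rule norm_sum)
  also have "\<dots> \<le> (\<Sum>j\<in>J. norm (z - w) * ((1 / (norm (z - x j))\<^sup>2 + 1 / (norm (w - x j))\<^sup>2) / 2))"
  proof (rule sum_mono)
    fix j assume j: "j \<in> J"
    let ?a = "1 / norm (z - x j)" and ?b = "1 / norm (w - x j)"
    have "1 / (z - x j) - 1 / (w - x j) = (w - z) / ((z - x j) * (w - x j))"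
      using z[OF j] by (simp add: divide_simps)
    then have "norm (1 / (z - x j) - 1 / (w - x j)) = norm (z - w) * (?a * ?b)"
      by (simp add: norm_divide norm_mult norm_minus_commute)
    also have "?a * ?b \<le> (?a\<^sup>2 + ?b\<^sup>2) / 2"
      using sum_squares_bound[of ?a ?b] by simp
    finally show "norm (1 / (z - x j) - 1 / (w - x j)) \<le> norm (z - w) * ((1 / (norm (z - x j))\<^sup>2
      + 1 / (norm (w - x j))\<^sup>2) / 2)"
      by (simp add: mult_left_mono power_one_over)
  qed
  also have "\<dots> = norm (z - w) * (((\<Sum>j\<in>J. 1 / (norm (z - x j))\<^sup>2) + (\<Sum>j\<in>J. 1 / (norm (w - x j))\<^sup>2)) / 2)"
    by (simp only: sum.distrib[symmetric] sum_distrib_left sum_divide_distrib)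
  also have "\<dots> \<le> norm (z - w) * H" using H by (intro mult_left_mono) auto
  finally show ?thesis by (simp add: mult.commute)
qed

text \<open>Near the root \<open>x i\<close> the critical points are the fixed points of \<open>z \<mapsto> x i - 1 / G z\<close>,
  where \<open>G\<close> is the field of the other roots; this map is a contraction.\<close>
lemma unique_crit_near_root:
  fixes x :: "nat \<Rightarrow> complex"
  assumes i: "i \<in> {1..n}" and g: "0 < g" "1 / g \<le> \<rho>" "2 * H \<le> g\<^sup>2" "\<rho> * H < g"
    and ne: "\<And>z j. dist z (x i) \<le> \<rho> \<Longrightarrow> j \<in> {1..n} - {i} \<Longrightarrow> z \<noteq> x j"
    and low: "\<And>z. dist z (x i) \<le> \<rho> \<Longrightarrow> g \<le> norm (\<Sum>j\<in>{1..n} - {i}. 1 / (z - x j))"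
    and up: "\<And>z. dist z (x i) \<le> \<rho> \<Longrightarrow> (\<Sum>j\<in>{1..n} - {i}. 1 / (norm (z - x j))\<^sup>2) \<le> H"
  obtains w where "only_crit_within (root_poly x n) \<rho> (x i) w" "dist w (x i) \<le> \<rho>"
    "w = x i - 1 / (\<Sum>j\<in>{1..n} - {i}. 1 / (w - x j))"
proof -
  define G where "G = (\<lambda>z. \<Sum>j\<in>{1..n} - {i}. 1 / (z - x j))"
  have n1: "1 \<le> n" using i by auto
  have low': "g \<le> norm (G z)" if "dist z (x i) \<le> \<rho>" for z using low[OF that] by (simp add: G_def)
  then have G0: "G z \<noteq> 0" if "dist z (x i) \<le> \<rho>" for z using that g by force
  have "0 \<le> 1 / g" using g by simp
  then have \<rho>: "0 \<le> \<rho>" using g by linarith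
  have H0: "0 \<le> H"
  proof -
    have "0 \<le> (\<Sum>j\<in>{1..n} - {i}. 1 / (norm (x i - x j))\<^sup>2)" by (intro sum_nonneg) auto
    also have "\<dots> \<le> H" using \<rho> by (intro up) auto
    finally show ?thesis .
  qed
  \<comment> \<open>The map preserves the disc because 1/g \<le> \<rho>, and its Lipschitz constant
    is at most H/g^2 \<le> 1/2.\<close>
  have fp: "\<exists>!w. w \<in> cball (x i) \<rho> \<and> x i - 1 / G w = w"
  proof (rule Banach_fix[where c = "1/2"])
    show "(\<lambda>w. x i - 1 / G w) ` cball (x i) \<rho> \<subseteq> cball (x i) \<rho>"
    proof (rule image_subsetI)
      fix w assume "w \<in> cball (x i) \<rho>"
      then have "g \<le> norm (G w)" by (intro low') (simp add: dist_commute)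
      then have "1 / norm (G w) \<le> 1 / g" using g by (intro divide_left_mono mult_pos_pos) auto
      then show "x i - 1 / G w \<in> cball (x i) \<rho>" using g by (simp add: dist_norm norm_divide)
    qed
    fix z w assume zw: "z \<in> cball (x i) \<rho>" "w \<in> cball (x i) \<rho>"
    then have zw': "dist z (x i) \<le> \<rho>" "dist w (x i) \<le> \<rho>" by (auto simp: dist_commute)
    have "dist (x i - 1 / G z) (x i - 1 / G w) = norm (G z - G w) / (norm (G z) * norm (G w))"
    proof -
      have "(x i - 1 / G z) - (x i - 1 / G w) = (G z - G w) / (G z * G w)"
        using G0[OF zw'(1)] G0[OF zw'(2)] by (simp add: field_simps)
      then show ?thesis by (simp only: dist_norm norm_divide norm_mult)
    qed
    also have "\<dots> \<le> H * norm (z - w) / (g * g)"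
    proof (intro frac_le mult_mono)
      show "norm (G z - G w) \<le> H * norm (z - w)"
        unfolding G_def using zw' by (intro resolvent_sum_diff_le ne up) auto
    qed (use g H0 low'[OF zw'(1)] low'[OF zw'(2)] in auto)
    also have "\<dots> = H / g\<^sup>2 * norm (z - w)" by (simp add: power2_eq_square)
    also have "\<dots> \<le> 1 / 2 * norm (z - w)"
      using g by (intro mult_right_mono) (auto simp: divide_simps)
    finally show "dist (x i - 1 / G z) (x i - 1 / G w) \<le> 1 / 2 * dist z w" by (simp add: dist_norm)
  qed (use \<rho> in \<open>auto simp: complete_eq_closed\<close>)
  then obtain w where w: "w \<in> cball (x i) \<rho>" "x i - 1 / G w = w"
    and uniq: "\<And>v. v \<in> cball (x i) \<rho> \<Longrightarrow> x i - 1 / G v = v \<Longrightarrow> v = w" by metis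
  have wd: "dist w (x i) \<le> \<rho>" using w by (simp add: dist_commute)
  have crit: "poly (pderiv (root_poly x n)) v = 0 \<longleftrightarrow> v = w" if v: "dist v (x i) \<le> \<rho>" for v
  proof -
    have "poly (pderiv (root_poly x n)) v = 0 \<longleftrightarrow> 1 + (v - x i) * G v = 0"
      unfolding G_def using ne[OF v] by (intro pderiv_root_poly_at i) auto
    also have "\<dots> \<longleftrightarrow> x i - 1 / G v = v"
      using G0[OF v] by (auto simp: field_simps add_eq_0_iff)
    also have "\<dots> \<longleftrightarrow> v = w" using uniq[of v] w v by (auto simp: dist_commute)
    finally show ?thesis .
  qed
  \<comment> \<open>Simplicity of \<open>w\<close>: |w - x_i| times the sum of the squares is at
    most \<rho> H < g \<le> |G w|, so the second derivative cannot vanish.\<close>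
  have "poly (pderiv (pderiv (root_poly x n))) w \<noteq> 0"
  proof (rule pderiv_root_poly_at(2)[OF i])
    show "w \<noteq> x j" if "j \<in> {1..n} - {i}" for j using ne[OF wd that] .
    show "poly (pderiv (root_poly x n)) w = 0" using crit[OF wd] by simp
    have "norm ((w - x i) * (\<Sum>j\<in>{1..n} - {i}. 1 / (w - x j)\<^sup>2)) \<le> \<rho> * H"
      unfolding norm_mult
    proof (intro mult_mono)
      have "norm (\<Sum>j\<in>{1..n} - {i}. 1 / (w - x j)\<^sup>2) \<le> (\<Sum>j\<in>{1..n} - {i}. 1 / (norm (w - x j))\<^sup>2)"
        by (rule order_trans[OF norm_sum]) (simp add: norm_divide norm_power)
      with up[OF wd] show "norm (\<Sum>j\<in>{1..n} - {i}. 1 / (w - x j)\<^sup>2) \<le> H" by simp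
    qed (use wd \<rho> in \<open>auto simp: dist_norm\<close>)
    also have "\<dots> < norm (G w)" using g low'[OF wd] by simp
    finally show "(\<Sum>j\<in>{1..n} - {i}. 1 / (w - x j)) \<noteq> (w - x i) * (\<Sum>j\<in>{1..n} - {i}. 1 / (w - x j)\<^sup>2)"
      unfolding G_def by (intro notI) simp
  qed
  then have ord: "order w (pderiv (root_poly x n)) = 1"
    using crit[OF wd] by (intro order_eq_1) auto
  have "only_crit_within (root_poly x n) \<rho> (x i) w"
    unfolding only_crit_within_def
  proof (rule multiset_eqI)
    fix v
    show "count {#v \<in># crit_pts (root_poly x n). dist v (x i) \<le> \<rho>#} v = count {#w#} v"
    proof (cases "dist v (x i) \<le> \<rho>")
      case True
      have "v \<noteq> w \<Longrightarrow> order v (pderiv (root_poly x n)) = 0"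
        using crit[OF True] by (simp add: order_0I)
      with True ord show ?thesis by (auto simp: count_crit_pts[OF n1])
    next
      case False
      with wd show ?thesis by auto
    qed
  qed
  then show ?thesis using that[of w] wd w(2) by (simp add: G_def)
qed

section \<open>Order statistics of finite multisets of complex numbers\<close>

lemma cpx_less_if_norm: "0 < norm z \<Longrightarrow> norm z < norm w \<Longrightarrow> cpx_less z w"
  by (auto simp: cpx_less_def cpx_le_def)

lemma cpx_le_imp_norm: "cpx_le z w \<Longrightarrow> norm z \<le> norm w"
  by (auto simp: cpx_le_def)

lemma mset_cpx_insort: "mset (cpx.insort x xs) = add_mset x (mset xs)"
  by (induction xs) auto

lemma mset_cpx_sorted_list_of_multiset: "mset (cpx.sorted_list_of_multiset A) = A"
  by (induction A) (simp_all add: mset_cpx_insort)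

lemma sorted_cpx_sorted_list_of_multiset: "cpx.sorted (cpx.sorted_list_of_multiset A)"
  by (induction A) (simp_all add: cpx.sorted_insort)

lemma kth_largest_props:
  assumes k: "1 \<le> k" "k \<le> size A"
  shows "kth_largest A k \<in># A" "size {#y \<in># A. cpx_less (kth_largest A k) y#} < k"
    "k \<le> size {#y \<in># A. cpx_le (kth_largest A k) y#}"
proof -
  let ?L = "cpx.sorted_list_of_multiset A" let ?R = "rev ?L"
  have ms: "mset ?R = A" by (simp add: mset_cpx_sorted_list_of_multiset)
  have len: "length ?R = size A" using ms by (metis size_mset)
  have sd: "sorted_wrt (\<lambda>a b. cpx_le b a) ?R"
    using sorted_cpx_sorted_list_of_multiset[of A] by (simp add: sorted_wrt_rev)
  let ?v = "kth_largest A k"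
  have v: "?v = ?R ! (k - 1)" by (simp add: kth_largest_def)
  show "?v \<in># A" using v k len ms by (metis One_nat_def diff_less in_set_conv_nth le_less_trans less_le_trans less_one nth_mem set_mset_mset Suc_le_lessD diff_Suc_less)
  have ge: "cpx_le (?R ! j) (?R ! i)" if "i \<le> j" "j < length ?R" for i j
    using sd that by (cases "i = j") (auto simp: sorted_wrt_iff_nth_less)
  have "size {#y \<in># A. cpx_less ?v y#} = length (filter (cpx_less ?v) ?R)"
    by (metis ms mset_filter size_mset)
  also have "filter (cpx_less ?v) ?R = filter (cpx_less ?v) (take (k - 1) ?R)"
  proof -
    have "filter (cpx_less ?v) (drop (k - 1) ?R) = []"
    proof (rule filter_False, rule ballI)
      fix y assume "y \<in> set (drop (k - 1) ?R)"
      then obtain j where j: "j < length (drop (k - 1) ?R)" "y = drop (k - 1) ?R ! j" by (metis in_set_conv_nth)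
      then have "cpx_le y ?v" unfolding v using ge[of "k - 1" "k - 1 + j"] by simp
      then show "\<not> cpx_less ?v y" by (rule cpx.leD)
    qed
    then show ?thesis by (metis append_Nil2 append_take_drop_id filter_append)
  qed
  also have "length \<dots> \<le> length (take (k - 1) ?R)" by (rule length_filter_le)
  finally show "size {#y \<in># A. cpx_less ?v y#} < k" using k by (simp, linarith)
  have "k = length (take k ?R)" using k len by simp
  also have "take k ?R = filter (cpx_le ?v) (take k ?R)"
  proof (rule filter_True[symmetric], rule ballI)
    fix y assume "y \<in> set (take k ?R)"
    then obtain j where j: "j < length (take k ?R)" "y = take k ?R ! j" by (metis in_set_conv_nth)
    then show "cpx_le ?v y" unfolding v using ge[of j "k - 1"] k len by fastforce
  qed
  also have "length \<dots> \<le> length (filter (cpx_le ?v) ?R)"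
    by (metis append_take_drop_id filter_append le_add1 length_append)
  also have "\<dots> = size {#y \<in># A. cpx_le ?v y#}"
    by (metis ms mset_filter size_mset)
  finally show "k \<le> size {#y \<in># A. cpx_le ?v y#}" .
qed

text \<open>If a is strictly below b, everything weakly above b is strictly above a, so at most one
  value satisfies both counts. The k-th largest element can thus be recognised by counting what lies
  above it, without handling sorted lists.\<close>

lemma kth_largest_eqI:
  assumes k: "1 \<le> k" and v: "size {#y \<in># A. cpx_less v y#} < k" "k \<le> size {#y \<in># A. cpx_le v y#}"
  shows "kth_largest A k = v"
proof -
  have disj: "\<not> cpx_less a b" if "size {#y \<in># A. cpx_less a y#} < k" "k \<le> size {#y \<in># A. cpx_le b y#}" for a b
  proof
    assume "cpx_less a b"
    then have "{#y \<in># A. cpx_le b y#} \<subseteq># {#y \<in># A. cpx_less a y#}"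
      by (intro mset_subset_eqI) (auto intro: cpx.less_le_trans)
    then show False using that size_mset_mono by fastforce
  qed
  have "k \<le> size A" using v(2) size_filter_mset_lesseq order_trans by blast
  from kth_largest_props[OF k this] v disj show ?thesis
    by (meson cpx.less_linear)
qed

lemma size_filter_image_mset_set:
  "finite I \<Longrightarrow> size {#y \<in># image_mset x (mset_set I). P y#} = card {i \<in> I. P (x i)}"
  by (simp add: filter_mset_image_mset)

text \<open>Adding the diagonal term turns the sum into a sum over the multiset of roots, which
  sorting does not change. The added term is 0 because 1/0 = 0, and the same convention treats
  coinciding roots alike on both sides.\<close>

lemma root_mean_roots_desc:
  assumes i: "i \<in> {1..n}" and k: "k \<in> {1..n}" and eq: "roots_desc x n k = x i"
  shows "root_mean (roots_desc x n) n k = root_mean x n i"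
proof -
  let ?M = "image_mset x (mset_set {1..n})"
  have size: "size ?M = n" by simp
  have gen: "(\<Sum>j \<in> {1..n} - {l}. 1 / (y l - y j)) = (\<Sum>v\<in>#image_mset y (mset_set {1..n}). 1 / (y l - v))"
    if "l \<in> {1..n}" for y :: "nat \<Rightarrow> complex" and l
  proof -
    have "(\<Sum>v\<in>#image_mset y (mset_set {1..n}). 1 / (y l - v)) = (\<Sum>j\<in>{1..n}. 1 / (y l - y j))"
      by (simp add: image_mset.compositionality comp_def flip: sum_unfold_sum_mset)
    also have "\<dots> = 1 / (y l - y l) + (\<Sum>j\<in>{1..n} - {l}. 1 / (y l - y j))"
      using that by (intro sum.remove) auto
    finally show ?thesis by simp
  qed
  have "image_mset (roots_desc x n) (mset_set {1..n}) = ?M"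
  proof -
    let ?R = "rev (cpx.sorted_list_of_multiset ?M)"
    have len: "length ?R = n" by (metis length_rev size size_mset mset_cpx_sorted_list_of_multiset)
    have "image_mset (roots_desc x n) (mset_set {1..n}) = mset (map (roots_desc x n) [1..<Suc n])"
      by (simp del: upt_Suc add: atLeastLessThanSuc_atLeastAtMost)
    also have "map (roots_desc x n) [1..<Suc n] = ?R"
      using len by (intro nth_equalityI) (auto simp: roots_desc_def kth_largest_def simp del: upt_Suc)
    finally show ?thesis by (simp add: mset_cpx_sorted_list_of_multiset)
  qed
  then show ?thesis
    unfolding root_mean_def gen[OF i, of x] gen[OF k, of "roots_desc x n"] by (simp only: eq)
qed

section \<open>Pairing of roots and critical points\<close>

text \<open>The set \<open>C\<close> is a mesh of points outside the disk where the field of the roots is controlled.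
  In the annulus, \<open>E\<close> will bound the error of the field once the nearest root is removed, and \<open>F\<close> the
  sum of the squared inverse distances from a root to the others.\<close>
locale separated_roots =
  fixes n :: nat and x :: "nat \<Rightarrow> complex" and L :: real and C :: "complex set"
    and s s2 h m e1 e2 E F :: real
  assumes n: "1 \<le> n"
    and disk: "\<And>j. j \<in> {1..n} \<Longrightarrow> norm (x j) \<le> 1"
    and sep2: "\<And>i j. i \<in> {1..n} \<Longrightarrow> j \<in> {1..n} \<Longrightarrow> i \<noteq> j \<Longrightarrow> 1 - 2 * L / n \<le> norm (x i) \<Longrightarrow> s2 < dist (x i) (x j)"
    and sep: "\<And>i j. i \<in> {1..n} \<Longrightarrow> j \<in> {1..n} \<Longrightarrow> i \<noteq> j \<Longrightarrow> 1 - s \<le> norm (x i) \<Longrightarrow> s < dist (x i) (x j)"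
    and net: "\<And>u. norm u = 1 \<Longrightarrow> \<exists>c\<in>C. norm c = 1 + h \<and> dist c u \<le> 3 / 2 * h"
    and field1: "\<And>c. c \<in> C \<Longrightarrow> norm ((\<Sum>j\<in>{1..n}. 1 / (c - x j)) - of_nat n / c) \<le> e1"
    and field2: "\<And>c. c \<in> C \<Longrightarrow> (\<Sum>j\<in>{1..n}. 1 / (norm (c - x j))\<^sup>2) \<le> e2"
    and crowd: "\<And>c. c \<in> C \<Longrightarrow> real (card {j\<in>{1..n}. dist c (x j) \<le> 4 * h}) \<le> m"
    and scales: "0 < s" "s \<le> s2" "0 < h" "h \<le> 1 / 10" "s \<le> h" "3 \<le> L" "L / n \<le> s / 3" "2 * L / n + 3 / n
      \<le> h / 2" "6 / n \<le> s2"
    and E: "e1 + 4 * h * e2 + m * (3 / s + 1 / h) + 1 / h + 4 * h * n \<le> E" "16 * E \<le> n"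
    and F: "4 * m / s2\<^sup>2 + 4 * e2 \<le> F" "8 * F < (real n)\<^sup>2"
begin

abbreviation "roots \<equiv> {1..n}"
abbreviation "p \<equiv> root_poly x n"
abbreviation "G i z \<equiv> \<Sum>j\<in>{1..n} - {i}. 1 / (z - x j)"

lemma n0: "0 < real n" using n by simp

lemma norm_shrunk: "norm (z * (1 - 1 / of_nat n)) = norm z * (1 - 1 / n)" for z :: complex
proof -
  have "(1 - 1 / of_nat n :: complex) = of_real (1 - 1 / n)" by simp
  moreover have "0 \<le> 1 - 1 / real n" using n by simp
  ultimately show ?thesis by (simp only: norm_mult norm_of_real abs_of_nonneg)
qed

lemma m0: "0 \<le> m"
proof -
  obtain c where "c \<in> C" using net[of 1] by auto
  from order_trans[OF of_nat_0_le_iff crowd[OF this]] show ?thesis .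
qed

lemma E0: "0 \<le> E"
proof -
  obtain c where c: "c \<in> C" using net[of 1] by auto
  have "0 \<le> e1" using field1[OF c] norm_ge_zero order_trans by blast
  moreover have "0 \<le> e2" using field2[OF c] by (rule order_trans[rotated]) (auto intro: sum_nonneg)
  ultimately have "0 \<le> e1 + 4 * h * e2 + m * (3 / s + 1 / h) + 1 / h + 4 * h * n"
    using m0 scales by (intro add_nonneg_nonneg mult_nonneg_nonneg) auto
  with E show ?thesis by linarith
qed

text \<open>A point within h/2 of the circle is that close to its radial projection, which is within
  3h/2 of a mesh point. Mesh points have modulus 1 + h, hence distance at least h from every
  root.\<close>

lemma near_net:
  assumes z: "\<bar>1 - norm z\<bar> \<le> h / 2"
  obtains c where "c \<in> C" "norm c = 1 + h" "dist c z \<le> 2 * h" "z \<noteq> 0" "1 / 2 \<le> norm z"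
    "\<And>j. j \<in> roots \<Longrightarrow> h \<le> dist c (x j)"
proof -
  have z0: "1 / 2 \<le> norm z" using z scales by linarith
  then have "z \<noteq> 0" by auto
  note z0 = this z0
  have "dist (sgn z) z = \<bar>1 - norm z\<bar>" using dist_sgn z0 by (simp add: abs_minus_commute)
  moreover obtain c where c: "c \<in> C" "norm c = 1 + h" "dist c (sgn z) \<le> 3 / 2 * h"
    using net[of "sgn z"] z0 by (auto simp: norm_sgn)
  ultimately have "dist c z \<le> 2 * h" using z dist_triangle_le[of c "sgn z" z "2 * h"]
    by (simp add: dist_commute)
  moreover have "h \<le> dist c (x j)" if "j \<in> roots" for j
    using norm_triangle_ineq2[of c "x j"] disk[OF that] c by (simp add: dist_norm)
  ultimately show ?thesis using that c z0 by blast
qed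

text \<open>The sum at z is compared with the sum at a mesh point c. A root farther than 4 h from c
  is still at least half as far from z, and its term changes by at most 4 h / |c - x_j|^2; the at
  most m closer ones are bounded through the distances s/3 from z and h from c. R is a singleton
  next to a root, and empty when critical points away from all roots are to be excluded.\<close>

lemma field_estimate:
  assumes z: "\<bar>1 - norm z\<bar> \<le> h / 2" and R: "R \<subseteq> roots" "card R \<le> 1"
    and far: "\<And>j. j \<in> roots - R \<Longrightarrow> s / 3 \<le> dist z (x j)"
  shows "norm ((\<Sum>j\<in>roots - R. 1 / (z - x j)) - of_nat n / z) \<le> E"
proof -
  obtain c where c: "c \<in> C" "norm c = 1 + h" and cz: "dist c z \<le> 2 * h" and z0: "z \<noteq> 0" "1 / 2 \<le> norm z"
    and ch: "\<And>j. j \<in> roots \<Longrightarrow> h \<le> dist c (x j)"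
    using near_net[OF z] by metis
  let ?N = "{j\<in>roots. dist c (x j) \<le> 4 * h}"
  have pos: "0 < s" "0 < h" using scales by auto
  have c0: "c \<noteq> 0" using c pos by auto
  have tb: "norm (1 / (z - x j) - 1 / (c - x j))
      \<le> (if dist c (x j) \<le> 4 * h then 3 / s + 1 / h else 0) + 4 * h * (1
        / (norm (c - x j))\<^sup>2)" if j: "j \<in> roots - R" for j
  proof (cases "dist c (x j) \<le> 4 * h")
    case True
    have "norm (1 / (z - x j) - 1 / (c - x j)) \<le> 1 / norm (z - x j) + 1 / norm (c - x j)"
      by (rule order_trans[OF norm_triangle_ineq4]) (simp add: norm_divide)
    also have "1 / norm (z - x j) \<le> 1 / (s / 3)"
      using far[OF j] pos by (intro divide_left_mono mult_pos_pos) (auto simp: dist_norm)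
    also have "1 / norm (c - x j) \<le> 1 / h"
      using ch[of j] j pos by (intro divide_left_mono mult_pos_pos) (auto simp: dist_norm)
    finally have "norm (1 / (z - x j) - 1 / (c - x j)) \<le> 3 / s + 1 / h" by simp
    moreover have "0 \<le> 4 * h * (1 / (norm (c - x j))\<^sup>2)" using pos by simp
    ultimately show ?thesis using True by auto
  next
    case False
    let ?d = "norm (c - x j)"
    have d: "4 * h < ?d" using False j by (auto simp: dist_norm)
    have zd: "?d / 2 \<le> norm (z - x j)"
      using dist_triangle[of c "x j" z] cz d by (simp add: dist_norm)
    have ne: "z \<noteq> x j" "c \<noteq> x j" using d zd pos by auto
    then have "norm (1 / (z - x j) - 1 / (c - x j)) = norm (c - z) / (norm (z - x j) * ?d)"
    proof -
      have "1 / (z - x j) - 1 / (c - x j) = (c - z) / ((z - x j) * (c - x j))"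
        using ne by (simp add: divide_simps)
      then show ?thesis by (simp only: norm_divide norm_mult)
    qed
    also have "\<dots> \<le> (2 * h) / (?d / 2 * ?d)"
      using cz d zd pos by (intro frac_le mult_right_mono mult_pos_pos) (auto simp: dist_norm)
    also have "\<dots> = 4 * h * (1 / ?d\<^sup>2)" by (simp add: power2_eq_square)
    finally show ?thesis using False by auto
  qed
  have fin: "finite roots" by simp
  have split: "(\<Sum>j\<in>roots - R. 1 / (z - x j)) - of_nat n / z =
     (\<Sum>j\<in>roots - R. 1 / (z - x j) - 1 / (c - x j)) - (\<Sum>j\<in>R. 1 / (c - x j))
     + ((\<Sum>j\<in>roots. 1 / (c - x j)) - of_nat n / c) + (of_nat n / c - of_nat n / z)"
    using sum.subset_diff[OF R(1) fin, of "\<lambda>j. 1 / (c - x j)"] by (simp add: sum_subtractf)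
  have b1: "norm (\<Sum>j\<in>roots - R. 1 / (z - x j) - 1 / (c - x j)) \<le> m * (3 / s + 1 / h) + 4 * h * e2"
  proof -
    have "norm (\<Sum>j\<in>roots - R. 1 / (z - x j) - 1 / (c - x j))
        \<le> (\<Sum>j\<in>roots - R. (if dist c (x j) \<le> 4 * h then 3 / s + 1 / h else 0) + 4 * h * (1 / (norm (c - x j))\<^sup>2))"
      by (rule order_trans[OF norm_sum]) (intro sum_mono tb)
    also have "\<dots> \<le> (\<Sum>j\<in>roots. (if dist c (x j) \<le> 4 * h then 3 / s + 1 / h else 0) + 4 * h * (1 / (norm (c - x j))\<^sup>2))"
      using pos by (intro sum_mono2) auto
    also have "\<dots> = real (card ?N) * (3 / s + 1 / h) + 4 * h * (\<Sum>j\<in>roots. 1 / (norm (c - x j))\<^sup>2)"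
      by (simp only: sum.distrib sum_distrib_left distrib_left sum.inter_filter[OF fin, symmetric] sum_constant)
    also have "\<dots> \<le> m * (3 / s + 1 / h) + 4 * h * e2"
      using crowd[OF c(1)] field2[OF c(1)] pos by (intro add_mono mult_mono mult_left_mono) auto
    finally show ?thesis .
  qed
  have b2: "norm (\<Sum>j\<in>R. 1 / (c - x j)) \<le> 1 / h"
  proof -
    have "norm (\<Sum>j\<in>R. 1 / (c - x j)) \<le> real (card R) * (1 / h)"
    proof (rule sum_norm_bound)
      fix j assume "j \<in> R"
      then have "h \<le> norm (c - x j)" using R ch[of j] by (auto simp: dist_norm)
      then show "norm (1 / (c - x j)) \<le> 1 / h"
        using pos by (simp add: norm_divide divide_left_mono frac_le)
    qed
    also have "\<dots> \<le> 1 * (1 / h)" using R pos by (intro mult_right_mono) auto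
    finally show ?thesis by simp
  qed
  have b3: "norm (of_nat n / c - of_nat n / z) \<le> 4 * h * n"
  proof -
    have "of_nat n / c - of_nat n / z = of_nat n * (z - c) / (c * z)"
      using c0 z0 by (simp add: field_simps)
    then have "norm (of_nat n / c - of_nat n / z) = real n * norm (z - c) / (norm c * norm z)"
      by (simp add: norm_divide norm_mult)
    also have "\<dots> \<le> real n * (2 * h) / (1 * (1 / 2))"
      using cz z0 c pos by (intro frac_le mult_mono) (auto simp: dist_norm norm_minus_commute)
    finally show ?thesis by (simp add: mult_ac)
  qed
  have "norm ((\<Sum>j\<in>roots - R. 1 / (z - x j)) - of_nat n / z)
     \<le> (m * (3 / s + 1 / h) + 4 * h * e2) + 1 / h + e1 + 4 * h * n"
    unfolding split
    by (intro norm_triangle_mono norm_triangle_le_diff add_mono b1 b2 b3 field1[OF c(1)])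
  then show ?thesis using E by linarith
qed

text \<open>The main term n/z has modulus at least 4 n / 5 and the error is at most n/16, which
  leaves n/2. The last bound converts an error E of the field into an error 4 E / n^2 of its
  reciprocal, and this governs the accuracy of the pairing.\<close>

lemma field_lower:
  fixes z S :: complex
  assumes z: "\<bar>1 - norm z\<bar> \<le> h / 2" and est: "norm (S - of_nat n / z) \<le> E"
  shows "n / 2 \<le> norm S" "z \<noteq> 0" "norm (z / of_nat n - 1 / S) \<le> 4 * E / (real n)\<^sup>2"
proof -
  have zz: "1 / 2 \<le> norm z" "norm z \<le> 5 / 4" using z scales by linarith+
  then show z0: "z \<noteq> 0" by auto
  have "real n / (5 / 4) \<le> n / norm z" using zz n0 by (intro divide_left_mono) auto
  also have "n / norm z = norm (of_nat n / z)" by (simp add: norm_divide)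
  also have "\<dots> \<le> norm S + norm (S - of_nat n / z)" by (metis norm_minus_commute norm_triangle_sub)
  finally show S: "n / 2 \<le> norm S" using est E by simp
  then have S0: "S \<noteq> 0" using n0 by auto
  have "z / of_nat n - 1 / S = z * (S - of_nat n / z) / (of_nat n * S)"
    using z0 S0 n0 by (simp add: field_simps)
  then have "norm (z / of_nat n - 1 / S) = norm z * norm (S - of_nat n / z) / (n * norm S)"
    by (simp add: norm_divide norm_mult)
  also have "\<dots> \<le> 2 * E / (n * (n / 2))"
    using zz est S n0 E0 by (intro frac_le mult_mono) auto
  finally show "norm (z / of_nat n - 1 / S) \<le> 4 * E / (real n)\<^sup>2" by (simp add: power2_eq_square)
qed

text \<open>The part 4 E / n^2 comes from replacing the reciprocal field by w/n; the rest covers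
  replacing w/n by x_i/n, which costs at most 2/n^2.\<close>

definition "err = (4 * E + 3) / (real n)\<^sup>2"

lemma err0: "0 < err" using E0 n0 by (simp add: err_def)

lemma fixed_point_close:
  assumes z: "\<bar>1 - norm w\<bar> \<le> h / 2" and est: "norm (S - of_nat n / w) \<le> E" and w: "w = x i - 1 / S"
  shows "norm (w - x i * (1 - 1 / of_nat n)) \<le> err" "dist w (x i) \<le> 2 / n"
proof -
  note fl = field_lower[OF z est]
  have S0: "S \<noteq> 0" using fl(1) n0 by auto
  have "dist w (x i) = 1 / norm S" using w by (simp add: dist_norm norm_divide)
  also have "\<dots> \<le> 1 / (n / 2)" using fl(1) n0 by (intro divide_left_mono mult_pos_pos) auto
  finally show d: "dist w (x i) \<le> 2 / n" by simp
  have "w - x i * (1 - 1 / of_nat n) = (x i - w) / of_nat n + (w / of_nat n - 1 / S)"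
    by (subst (1) w) (simp add: algebra_simps diff_divide_distrib)
  also have "norm \<dots> \<le> (2 / n) / n + 4 * E / (real n)\<^sup>2"
  proof (rule norm_triangle_mono)
    show "norm ((x i - w) / of_nat n) \<le> 2 / n / n"
      using d n0 unfolding norm_divide dist_norm
      by (subst norm_minus_commute) (simp only: norm_of_nat, intro divide_right_mono, auto)
  qed (use fl(3) in simp)
  also have "\<dots> \<le> err" using n0 by (simp add: err_def power2_eq_square add_divide_distrib divide_right_mono)
  finally show "norm (w - x i * (1 - 1 / of_nat n)) \<le> err" .
qed

text \<open>As 6/n \<le> s2, the disc of radius 3/n around x_i stays at least s2/2 away from the
  other roots. The wider separation \<open>s2\<close> is made for F: at n^(-0.65) the crowded part
  of F is about n^1.42, whereas the scale n^(-0.73) of \<open>s\<close> would give n^1.58 and an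
  error of order n^(-1.42), too large for the rate n^(-3/2) approached as \<alpha> tends to
  0.\<close>

lemma near_root:
  assumes i: "i \<in> roots" "1 - 2 * L / n \<le> norm (x i)" and z: "dist z (x i) \<le> 3 / n"
  shows "\<bar>1 - norm z\<bar> \<le> h / 2" "\<And>j. j \<in> roots - {i} \<Longrightarrow> s2 / 2 \<le> dist z (x j)"
    "norm (G i z - of_nat n / z) \<le> E" "(\<Sum>j\<in>roots - {i}. 1 / (norm (z - x j))\<^sup>2) \<le> F"
proof -
  have "\<bar>1 - norm (x i)\<bar> \<le> 2 * L / n" using i disk[OF i(1)] by auto
  moreover have "\<bar>norm z - norm (x i)\<bar> \<le> 3 / n"
    using z norm_triangle_ineq3[of z "x i"] by (simp add: dist_norm)
  ultimately show zh: "\<bar>1 - norm z\<bar> \<le> h / 2" using scales by linarith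
  show far: "s2 / 2 \<le> dist z (x j)" if j: "j \<in> roots - {i}" for j
  proof -
    have "s2 < dist (x i) (x j)" using j i by (intro sep2) auto
    also have "\<dots> \<le> dist (x i) z + dist z (x j)" by (rule dist_triangle)
    finally show ?thesis using z scales by (simp add: dist_commute)
  qed
  have s2: "s / 3 \<le> s2 / 2" "0 < s2" using scales by auto
  show "norm (G i z - of_nat n / z) \<le> E"
  proof (intro field_estimate zh)
    show "s / 3 \<le> dist z (x j)" if "j \<in> roots - {i}" for j
      using far[OF that] s2 by linarith
  qed (use i in auto)
  obtain c where c: "c \<in> C" and cz: "dist c z \<le> 2 * h"
    using near_net[OF zh] by metis
  let ?N = "{j\<in>roots. dist c (x j) \<le> 4 * h}"
  have "(\<Sum>j\<in>roots - {i}. 1 / (norm (z - x j))\<^sup>2)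
      \<le> (\<Sum>j\<in>roots - {i}. (if dist c (x j) \<le> 4 * h then 4 / s2\<^sup>2 else 0) + 4 * (1 / (norm (c - x j))\<^sup>2))"
  proof (rule sum_mono)
    fix j assume j: "j \<in> roots - {i}"
    show "1 / (norm (z - x j))\<^sup>2 \<le> (if dist c (x j) \<le> 4 * h then 4 / s2\<^sup>2 else 0) + 4 * (1 / (norm (c - x j))\<^sup>2)"
    proof (cases "dist c (x j) \<le> 4 * h")
      case True
      have "1 / (norm (z - x j))\<^sup>2 \<le> 1 / (s2 / 2)\<^sup>2"
        using far[OF j] s2 by (intro divide_left_mono power_mono mult_pos_pos zero_less_power) (auto simp: dist_norm)
      also have "\<dots> = 4 / s2\<^sup>2" by (simp add: power2_eq_square)
      finally show ?thesis using True by (auto intro: add_increasing2)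
    next
      case False
      let ?d = "norm (c - x j)"
      have d: "4 * h < ?d" using False j by (auto simp: dist_norm)
      have "?d / 2 \<le> norm (z - x j)"
        using dist_triangle[of c "x j" z] cz d by (simp add: dist_norm)
      then have "1 / (norm (z - x j))\<^sup>2 \<le> 1 / (?d / 2)\<^sup>2"
        using d scales by (intro divide_left_mono power_mono mult_pos_pos zero_less_power) auto
      also have "\<dots> = 4 * (1 / ?d\<^sup>2)" by (simp add: power2_eq_square)
      finally show ?thesis using False by auto
    qed
  qed
  also have "\<dots> \<le> (\<Sum>j\<in>roots. (if dist c (x j) \<le> 4 * h then 4 / s2\<^sup>2 else 0) + 4 * (1 / (norm (c - x j))\<^sup>2))"
    by (intro sum_mono2) auto
  also have "\<dots> = real (card ?N) * (4 / s2\<^sup>2) + 4 * (\<Sum>j\<in>roots. 1 / (norm (c - x j))\<^sup>2)"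
    by (simp only: sum.distrib sum_distrib_left sum.inter_filter[OF finite_atLeastAtMost, symmetric]) simp
  also have "\<dots> \<le> m * (4 / s2\<^sup>2) + 4 * e2"
    using crowd[OF c(1)] field2[OF c(1)] by (intro add_mono mult_right_mono mult_left_mono) auto
  finally show "(\<Sum>j\<in>roots - {i}. 1 / (norm (z - x j))\<^sup>2) \<le> F" using F by (simp add: mult.commute)
qed

text \<open>The first part is the change 3 F / n of the field over the disc divided by the squared
  lower bound (n/2)^2; the second is the cost 1/|n G| \<le> 2/n^2 of averaging over n - 1 terms but
  dividing by n.\<close>

definition "err1 = 12 * F / real n ^ 3 + 2 / (real n)\<^sup>2"

text \<open>The contraction argument is applied with g = n/2 and \<rho> = 3/n; the condition 8 F <
  n^2 gives both 2 F \<le> g^2 and \<rho> F < g.\<close>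

lemma paired_crit:
  assumes i: "i \<in> roots" "1 - 2 * L / n \<le> norm (x i)"
  obtains w where "only_crit_within p (3 / n) (x i) w" "dist w (x i) \<le> 3 / n"
    "norm (w - x i * (1 - 1 / of_nat n)) \<le> err"
    "norm (w - x i + 1 / of_nat n * (1 / root_mean x n i)) \<le> err1"
proof -
  note nr = near_root[OF i]
  have F0: "0 \<le> F"
  proof -
    have "0 \<le> (\<Sum>j\<in>roots - {i}. 1 / (norm (x i - x j))\<^sup>2)" by (intro sum_nonneg) auto
    also have "\<dots> \<le> F" using n0 by (intro nr) auto
    finally show ?thesis .
  qed
  have low: "n / 2 \<le> norm (G i z)" if "dist z (x i) \<le> 3 / n" for z
    using field_lower(1)[OF nr(1)[OF that] nr(3)[OF that]] .
  have ne: "z \<noteq> x j" if "dist z (x i) \<le> 3 / n" "j \<in> roots - {i}" for z j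
    using nr(2)[OF that] scales by auto
  obtain w where w: "only_crit_within p (3 / n) (x i) w" "dist w (x i) \<le> 3 / n" "w = x i - 1 / G i w"
  proof (rule unique_crit_near_root[of i n "n / 2" "3 / n" F x])
    show "2 * F \<le> (real n / 2)\<^sup>2" using F by (simp add: power2_eq_square)
    show "3 / n * F < n / 2" using F F0 n0 by (simp add: field_simps power2_eq_square)
    show "n / 2 \<le> norm (G i z)" if "dist z (x i) \<le> 3 / n" for z using low[OF that] .
    show "(\<Sum>j\<in>roots - {i}. 1 / (norm (z - x j))\<^sup>2) \<le> F" if "dist z (x i) \<le> 3 / n" for z
      using nr(4)[OF that] .
    show "z \<noteq> x j" if "dist z (x i) \<le> 3 / n" "j \<in> roots - {i}" for z j using ne[OF that] .
  qed (use i n0 in \<open>auto simp: divide_le_cancel\<close>)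
  have d0: "dist (x i) (x i) \<le> 3 / n" using n0 by simp
  have "norm (w - x i * (1 - 1 / of_nat n)) \<le> err"
    using fixed_point_close(1)[OF nr(1)[OF w(2)] nr(3)[OF w(2)] w(3)] .
  moreover have "norm (w - x i + 1 / of_nat n * (1 / root_mean x n i)) \<le> err1"
  proof -
    have G0: "G i w \<noteq> 0" "G i (x i) \<noteq> 0" using low[OF w(2)] low[OF d0] n0 by auto
    have rm: "1 / of_nat n * (1 / root_mean x n i) = (1 - 1 / of_nat n) / G i (x i)"
    proof -
      have "root_mean x n i = G i (x i) / of_nat (n - 1)" by (simp add: root_mean_def)
      moreover have "of_nat (n - 1) = (of_nat n - 1 :: complex)" using n by (simp add: of_nat_diff)
      ultimately show ?thesis using n0 by (simp add: field_simps)
    qed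
    have "w - x i + 1 / of_nat n * (1 / root_mean x n i)
        = (G i w - G i (x i)) / (G i w * G i (x i)) - 1 / (of_nat n * G i (x i))"
      unfolding rm using G0 n0 by (subst w(3)) (simp add: divide_simps, simp add: algebra_simps)
    also have "norm \<dots> \<le> F * (3 / n) / (n / 2 * (n / 2)) + 1 / (n * (n / 2))"
    proof (rule order_trans[OF norm_triangle_ineq4], intro add_mono)
      have "norm (G i w - G i (x i)) \<le> F * norm (w - x i)"
        by (intro resolvent_sum_diff_le nr ne w d0) auto
      also have "\<dots> \<le> F * (3 / n)" using w(2) F0 by (intro mult_left_mono) (auto simp: dist_norm)
      finally show "norm ((G i w - G i (x i)) / (G i w * G i (x i))) \<le> F * (3 / n) / (n / 2 * (n / 2))"
        unfolding norm_divide norm_mult using low[OF w(2)] low[OF d0] n0 F0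
        by (intro frac_le mult_mono) auto
      show "norm (1 / (of_nat n * G i (x i))) \<le> 1 / (n * (n / 2))"
        unfolding norm_divide norm_mult using low[OF d0] n0
        by (intro frac_le mult_mono mult_pos_pos) auto
    qed
    also have "\<dots> = err1" by (simp add: err1_def power2_eq_square power3_eq_cube)
    finally show ?thesis .
  qed
  ultimately show ?thesis using that w by blast
qed

text \<open>Without a root within s/3 the full field is within E of n/w and cannot vanish. So some
  root is that close; by \<open>sep\<close> all others keep a distance of at least s/3 from w, their
  field is under control, and the critical point equation makes w a fixed point of the map used in
  the pairing.\<close>

lemma crit_has_root:
  assumes w: "poly (pderiv p) w = 0" "1 - L / n \<le> norm w" and small: "err \<le> 1 / (2 * n)" and Ln: "2 * L \<le> n"
  obtains i where "i \<in> roots" "1 - L / n \<le> norm (x i)" "dist w (x i) \<le> 2 / n"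
    "norm (w - x i * (1 - 1 / of_nat n)) \<le> err"
proof -
  have w1: "norm w \<le> 1" using crit_pts_unit_disk[OF n disk w(1)] .
  have L0: "0 \<le> L / n" using scales by simp
  have wh: "\<bar>1 - norm w\<bar> \<le> h / 2"
  proof -
    have "L / n \<le> 2 * L / n + 3 / n" using L0 n0 by (simp add: field_simps)
    then show ?thesis using w w1 scales by simp
  qed
  have "\<exists>i\<in>roots. dist w (x i) < s / 3"
  proof (rule ccontr)
    assume *: "\<not> (\<exists>i\<in>roots. dist w (x i) < s / 3)"
    then have "norm ((\<Sum>j\<in>roots - {}. 1 / (w - x j)) - of_nat n / w) \<le> E"
      by (intro field_estimate wh) (auto simp: not_less)
    then have "n / 2 \<le> norm (\<Sum>j\<in>roots. 1 / (w - x j))" using field_lower(1)[OF wh] by simp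
    moreover have "(\<Sum>j\<in>roots. 1 / (w - x j)) = 0"
      using w(1) * scales by (subst pderiv_root_poly_off_roots[symmetric]) force+
    ultimately show False using n0 by (simp only: norm_zero)
  qed
  then obtain i where i: "i \<in> roots" "dist w (x i) < s / 3" by blast
  have "norm w - norm (x i) \<le> dist w (x i)" using norm_triangle_ineq2[of w "x i"] by (simp add: dist_norm)
  then have xi: "1 - s \<le> norm (x i)" using i w scales by linarith
  have far: "s / 3 \<le> dist w (x j)" if j: "j \<in> roots - {i}" for j
  proof -
    have "s < dist (x i) (x j)" using j i xi by (intro sep) auto
    also have "\<dots> \<le> dist (x i) w + dist w (x j)" by (rule dist_triangle)
    finally show ?thesis using i scales by (simp add: dist_commute)
  qed
  have est: "norm (G i w - of_nat n / w) \<le> E"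
    using far i by (intro field_estimate wh) auto
  have "1 + (w - x i) * G i w = 0"
    using far scales i w(1) by (subst pderiv_root_poly_at(1)[symmetric]) force+
  moreover have "G i w \<noteq> 0" using field_lower(1)[OF wh est] n0 by auto
  ultimately have fp: "w = x i - 1 / G i w" by (simp add: field_simps add_eq_0_iff)
  note close = fixed_point_close[OF wh est fp]
  \<comment> \<open>\<open>w\<close> has modulus about |x_i| (1 - 1/n), so it lies deeper than its
    root by nearly 1/n, more than \<open>err\<close> \<le> 1/(2 n) can undo; hence the root is in
    the annulus as well.\<close>
  have "1 - L / n \<le> norm (x i)"
  proof -
    have "norm w \<le> norm (x i * (1 - 1 / of_nat n)) + err"
      using close(1) norm_triangle_sub[of w "x i * (1 - 1 / of_nat n)"] by linarith
    also have "norm (x i * (1 - 1 / of_nat n)) = norm (x i) * (1 - 1 / n)" by (rule norm_shrunk)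
    finally have a: "1 - L / n - 1 / (2 * n) \<le> norm (x i) * (1 - 1 / n)" using w(2) small by linarith
    show ?thesis
    proof (rule ccontr)
      assume c: "\<not> 1 - L / n \<le> norm (x i)"
      have n1: "0 < 1 - 1 / real n" using Ln scales by (simp add: field_simps)
      have half: "L / n * (1 / n) \<le> 1 / 2 * (1 / n)" using Ln n0 by (intro mult_right_mono) (auto simp: field_simps)
      have "norm (x i) * (1 - 1 / n) < (1 - L / n) * (1 - 1 / n)"
        using c n1 by (intro mult_strict_right_mono) auto
      also have "\<dots> = 1 - L / n - 1 / n + L / n * (1 / n)" by (simp add: algebra_simps)
      finally show False using a half by simp
    qed
  qed
  then show ?thesis using that[of i] i(1) close by blast
qed

lemma only_crit_withinD:
  assumes "only_crit_within q r a w"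
  shows "w \<in># crit_pts q" "dist w a \<le> r" "count (crit_pts q) w = 1"
    "\<And>v. v \<in># crit_pts q \<Longrightarrow> dist v a \<le> r \<Longrightarrow> v = w"
proof -
  have eq: "{#v \<in># crit_pts q. dist v a \<le> r#} = {#w#}" using assms by (simp add: only_crit_within_def)
  have "w \<in># {#v \<in># crit_pts q. dist v a \<le> r#}" unfolding eq by simp
  then show w: "w \<in># crit_pts q" "dist w a \<le> r" by auto
  have "count {#v \<in># crit_pts q. dist v a \<le> r#} w = 1" unfolding eq by simp
  then show "count (crit_pts q) w = 1" using w by simp
  fix v assume "v \<in># crit_pts q" "dist v a \<le> r"
  then have "v \<in># {#v \<in># crit_pts q. dist v a \<le> r#}" by simp
  then show "v = w" unfolding eq by simp
qed

definition "paired i w \<longleftrightarrow> only_crit_within p (3 / n) (x i) w \<and> dist w (x i) \<le> 3 / n \<and>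
    norm (w - x i * (1 - 1 / of_nat n)) \<le> err \<and>
    norm (w - x i + 1 / of_nat n * (1 / root_mean x n i)) \<le> err1"

definition "W i = (SOME w. paired i w)"

lemma W:
  assumes i: "i \<in> roots" "1 - 2 * L / n \<le> norm (x i)"
  shows "only_crit_within p (3 / n) (x i) (W i)" "dist (W i) (x i) \<le> 3 / n"
    "norm (W i - x i * (1 - 1 / of_nat n)) \<le> err"
    "norm (W i - x i + 1 / of_nat n * (1 / root_mean x n i)) \<le> err1"
proof -
  obtain w where "paired i w" unfolding paired_def using paired_crit[OF i] by metis
  then have "paired i (W i)" unfolding W_def by (rule someI)
  then show "only_crit_within p (3 / n) (x i) (W i)" "dist (W i) (x i) \<le> 3 / n"
    "norm (W i - x i * (1 - 1 / of_nat n)) \<le> err"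
    "norm (W i - x i + 1 / of_nat n * (1 / root_mean x n i)) \<le> err1"
    unfolding paired_def by blast+
qed

lemma W_crit: "i \<in> roots \<Longrightarrow> 1 - 2 * L / n \<le> norm (x i) \<Longrightarrow> W i \<in># crit_pts p"
  using only_crit_withinD(1)[OF W(1)] by blast

lemma norm_W:
  assumes i: "i \<in> roots" "1 - 2 * L / n \<le> norm (x i)"
  shows "\<bar>norm (W i) - norm (x i) * (1 - 1 / n)\<bar> \<le> err" "norm (W i) \<le> 1"
proof -
  show "\<bar>norm (W i) - norm (x i) * (1 - 1 / n)\<bar> \<le> err"
    using norm_triangle_ineq3[of "W i" "x i * (1 - 1 / of_nat n)"] W(3)[OF i] by (simp only: norm_shrunk)
  have "poly (pderiv p) (W i) = 0" using W_crit[OF i] mem_crit_pts[OF n] by blast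
  then show "norm (W i) \<le> 1" using crit_pts_unit_disk[of n x "W i"] n disk by blast
qed

lemma roots_close_eq:
  assumes "i \<in> roots" "1 - 2 * L / n \<le> norm (x i)" "j \<in> roots"
    and "dist w (x i) \<le> 3 / n" "dist w (x j) \<le> 3 / n"
  shows "i = j"
proof (rule ccontr)
  assume "i \<noteq> j"
  then have "s2 < dist (x i) (x j)" using assms by (intro sep2) auto
  also have "\<dots> \<le> dist w (x i) + dist w (x j)" by (metis dist_commute dist_triangle)
  also have "\<dots> \<le> 3 / n + 3 / n" using assms by (intro add_mono)
  also have "\<dots> \<le> s2" using scales by simp
  finally show False by simp
qed

lemma annulus_wider: "1 - L / n \<le> r \<Longrightarrow> 1 - 2 * L / n \<le> r"
proof -
  have "L / n \<le> 2 * L / n" using scales n0 by (simp add: field_simps)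
  then show "1 - L / n \<le> r \<Longrightarrow> 1 - 2 * L / n \<le> r" by linarith
qed

lemma W_inj: "inj_on W {i \<in> roots. 1 - 2 * L / n \<le> norm (x i)}"
proof (rule inj_onI)
  fix i j
  assume *: "i \<in> {i \<in> roots. 1 - 2 * L / n \<le> norm (x i)}" "j \<in> {i \<in> roots. 1 - 2 * L / n \<le> norm (x i)}"
    "W i = W j"
  then have "dist (W i) (x i) \<le> 3 / n" "dist (W i) (x j) \<le> 3 / n" using W(2)[of i] W(2)[of j] by auto
  then show "i = j" using * by (intro roots_close_eq) auto
qed

section \<open>Parts (i) to (iv) for a fixed configuration of roots\<close>

context
  fixes l :: nat
  assumes Ll: "L = real l" and small: "err \<le> 1 / (2 * n)" and Ln: "2 * L \<le> n"
begin

abbreviation "A \<equiv> annulus l n"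

lemma mem_A: "w \<in> A \<longleftrightarrow> 1 - L / n \<le> norm w \<and> norm w \<le> 1"
  by (simp add: annulus_def Ll)

text \<open>The nearby root has only one critical point within 3/n, its partner, so the pairing
  exhausts the critical points of the annulus.\<close>

lemma crit_is_W:
  assumes w: "w \<in># crit_pts p" "1 - L / n \<le> norm w"
  obtains i where "i \<in> roots" "x i \<in> A" "w = W i"
proof -
  have "poly (pderiv p) w = 0" using w mem_crit_pts[OF n] by blast
  then obtain i where i: "i \<in> roots" "1 - L / n \<le> norm (x i)" "dist w (x i) \<le> 2 / n"
    using crit_has_root[OF _ w(2) small Ln] by metis
  have i2: "1 - 2 * L / n \<le> norm (x i)" using annulus_wider[OF i(2)] .
  have "(2::real) / n \<le> 3 / n" using n0 by (simp add: divide_right_mono)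
  then have "dist w (x i) \<le> 3 / n" using i(3) by linarith
  then have "w = W i" using only_crit_withinD(4)[OF W(1)[OF i(1) i2]] w by blast
  with i disk show ?thesis by (intro that[of i]) (auto simp: mem_A)
qed

lemma W_in_A:
  assumes i: "i \<in> roots" "1 - 1 / n \<le> norm (x i)"
  shows "W i \<in> A" "1 - 2 * L / n \<le> norm (x i)"
proof -
  have "1 / n \<le> 2 * L / n" using scales n0 by (intro divide_right_mono) auto
  then show i2: "1 - 2 * L / n \<le> norm (x i)" using i by linarith
  have "0 \<le> 1 - 1 / real n" using n by simp
  then have "(1 - 1 / n) * (1 - 1 / n) \<le> norm (x i) * (1 - 1 / n)"
    using i by (intro mult_right_mono) auto
  then have "1 - 2 / n \<le> norm (x i) * (1 - 1 / n)"
  proof -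
    have "(1 - 1 / real n) * (1 - 1 / n) = 1 - 2 / n + 1 / n * (1 / n)" by (simp add: algebra_simps)
    moreover have "0 \<le> 1 / real n * (1 / n)" by simp
    ultimately show ?thesis using \<open>(1 - 1 / n) * (1 - 1 / n) \<le> norm (x i) * (1 - 1 / n)\<close> by linarith
  qed
  moreover have "1 / (2 * n) \<le> 1 / n" using n0 by (simp add: frac_le)
  ultimately have "1 - 2 / n - 1 / n \<le> norm (W i)"
    using norm_W(1)[OF i(1) i2] small by linarith
  moreover have "3 / n \<le> L / n" using scales n0 by (intro divide_right_mono) auto
  ultimately show "W i \<in> A" using norm_W(2)[OF i(1) i2] by (simp add: mem_A)
qed

text \<open>Roots at depth at most 1/n are enough for part (i): their partners sink by about 1/n
  more, stay within depth 3/n \<le> L/n, and are distinct for distinct roots.\<close>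

lemma crit_count:
  "card {i \<in> roots. 1 - 1 / n \<le> norm (x i)} \<le> card {w \<in> A. w \<in># crit_pts p}"
proof (rule card_inj_on_le[of W])
  show "inj_on W {i \<in> roots. 1 - 1 / n \<le> norm (x i)}"
    using W_in_A by (intro inj_on_subset[OF W_inj]) auto
  show "W ` {i \<in> roots. 1 - 1 / n \<le> norm (x i)} \<subseteq> {w \<in> A. w \<in># crit_pts p}"
    using W_in_A W_crit by auto
  show "finite {w \<in> A. w \<in># crit_pts p}" by simp
qed

lemma roots_paired:
  "\<exists>W :: nat \<Rightarrow> complex. \<forall>i \<in> roots. x i \<in> A \<longrightarrow>
     only_crit_within p (3 / n) (x i) (W i) \<and>
     norm (W i - x i + (1 / of_nat n) * (1 / root_mean x n i)) \<le> err1 \<and>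
     norm (W i - x i * (1 - 1 / of_nat n)) \<le> err"
  using W annulus_wider by (intro exI[of _ W]) (auto simp: mem_A)

text \<open>Dividing by x_i, of modulus at least 1/2, doubles the error, hence the value of
  \<open>\<eta>\<close>. Conversely \<eta> \<le> 1/n puts every root in the stated relation within
  2/n of w, and the separation of the roots leaves only one.\<close>

lemma crit_paired:
  assumes \<eta>: "\<eta> = 2 * err"
  shows "\<exists>\<iota> :: complex \<Rightarrow> nat. inj_on \<iota> {w \<in> A. w \<in># crit_pts p} \<and>
     (\<forall>w \<in> {w \<in> A. w \<in># crit_pts p}.
        {i \<in> roots. x i \<in> A \<and> (\<exists>e. norm e \<le> \<eta> \<and> w = x i * (1 - 1 / of_nat n + e))} = {\<iota> w} \<and>
        norm (w - x (\<iota> w) * (1 - 1 / of_nat n)) \<le> err)"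
proof -
  let ?K = "{w \<in> A. w \<in># crit_pts p}"
  have "\<exists>i. i \<in> roots \<and> x i \<in> A \<and> w = W i" if w: "w \<in> ?K" for w
    using crit_is_W[of w] w by (auto simp: mem_A)
  then obtain \<iota> where \<iota>: "\<And>w. w \<in> ?K \<Longrightarrow> \<iota> w \<in> roots \<and> x (\<iota> w) \<in> A \<and> w = W (\<iota> w)"
    by metis
  have \<iota>2: "1 - 2 * L / n \<le> norm (x (\<iota> w))" if "w \<in> ?K" for w
    using \<iota>[OF that] annulus_wider by (auto simp: mem_A)
  have "inj_on \<iota> ?K" by (rule inj_onI) (metis \<iota>)
  moreover have "{i \<in> roots. x i \<in> A \<and> (\<exists>e. norm e \<le> \<eta> \<and> w = x i * (1 - 1 / of_nat n + e))} = {\<iota> w}"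
    if w: "w \<in> ?K" for w
  proof (intro equalityI subsetI)
    fix i assume "i \<in> {i \<in> roots. x i \<in> A \<and> (\<exists>e. norm e \<le> \<eta> \<and> w = x i * (1 - 1 / of_nat n + e))}"
    then obtain e where i: "i \<in> roots" "x i \<in> A" and e: "norm e \<le> \<eta>" "w = x i * (1 - 1 / of_nat n + e)" by blast
    have "w - x i = x i * (e - 1 / of_nat n)" by (simp add: e algebra_simps)
    then have "dist w (x i) = norm (x i) * norm (e - 1 / of_nat n)"
      by (simp add: dist_norm norm_mult)
    also have "\<dots> \<le> 1 * (norm e + norm (1 / of_nat n :: complex))"
      using disk[OF i(1)] by (intro mult_mono norm_triangle_ineq4) auto
    also have "\<dots> \<le> 1 / n + 1 / n" using e(1) small \<eta> by (simp add: norm_divide)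
    also have "\<dots> \<le> 3 / n" using n0 by (simp add: field_simps)
    finally have "dist w (x i) \<le> 3 / n" .
    moreover have "dist w (x (\<iota> w)) \<le> 3 / n" using W(2)[of "\<iota> w"] \<iota>[OF w] \<iota>2[OF w] by metis
    ultimately have "\<iota> w = i" using roots_close_eq \<iota>[OF w] \<iota>2[OF w] i(1) by blast
    then show "i \<in> {\<iota> w}" by simp
  next
    fix i assume "i \<in> {\<iota> w}"
    then have i: "i = \<iota> w" by simp
    have norm_half: "1 / 2 \<le> norm (x i)"
    proof -
      have "L / n \<le> 1 / 2" using Ln n0 by (simp add: field_simps)
      moreover have "1 - L / n \<le> norm (x i)" using \<iota>[OF w] by (simp add: mem_A i)
      ultimately show ?thesis by linarith
    qed
    then have x0: "x i \<noteq> 0" by auto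
    define e where "e = (w - x i * (1 - 1 / of_nat n)) / x i"
    have "w = x i * (1 - 1 / of_nat n + e)" using x0 by (simp add: e_def field_simps)
    moreover have "norm e \<le> \<eta>"
    proof -
      have "norm (w - x i * (1 - 1 / of_nat n)) \<le> err" using W(3)[of i] \<iota>[OF w] \<iota>2[OF w] unfolding i by metis
      then have "norm e \<le> err / (1 / 2)"
        unfolding e_def norm_divide using norm_half err0 by (intro frac_le) auto
      then show ?thesis by (simp add: \<eta>)
    qed
    ultimately show "i \<in> {i \<in> roots. x i \<in> A \<and> (\<exists>e. norm e \<le> \<eta> \<and> w = x i * (1 - 1 / of_nat n + e))}"
      using \<iota>[OF w] unfolding i by blast
  qed
  moreover have "norm (w - x (\<iota> w) * (1 - 1 / of_nat n)) \<le> err" if w: "w \<in> ?K" for w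
    using W(3)[of "\<iota> w"] \<iota>[OF w] \<iota>2[OF w] by metis
  ultimately show ?thesis by blast
qed

text \<open>The factor 1 - 1/n \<ge> 1/2 shrinks a gap of 5 \<open>err\<close> to no less than 5/2
  \<open>err\<close>, more than the total error 2 \<open>err\<close> of two partners. So the moduli
  of the partners compare like those of the roots, and the k-th largest on both sides is found by
  counting.\<close>

lemma largest_paired:
  assumes t1: "t1 \<le> 1 / n" and top: "l \<le> card {i \<in> roots. 1 - t1 \<le> norm (x i)}"
    and gap: "\<And>i j. i \<in> roots \<Longrightarrow> j \<in> roots \<Longrightarrow> i \<noteq> j \<Longrightarrow> 1 - t1 \<le> norm (x i) \<Longrightarrow>
      5 * err < \<bar>norm (x i) - norm (x j)\<bar>"
    and k: "k \<in> {1..l}"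
  obtains i where "i \<in> roots" "1 - t1 \<le> norm (x i)" "roots_desc x n k = x i" "crit_desc x n k = W i"
    "1 - 2 * L / n \<le> norm (x i)" "root_mean (roots_desc x n) n k = root_mean x n i"
proof -
  let ?T = "{i \<in> roots. 1 - t1 \<le> norm (x i)}"
  let ?X = "image_mset x (mset_set roots)" and ?K = "crit_pts p"
  have n2: "2 \<le> n" using Ln scales by linarith
  have half: "1 / real n \<le> 1 / 2" using n2 by (simp add: field_simps)
  have x0: "0 < norm (x i)" if "i \<in> ?T" for i
  proof -
    have "1 - t1 \<le> norm (x i)" using that by blast
    then show ?thesis using t1 half by linarith
  qed
  have T1: "1 - 1 / n \<le> norm (x i)" if "i \<in> ?T" for i using that t1 by auto
  note T2 = W_in_A[OF _ T1]
  have "card ?T \<le> card roots" by (intro card_mono) auto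
  then have kn: "k \<in> roots" using k top by auto
  have above: "cpx_less (x i) (x j) \<longleftrightarrow> norm (x i) < norm (x j)" "cpx_le (x i) (x j) \<longleftrightarrow> norm (x i) < norm (x j) \<or> i = j"
    if i: "i \<in> ?T" and j: "j \<in> roots" for i j
  proof -
    have "norm (x i) \<noteq> norm (x j)" if "i \<noteq> j" using gap[of i j] i j that err0 by auto
    then show "cpx_less (x i) (x j) \<longleftrightarrow> norm (x i) < norm (x j)" "cpx_le (x i) (x j) \<longleftrightarrow> norm (x i) < norm (x j) \<or> i = j"
      using cpx_less_if_norm[OF x0[OF i], of "x j"] cpx_le_imp_norm[of "x i" "x j"] cpx_le_refl[of "x i"]
      unfolding cpx_less_def by (metis less_le)+
  qed
  have k1: "1 \<le> k" "k \<le> size ?X" using kn by auto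
  note kp = kth_largest_props[OF k1]
  obtain i where i: "i \<in> roots" and xi: "roots_desc x n k = x i"
    using kp(1) by (auto simp: roots_desc_def)
  \<comment> \<open>Otherwise all of the at least l top roots would lie above the k-th largest root,
    which has fewer than k \<le> l above it.\<close>
  have iT: "i \<in> ?T"
  proof (rule ccontr)
    assume "i \<notin> ?T"
    then have "cpx_less (x i) (x j)" if "j \<in> ?T" for j
      using above(1)[OF that i] that i x0[OF that]
      by (auto simp: cpx_less_def cpx_le_def)
    then have "?T \<subseteq> {j \<in> roots. cpx_less (x i) (x j)}" by blast
    then have "card ?T \<le> card {j \<in> roots. cpx_less (x i) (x j)}" by (intro card_mono) auto
    also have "\<dots> < k" using kp(2) xi by (simp add: size_filter_image_mset_set roots_desc_def)
    finally show False using top k by simp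
  qed
  let ?U = "{j \<in> roots. norm (x i) < norm (x j)}"
  have U1: "card ?U < k"
  proof -
    have "card ?U = card {j \<in> roots. cpx_less (x i) (x j)}" using above(1)[OF iT] by (metis (lifting))
    then show ?thesis using kp(2) xi by (simp add: size_filter_image_mset_set roots_desc_def)
  qed
  have U2: "k \<le> card (insert i ?U)"
  proof -
    have "insert i ?U = {j \<in> roots. cpx_le (x i) (x j)}" using above(2)[OF iT] i by blast
    then show ?thesis using kp(3) xi by (simp add: size_filter_image_mset_set roots_desc_def)
  qed
  have UT: "?U \<subseteq> ?T" using iT by auto
  have order: "norm (W i) < norm (W j) \<longleftrightarrow> norm (x i) < norm (x j)" "norm (W i) \<noteq> norm (W j)"
    if j: "j \<in> roots" "j \<noteq> i" "1 - 2 * L / n \<le> norm (x j)" for j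
  proof -
    have g: "5 * err < \<bar>norm (x i) - norm (x j)\<bar>" using gap[of i j] iT j by auto
    let ?q = "1 - 1 / real n"
    have q: "1 / 2 \<le> ?q" using half by simp
    have a: "\<bar>norm (W i) - norm (x i) * ?q\<bar> \<le> err" "\<bar>norm (W j) - norm (x j) * ?q\<bar> \<le> err"
      using norm_W(1) iT T2(2)[of i] j by auto
    have *: "5 / 2 * err < b * ?q - a * ?q" if "5 * err < b - a" for a b
    proof -
      have "1 / 2 * (5 * err) < ?q * (b - a)"
        using that q err0 by (intro mult_le_less_imp_less) auto
      moreover have "?q * (b - a) = b * ?q - a * ?q" by (simp add: algebra_simps diff_divide_distrib)
      ultimately show ?thesis by simp
    qed
    show "norm (W i) < norm (W j) \<longleftrightarrow> norm (x i) < norm (x j)" "norm (W i) \<noteq> norm (W j)"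
      using g a *[of "norm (x i)" "norm (x j)"] *[of "norm (x j)" "norm (x i)"] err0 by linarith+
  qed
  have Wi: "W i \<in> A" using T2(1)[of i] iT by auto
  have Wi0: "0 < norm (W i)"
  proof -
    have "L / n \<le> 1 / 2" using Ln n0 by (simp add: field_simps)
    moreover have "1 - L / n \<le> norm (W i)" using Wi by (simp add: mem_A)
    ultimately show ?thesis by linarith
  qed
  \<comment> \<open>A critical point above \<open>W i\<close> has at least its modulus, so it lies
    in the annulus and is the partner of some root; no unpaired critical point can enter the ranking
    here.\<close>
  have Uset: "{y \<in> set_mset ?K. cpx_less (W i) y} = W ` ?U"
  proof (intro equalityI subsetI)
    fix y assume y: "y \<in> {y \<in> set_mset ?K. cpx_less (W i) y}"
    then have "norm (W i) \<le> norm y" using cpx_le_imp_norm by (auto simp: cpx_less_def)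
    then obtain j where j: "j \<in> roots" "x j \<in> A" "y = W j"
      using crit_is_W[of y] y Wi by (auto simp: mem_A)
    then have "j \<noteq> i" using y by (auto simp: cpx_less_def)
    then have "norm (x i) < norm (x j)"
      using order[of j] j annulus_wider \<open>norm (W i) \<le> norm y\<close> by (auto simp: mem_A)
    then show "y \<in> W ` ?U" using j by auto
  next
    fix y assume "y \<in> W ` ?U"
    then obtain j where j: "j \<in> ?U" "y = W j" by blast
    then have jT: "j \<in> ?T" using UT by blast
    have "norm (W i) < norm (W j)" using order(1)[of j] j T2(2)[of j] jT by auto
    then have "cpx_less (W i) y" using Wi0 j by (simp add: cpx_less_if_norm)
    moreover have "y \<in># ?K" using W_crit[of j] T2(2)[of j] jT j by auto
    ultimately show "y \<in> {y \<in> set_mset ?K. cpx_less (W i) y}" by simp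
  qed
  have Tfin: "finite ?U" by simp
  have injT: "inj_on W (insert i ?U)"
    using T2(2) iT UT by (intro inj_on_subset[OF W_inj]) blast
  have count1: "count ?K (W j) = 1" if "j \<in> ?T" for j
    using only_crit_withinD(3)[OF W(1)] T2(2)[of j] that by auto
  have size1: "size {#y \<in># ?K. P y#} = card J"
    if P: "{y \<in> set_mset ?K. P y} = W ` J" and J: "J \<subseteq> insert i ?U" for P J
  proof -
    have "size {#y \<in># ?K. P y#} = (\<Sum>y\<in>{y \<in> set_mset ?K. P y}. count ?K y)"
      by (simp add: size_multiset_overloaded_eq)
    also have "\<dots> = (\<Sum>y\<in>W ` J. 1)"
      unfolding P using J UT iT count1 by (intro sum.cong) auto
    also have "\<dots> = card J" using inj_on_subset[OF injT J] by (simp add: card_image)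
    finally show ?thesis .
  qed
  have "{y \<in> set_mset ?K. cpx_le (W i) y} = W ` insert i ?U"
  proof -
    have "W i \<in># ?K" using W_crit[of i] T2(2)[of i] iT by auto
    then have "{y \<in> set_mset ?K. cpx_le (W i) y} = insert (W i) {y \<in> set_mset ?K. cpx_less (W i) y}"
      using cpx_le_refl by (auto simp: cpx_less_def)
    then show ?thesis using Uset by simp
  qed
  then have "size {#y \<in># ?K. cpx_le (W i) y#} = card (insert i ?U)" by (rule size1) simp
  moreover have "size {#y \<in># ?K. cpx_less (W i) y#} = card ?U" using Uset by (rule size1) blast
  ultimately have "crit_desc x n k = W i"
    unfolding crit_desc_def using U1 U2 k1(1) by (intro kth_largest_eqI) (simp_all only:)
  moreover have "root_mean (roots_desc x n) n k = root_mean x n i"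
    using root_mean_roots_desc[OF i kn xi] .
  ultimately show ?thesis using that[of i] i iT xi T2(2)[of i] by auto
qed

end

end

section \<open>Random roots\<close>

locale radial_sample = radial_disk \<mu> K \<beta> + M: prob_space M
  for \<mu> :: "complex measure" and K \<beta> :: real and M :: "'a measure" +
  fixes X :: "nat \<Rightarrow> 'a \<Rightarrow> complex"
  assumes indep: "M.indep_vars (\<lambda>_. borel) X {1..}"
    and distr: "1 \<le> i \<Longrightarrow> distr M borel (X i) = \<mu>"
begin

lemma X_measurable: "1 \<le> i \<Longrightarrow> X i \<in> borel_measurable M"
  using indep by (auto simp: M.indep_vars_def)

lemma prob_X:
  assumes i: "1 \<le> i" and B: "B \<in> sets borel"
  shows "M.prob {\<omega> \<in> space M. X i \<omega> \<in> B} = prob B"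
proof -
  have "prob B = measure (distr M borel (X i)) B" by (simp only: distr[OF i])
  also have "\<dots> = M.prob (X i -` B \<inter> space M)" using X_measurable[OF i] B by (rule measure_distr)
  also have "X i -` B \<inter> space M = {\<omega> \<in> space M. X i \<omega> \<in> B}" by auto
  finally show ?thesis ..
qed

lemma expectation_X:
  fixes f :: "complex \<Rightarrow> 'b :: {banach, second_countable_topology}"
  assumes i: "1 \<le> i" and f: "f \<in> borel_measurable borel"
  shows "M.expectation (\<lambda>\<omega>. f (X i \<omega>)) = (\<integral>z. f z \<partial>\<mu>)"
  using integral_distr[OF X_measurable[OF i] f] distr[OF i] by simp

lemma event_sets:
  assumes "1 \<le> i" "B \<in> sets borel"
  shows "{\<omega> \<in> space M. X i \<omega> \<in> B} \<in> M.events"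
proof -
  note [measurable] = X_measurable[OF assms(1)] assms(2)
  show ?thesis by measurable
qed

lemma pair_event_sets:
  assumes i: "1 \<le> i" "1 \<le> j" and T: "T \<in> sets (borel \<Otimes>\<^sub>M borel)"
  shows "{\<omega> \<in> space M. (X i \<omega>, X j \<omega>) \<in> T} \<in> M.events"
proof -
  note [measurable] = X_measurable[OF i(1)] X_measurable[OF i(2)] T
  show ?thesis by measurable
qed

lemma indep_pair:
  assumes "1 \<le> i" "1 \<le> j" "i \<noteq> j"
  shows "M.indep_var borel (X i) borel (X j)"
proof -
  have "M.indep_var borel ((\<lambda>f. f i) \<circ> (\<lambda>\<omega>. restrict (\<lambda>i. X i \<omega>) {i}))
      borel ((\<lambda>f. f j) \<circ> (\<lambda>\<omega>. restrict (\<lambda>i. X i \<omega>) {j}))"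
    using assms by (intro M.indep_var_compose[OF M.indep_var_restrict[OF indep]]) auto
  then show ?thesis by (simp add: comp_def)
qed

lemma indep_upto: "M.indep_vars (\<lambda>_. borel) X {1..n}"
  by (rule M.indep_vars_subset[OF indep]) auto

text \<open>A union bound over the at most n^2 ordered pairs, each estimated by conditioning on its
  first member.\<close>

lemma some_pair_bound:
  fixes n :: nat
  assumes S: "S \<in> sets borel" and T: "T \<in> sets (borel \<Otimes>\<^sub>M borel)"
    and b: "\<And>x. x \<in> S \<Longrightarrow> prob {y. (x, y) \<in> T} \<le> b"
  defines "B \<equiv> \<Union>i\<in>{1..n}. \<Union>j\<in>{1..n} - {i}. {\<omega> \<in> space M. X i \<omega> \<in> S \<and> (X i \<omega>, X j \<omega>) \<in> T}"
  shows "B \<in> M.events" "0 \<le> b \<Longrightarrow> M.prob B \<le> (real n)\<^sup>2 * (prob S * b)"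
proof -
  have ev: "{\<omega> \<in> space M. X i \<omega> \<in> S \<and> (X i \<omega>, X j \<omega>) \<in> T} \<in> M.events" if "i \<in> {1..n}" "j \<in> {1..n}" for i j
  proof -
    have "{\<omega> \<in> space M. X i \<omega> \<in> S \<and> (X i \<omega>, X j \<omega>) \<in> T}
      = {\<omega> \<in> space M. X i \<omega> \<in> S} \<inter> {\<omega> \<in> space M. (X i \<omega>, X j \<omega>) \<in> T}" by auto
    also have "\<dots> \<in> M.events" using that S T by (intro sets.Int event_sets pair_event_sets) auto
    finally show ?thesis .
  qed
  then show "B \<in> M.events" unfolding B_def by (intro sets.finite_UN) auto
  assume b0: "0 \<le> b"
  have pb: "M.prob {\<omega> \<in> space M. X i \<omega> \<in> S \<and> (X i \<omega>, X j \<omega>) \<in> T} \<le> prob S * b"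
    if "i \<in> {1..n}" "j \<in> {1..n} - {i}" for i j
    using M.indep_pair_bound[OF indep_pair distr S T b, of i j] that prob_X[of i S] S by auto
  have "M.prob B \<le> (\<Sum>i\<in>{1..n}. M.prob (\<Union>j\<in>{1..n} - {i}. {\<omega> \<in> space M. X i \<omega> \<in> S \<and> (X i \<omega>, X j \<omega>) \<in> T}))"
    unfolding B_def using ev by (intro measure_UNION_le sets.finite_UN) auto
  also have "\<dots> \<le> (\<Sum>i\<in>{1..n}. \<Sum>j\<in>{1..n} - {i}. M.prob {\<omega> \<in> space M. X i \<omega> \<in> S \<and> (X i \<omega>, X j \<omega>) \<in> T})"
    using ev by (intro sum_mono measure_UNION_le) auto
  also have "\<dots> \<le> (\<Sum>i\<in>{1..n}. \<Sum>j\<in>{1..n} - {i}. prob S * b)"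
    using pb by (intro sum_mono) auto
  also have "\<dots> \<le> (\<Sum>i\<in>{1..n}. \<Sum>j\<in>{1..n}. prob S * b)"
    using b0 by (intro sum_mono sum_mono2) auto
  also have "\<dots> = (real n)\<^sup>2 * (prob S * b)" by (simp add: power2_eq_square)
  finally show "M.prob B \<le> (real n)\<^sup>2 * (prob S * b)" .
qed

definition "close_event n t s = (\<Union>i\<in>{1..n}. \<Union>j\<in>{1..n} - {i}.
  {\<omega> \<in> space M. X i \<omega> \<in> {x. 1 - t \<le> norm x \<and> norm x \<le> 1} \<and> (X i \<omega>, X j \<omega>) \<in> {(x, y). dist x y \<le> s}})"

lemma closed_pair_sets:
  fixes T :: "(complex \<times> complex) set"
  shows "closed T \<Longrightarrow> T \<in> sets (borel \<Otimes>\<^sub>M borel)"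
  unfolding borel_prod by (rule borel_closed)

lemma close_event:
  assumes t: "0 < t" "t \<le> s" "s < 1"
  shows "close_event n t s \<in> M.events"
    "M.prob (close_event n t s) \<le> (real n)\<^sup>2 * (K * t powr \<beta> * (40 * K * s powr (1 + \<beta>)))"
proof -
  let ?S = "{x::complex. 1 - t \<le> norm x \<and> norm x \<le> 1}" and ?T = "{(x, y). dist (x::complex) y \<le> s}"
  have S: "?S \<in> sets borel" by measurable
  have T: "?T \<in> sets (borel \<Otimes>\<^sub>M borel)"
  proof (rule closed_pair_sets)
    have "closed {p::complex \<times> complex. dist (fst p) (snd p) \<le> s}"
      by (intro closed_Collect_le continuous_intros)
    then show "closed ?T" by (simp add: case_prod_unfold)
  qed
  have b: "prob {y. (x, y) \<in> ?T} \<le> 40 * K * s powr (1 + \<beta>)" if "x \<in> ?S" for x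
  proof -
    have "{y. (x, y) \<in> ?T} = cball x s" by auto
    then show ?thesis using cball_bound[of x s] that t by auto
  qed
  note sp = some_pair_bound[OF S T b, folded close_event_def]
  show "close_event n t s \<in> M.events" by (rule sp(1))
  have "M.prob (close_event n t s) \<le> (real n)\<^sup>2 * (prob ?S * (40 * K * s powr (1 + \<beta>)))"
    using K_pos by (intro sp(2)) auto
  also have "\<dots> \<le> (real n)\<^sup>2 * (K * t powr \<beta> * (40 * K * s powr (1 + \<beta>)))"
  proof (intro mult_left_mono mult_right_mono)
    have "prob ?S \<le> prob {z. 1 - t \<le> norm z}" by (intro finite_measure_mono) auto
    then show "prob ?S \<le> K * t powr \<beta>" using tail[OF t(1)] by linarith
  qed (use K_pos in auto)
  finally show "M.prob (close_event n t s) \<le> (real n)\<^sup>2 * (K * t powr \<beta> * (40 * K * s powr (1 + \<beta>)))" .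
qed

lemma close_event_avoided:
  assumes "\<omega> \<in> space M" "\<omega> \<notin> close_event n t s" "\<And>j. j \<in> {1..n} \<Longrightarrow> norm (X j \<omega>) \<le> 1"
    and "i \<in> {1..n}" "j \<in> {1..n}" "i \<noteq> j" "1 - t \<le> norm (X i \<omega>)"
  shows "s < dist (X i \<omega>) (X j \<omega>)"
proof (rule ccontr)
  assume "\<not> s < dist (X i \<omega>) (X j \<omega>)"
  then have "\<omega> \<in> close_event n t s"
    unfolding close_event_def using assms by (intro UN_I[of i] UN_I[of j]) auto
  with assms show False by simp
qed

text \<open>The condition |y| \<le> 1 - t0 keeps the second modulus away from the circle, where the
  radial density is unbounded; outside \<open>edge_event n t0\<close> all roots satisfy it.\<close>

definition "gap_event n t1 t0 g = (\<Union>i\<in>{1..n}. \<Union>j\<in>{1..n} - {i}.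
  {\<omega> \<in> space M. X i \<omega> \<in> {x. 1 - t1 \<le> norm x \<and> norm x \<le> 1} \<and>
     (X i \<omega>, X j \<omega>) \<in> {(x, y). \<bar>norm x - norm y\<bar> \<le> g \<and> norm y \<le> 1 - t0}})"

lemma gap_event:
  assumes t: "0 < t1" "0 < t0" "0 < g" "t1 + g \<le> \<epsilon>"
    and ring: "\<And>r1 r2. 1 - \<epsilon> \<le> r1 \<Longrightarrow> r1 \<le> r2 \<Longrightarrow> r2 < 1 \<Longrightarrow>
      prob {z. r1 \<le> norm z \<and> norm z \<le> r2} \<le> K * (r2 - r1) * (1 - r2) powr \<alpha>"
    and \<alpha>: "\<alpha> \<le> 0"
  shows "gap_event n t1 t0 g \<in> M.events"
    "M.prob (gap_event n t1 t0 g) \<le> (real n)\<^sup>2 * (K * t1 powr \<beta> * (K * (2 * g) * t0 powr \<alpha>))"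
proof -
  let ?S = "{x::complex. 1 - t1 \<le> norm x \<and> norm x \<le> 1}"
  let ?T = "{(x, y::complex). \<bar>norm (x::complex) - norm y\<bar> \<le> g \<and> norm y \<le> 1 - t0}"
  have S: "?S \<in> sets borel" by measurable
  have T: "?T \<in> sets (borel \<Otimes>\<^sub>M borel)"
  proof (rule closed_pair_sets)
    have "closed {p::complex \<times> complex. \<bar>norm (fst p) - norm (snd p)\<bar> \<le> g \<and> norm (snd p) \<le> 1 - t0}"
      by (intro closed_Collect_conj closed_Collect_le continuous_intros)
    then show "closed ?T" by (simp add: case_prod_unfold)
  qed
  have b: "prob {y. (x, y) \<in> ?T} \<le> K * (2 * g) * t0 powr \<alpha>" if x: "x \<in> ?S" for x
  proof -
    let ?r1 = "norm x - g" and ?r2 = "min (norm x + g) (1 - t0)"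
    have sub: "{y. (x, y) \<in> ?T} \<subseteq> {y. ?r1 \<le> norm y \<and> norm y \<le> ?r2}" by auto
    show ?thesis
    proof (cases "?r1 \<le> ?r2")
      case True
      have "prob {y. (x, y) \<in> ?T} \<le> prob {y. ?r1 \<le> norm y \<and> norm y \<le> ?r2}"
        using sub by (intro finite_measure_mono) (auto simp: sets_mu)
      also have "\<dots> \<le> K * (?r2 - ?r1) * (1 - ?r2) powr \<alpha>"
        using x t True by (intro ring) auto
      also have "\<dots> \<le> K * (2 * g) * t0 powr \<alpha>"
        using K_pos True t \<alpha> by (intro mult_mono powr_mono2') auto
      finally show ?thesis .
    next
      case False
      then have "{y. ?r1 \<le> norm y \<and> norm y \<le> ?r2} = {}" by (auto simp del: min_less_iff_disj)
      then have "{y. (x, y) \<in> ?T} = {}" using sub by blast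
      then show ?thesis using K_pos t by (simp del: mem_Collect_eq)
    qed
  qed
  note sp = some_pair_bound[OF S T b, folded gap_event_def]
  show "gap_event n t1 t0 g \<in> M.events" by (rule sp(1))
  have "M.prob (gap_event n t1 t0 g) \<le> (real n)\<^sup>2 * (prob ?S * (K * (2 * g) * t0 powr \<alpha>))"
    using K_pos t by (intro sp(2)) auto
  also have "\<dots> \<le> (real n)\<^sup>2 * (K * t1 powr \<beta> * (K * (2 * g) * t0 powr \<alpha>))"
  proof (intro mult_left_mono mult_right_mono)
    have "prob ?S \<le> prob {z. 1 - t1 \<le> norm z}" by (intro finite_measure_mono) auto
    then show "prob ?S \<le> K * t1 powr \<beta>" using tail[OF t(1)] by linarith
  qed (use K_pos t in auto)
  finally show "M.prob (gap_event n t1 t0 g) \<le> (real n)\<^sup>2 * (K * t1 powr \<beta> * (K * (2 * g) * t0 powr \<alpha>))" .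
qed

lemma gap_event_avoided:
  assumes "\<omega> \<in> space M" "\<omega> \<notin> gap_event n t1 t0 g" "\<And>j. j \<in> {1..n} \<Longrightarrow> norm (X j \<omega>) \<le> 1 - t0" "0 \<le> t0"
    and "i \<in> {1..n}" "j \<in> {1..n}" "i \<noteq> j" "1 - t1 \<le> norm (X i \<omega>)"
  shows "g < \<bar>norm (X i \<omega>) - norm (X j \<omega>)\<bar>"
proof (rule ccontr)
  assume "\<not> g < \<bar>norm (X i \<omega>) - norm (X j \<omega>)\<bar>"
  moreover have "norm (X i \<omega>) \<le> 1" using assms(3)[OF assms(5)] assms(4) by simp
  ultimately have "\<omega> \<in> gap_event n t1 t0 g"
    unfolding gap_event_def using assms by (intro UN_I[of i] UN_I[of j]) auto
  with assms show False by simp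
qed

text \<open>The strict inequality lets t = 0 stand for the null event that some root leaves the
  closed disk.\<close>

definition "edge_event n t = (\<Union>i\<in>{1..n}. {\<omega> \<in> space M. X i \<omega> \<in> {x. 1 - t < norm x}})"

lemma edge_event:
  shows "edge_event n t \<in> M.events" "0 < t \<Longrightarrow> M.prob (edge_event n t) \<le> n * (K * t powr \<beta>)"
    "M.prob (edge_event n 0) = 0"
proof -
  let ?B = "\<lambda>t. {x::complex. 1 - t < norm x}"
  have B: "?B t \<in> sets borel" for t by measurable
  have ev: "edge_event n t \<in> M.events" for t
    unfolding edge_event_def using B by (intro sets.finite_UN event_sets) auto
  then show "edge_event n t \<in> M.events" .
  have le: "M.prob (edge_event n t) \<le> n * prob (?B t)" for t
  proof -
    have "M.prob (edge_event n t) \<le> (\<Sum>i\<in>{1..n}. M.prob {\<omega> \<in> space M. X i \<omega> \<in> ?B t})"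
      unfolding edge_event_def using B by (intro measure_UNION_le event_sets) auto
    also have "\<dots> = (\<Sum>i\<in>{1..n}. prob (?B t))" using B by (intro sum.cong prob_X) auto
    also have "\<dots> = n * prob (?B t)" by simp
    finally show ?thesis .
  qed
  show "M.prob (edge_event n t) \<le> n * (K * t powr \<beta>)" if t: "0 < t"
  proof -
    have "prob (?B t) \<le> prob {x. 1 - t \<le> norm x}" by (intro finite_measure_mono) auto
    then have "prob (?B t) \<le> K * t powr \<beta>" using tail[OF t] by linarith
    then show ?thesis using le[of t] by (meson mult_left_mono of_nat_0_le_iff order_trans)
  qed
  have "prob (?B 0) = 0"
    using disk by (intro prob_eq_0[THEN iffD2]) (auto elim!: eventually_mono simp: sets_mu)
  then show "M.prob (edge_event n 0) = 0" using le[of 0] by (simp add: measure_le_0_iff)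
qed

lemma edge_event_avoided:
  "\<omega> \<in> space M \<Longrightarrow> \<omega> \<notin> edge_event n t \<Longrightarrow> i \<in> {1..n} \<Longrightarrow> norm (X i \<omega>) \<le> 1 - t"
  unfolding edge_event_def by (auto simp: not_less)

definition "few_event n t \<tau> = {\<omega> \<in> space M. real (card {i \<in> {1..n}. X i \<omega> \<in> {x. 1 - t \<le> norm x}}) \<le> \<tau>}"

lemma card_event_sets:
  assumes B: "B \<in> sets borel"
  shows "{\<omega> \<in> space M. real (card {i \<in> {1..n}. X i \<omega> \<in> B}) \<le> \<tau>} \<in> M.events"
    "{\<omega> \<in> space M. \<tau> \<le> real (card {i \<in> {1..n}. X i \<omega> \<in> B})} \<in> M.events"
proof -
  have eq: "real (card {i \<in> {1..n}. X i \<omega> \<in> B}) = (\<Sum>i\<in>{1..n}. indicator B (X i \<omega>))" for \<omega>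
    by (simp add: indicator_def sum.If_cases Int_def)
  have [measurable]: "(\<lambda>\<omega>. \<Sum>i\<in>{1..n}. indicator B (X i \<omega>) :: real) \<in> borel_measurable M"
    using X_measurable B by (intro borel_measurable_sum) auto
  show "{\<omega> \<in> space M. real (card {i \<in> {1..n}. X i \<omega> \<in> B}) \<le> \<tau>} \<in> M.events"
    "{\<omega> \<in> space M. \<tau> \<le> real (card {i \<in> {1..n}. X i \<omega> \<in> B})} \<in> M.events"
    unfolding eq by measurable
qed

lemma few_event:
  assumes low: "k * t powr \<beta> \<le> prob {z. 1 - t \<le> norm z}" and k: "0 < k" "0 < t" and n: "1 \<le> n"
    and \<tau>: "2 * \<tau> \<le> n * (k * t powr \<beta>)"
  shows "few_event n t \<tau> \<in> M.events" "M.prob (few_event n t \<tau>) \<le> 4 / (n * (k * t powr \<beta>))"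
proof -
  let ?B = "{x::complex. 1 - t \<le> norm x}"
  have B: "?B \<in> sets borel" by measurable
  show "few_event n t \<tau> \<in> M.events" unfolding few_event_def by (rule card_event_sets) (rule B)
  have pos: "0 < k * t powr \<beta>" using k by simp
  have "M.prob (few_event n t \<tau>) \<le> 4 / (real (card {1..n}) * prob ?B)"
    unfolding few_event_def
  proof (rule M.binomial_lower_tail[OF _ indep_upto B])
    have "n * (k * t powr \<beta>) \<le> n * prob ?B" using low by (intro mult_left_mono) auto
    then show "2 * \<tau> \<le> real (card {1..n}) * prob ?B" using \<tau> by simp
    show "M.prob {\<omega> \<in> space M. X i \<omega> \<in> ?B} = prob ?B" if "i \<in> {1..n}" for i
      using that B by (intro prob_X) auto
  qed (use n low pos in auto)
  also have "\<dots> \<le> 4 / (n * (k * t powr \<beta>))"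
    using low pos n k by (intro divide_left_mono mult_left_mono mult_pos_pos less_le_trans[OF pos low]) auto
  finally show "M.prob (few_event n t \<tau>) \<le> 4 / (n * (k * t powr \<beta>))" .
qed

text \<open>The truncation makes the variable bounded at every sample point; almost surely it is void.\<close>
definition resolvent :: "complex \<Rightarrow> complex \<Rightarrow> complex" where
  "resolvent c z = (if norm z \<le> 1 then 1 / (c - z) else 0)"

definition "field_event n c e1 = {\<omega> \<in> space M. e1
  \<le> norm ((\<Sum>i\<in>{1..n}. resolvent c (X i \<omega>)) - of_nat (card {1..n}) * (1 / c))}"

definition "energy_event n c e2 = {\<omega> \<in> space M. e2 \<le> (\<Sum>i\<in>{1..n}. (norm (resolvent c (X i \<omega>)))\<^sup>2)}"

definition "crowd_event n c h m = {\<omega> \<in> space M. m \<le> real (card {i \<in> {1..n}. X i \<omega> \<in> cball c (4 * h)})}"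

lemma resolvent_borel[measurable]: "resolvent c \<in> borel_measurable borel"
  unfolding resolvent_def by measurable

text \<open>On the disk |1/(c - z)| \<le> 1/h, so the fourth moment is at most V/h^2, which controls
  the variance of the energy. As e2 \<ge> 2 n V, an energy of e2 deviates from its mean by at least
  e2/2. For the crowding, the ball of radius 4 h around c lies in the ball of radius 5 h around its
  projection to the circle.\<close>

lemma net_events:
  assumes c: "norm c = 1 + h" and h: "0 < h" and u: "0 < u"
    and V: "1 / u + K * u powr \<beta> / h \<le> V" and e: "0 < e1" "0 < e2" "2 * real n * V \<le> e2"
  shows "field_event n c e1 \<in> M.events" "M.prob (field_event n c e1) \<le> 8 * real n * V / e1\<^sup>2"
    "energy_event n c e2 \<in> M.events" "M.prob (energy_event n c e2) \<le> 4 * real n * V / (h\<^sup>2 * e2\<^sup>2)"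
    "crowd_event n c h m \<in> M.events" "M.prob (crowd_event n c h m) \<le> exp (2 * real n * (10 * K * (5
      * h) powr (1 + \<beta>)) - m)"
proof -
  have c1: "1 < norm c" using c h by simp
  have bound: "norm (resolvent c z) \<le> 1 / h" for z
  proof (cases "norm z \<le> 1")
    case True
    have "h \<le> norm (c - z)" using norm_diff_ge[OF True c1] c by simp
    then show ?thesis using h True by (simp add: resolvent_def norm_divide frac_le)
  qed (use h in \<open>simp add: resolvent_def\<close>)
  have bound2: "(norm (resolvent c z))\<^sup>2 \<le> 1 / h\<^sup>2" for z
    using power_mono[OF bound[of z], of 2] by (simp add: power_one_over)
  have int2: "integrable \<mu> (\<lambda>z. (norm (resolvent c z))\<^sup>2)"
    using bound2 by (intro integrable_bounded[of _ "1 / h\<^sup>2"]) auto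
  have mean: "(\<integral>z. resolvent c z \<partial>\<mu>) = 1 / c"
  proof -
    have "(\<integral>z. resolvent c z \<partial>\<mu>) = (\<integral>z. 1 / (c - z) \<partial>\<mu>)"
      using disk by (intro integral_cong_AE) (auto elim!: eventually_mono simp: resolvent_def)
    then show ?thesis using resolvent_mean[OF c1] by simp
  qed
  have second: "(\<integral>z. (norm (resolvent c z))\<^sup>2 \<partial>\<mu>) \<le> V"
  proof -
    have "(\<integral>z. (norm (resolvent c z))\<^sup>2 \<partial>\<mu>) = (\<integral>z. 1 / (norm (c - z))\<^sup>2 \<partial>\<mu>)"
      using disk by (intro integral_cong_AE) (auto elim!: eventually_mono simp: resolvent_def norm_divide power_one_over)
    then show ?thesis using resolvent_second_moment[OF c h u] V by simp
  qed
  have indR: "M.indep_vars (\<lambda>_. borel) (\<lambda>i \<omega>. resolvent c (X i \<omega>)) {1..n}"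
    by (rule M.indep_vars_compose2[OF indep_upto]) auto
  have indE: "M.indep_vars (\<lambda>_. borel) (\<lambda>i \<omega>. (norm (resolvent c (X i \<omega>)))\<^sup>2) {1..n}"
    by (rule M.indep_vars_compose2[OF indep_upto]) auto
  have m1: "(\<lambda>\<omega>. \<Sum>i\<in>{1..n}. resolvent c (X i \<omega>)) \<in> borel_measurable M"
    using X_measurable by (intro borel_measurable_sum measurable_compose[OF _ resolvent_borel]) auto
  have m2: "(\<lambda>\<omega>. \<Sum>i\<in>{1..n}. (norm (resolvent c (X i \<omega>)))\<^sup>2) \<in> borel_measurable M"
    using X_measurable by (intro borel_measurable_sum measurable_compose[OF _ resolvent_borel] borel_measurable_power borel_measurable_norm) auto
  show "field_event n c e1 \<in> M.events" unfolding field_event_def using m1 by measurable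
  show "energy_event n c e2 \<in> M.events" unfolding energy_event_def using m2 by measurable
  show "crowd_event n c h m \<in> M.events" unfolding crowd_event_def by (intro card_event_sets) auto
  have "M.prob (field_event n c e1) \<le> 8 * real (card {1..n}) * V / e1\<^sup>2"
    unfolding field_event_def
  proof (rule M.Chebyshev_indep_sum_complex[OF _ indR])
    show "M.expectation (\<lambda>\<omega>. resolvent c (X i \<omega>)) = 1 / c" if "i \<in> {1..n}" for i
      using that mean by (subst expectation_X) auto
    show "M.expectation (\<lambda>\<omega>. (norm (resolvent c (X i \<omega>)))\<^sup>2) \<le> V" if "i \<in> {1..n}" for i
      using that second by (subst expectation_X[where f = "\<lambda>z. (norm (resolvent c z))\<^sup>2"]) auto
  qed (use bound e in auto)
  then show "M.prob (field_event n c e1) \<le> 8 * real n * V / e1\<^sup>2" by simp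
  let ?m = "\<integral>z. (norm (resolvent c z))\<^sup>2 \<partial>\<mu>"
  have "M.prob (energy_event n c e2)
      \<le> M.prob {\<omega> \<in> space M. e2 / 2 \<le> \<bar>(\<Sum>i\<in>{1..n}. (norm (resolvent c (X i \<omega>)))\<^sup>2) - real (card {1..n}) * ?m\<bar>}"
  proof (rule M.finite_measure_mono)
    have "real n * ?m \<le> n * V" using second by (intro mult_left_mono) auto
    then have "e2 / 2 \<le> \<bar>S - real (card {1..n}) * ?m\<bar>" if "e2 \<le> S" for S using that e by simp
    then show "energy_event n c e2 \<subseteq> {\<omega> \<in> space M. e2 / 2
      \<le> \<bar>(\<Sum>i\<in>{1..n}. (norm (resolvent c (X i \<omega>)))\<^sup>2) - real (card {1..n}) * ?m\<bar>}"
      unfolding energy_event_def by blast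
    show "{\<omega> \<in> space M. e2 / 2 \<le> \<bar>(\<Sum>i\<in>{1..n}. (norm (resolvent c (X i \<omega>)))\<^sup>2) - real (card {1..n}) * ?m\<bar>} \<in> M.events"
      using m2 by measurable
  qed
  also have "\<dots> \<le> real (card {1..n}) * (V / h\<^sup>2) / (e2 / 2)\<^sup>2"
  proof (rule M.Chebyshev_indep_sum[OF _ indE])
    show "M.expectation (\<lambda>\<omega>. (norm (resolvent c (X i \<omega>)))\<^sup>2) = ?m" if "i \<in> {1..n}" for i
      using that by (subst expectation_X[where f = "\<lambda>z. (norm (resolvent c z))\<^sup>2"]) auto
    show "M.expectation (\<lambda>\<omega>. ((norm (resolvent c (X i \<omega>)))\<^sup>2)\<^sup>2) \<le> V / h\<^sup>2" if "i \<in> {1..n}" for i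
    proof -
      have "(\<integral>z. ((norm (resolvent c z))\<^sup>2)\<^sup>2 \<partial>\<mu>) \<le> (\<integral>z. (norm (resolvent c z))\<^sup>2 * (1 / h\<^sup>2) \<partial>\<mu>)"
      proof (rule integral_mono)
        have b4: "((norm (resolvent c z))\<^sup>2)\<^sup>2 \<le> (norm (resolvent c z))\<^sup>2 * (1 / h\<^sup>2)" for z
          unfolding power2_eq_square[of "(norm (resolvent c z))\<^sup>2"] by (intro mult_left_mono bound2) auto
        then show "((norm (resolvent c z))\<^sup>2)\<^sup>2 \<le> (norm (resolvent c z))\<^sup>2 * (1 / h\<^sup>2)" for z .
        show i4: "integrable \<mu> (\<lambda>z. (norm (resolvent c z))\<^sup>2 * (1 / h\<^sup>2))"
          using int2 by (rule integrable_mult_left)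
        show "integrable \<mu> (\<lambda>z. ((norm (resolvent c z))\<^sup>2)\<^sup>2)"
          using b4 by (intro Bochner_Integration.integrable_bound[OF i4]) auto
      qed
      also have "\<dots> = ?m * (1 / h\<^sup>2)" by (rule integral_mult_left_zero)
      also have "\<dots> \<le> V * (1 / h\<^sup>2)" using second by (intro mult_right_mono) auto
      finally show ?thesis
        using that by (subst expectation_X[where f = "\<lambda>z. ((norm (resolvent c z))\<^sup>2)\<^sup>2"]) auto
    qed
    show "\<bar>(norm (resolvent c (X i \<omega>)))\<^sup>2\<bar> \<le> 1 / h\<^sup>2" for i \<omega> using bound2 by simp
  qed (use e in auto)
  also have "\<dots> = 4 * real n * V / (h\<^sup>2 * e2\<^sup>2)" by (simp add: power_divide)
  finally show "M.prob (energy_event n c e2) \<le> 4 * real n * V / (h\<^sup>2 * e2\<^sup>2)" .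
  have "M.prob (crowd_event n c h m) \<le> exp (2 * real (card {1..n}) * (10 * K * (5 * h) powr (1 + \<beta>)) - m)"
    unfolding crowd_event_def
  proof (rule M.binomial_upper_tail[OF _ indep_upto])
    have "c \<noteq> 0" using c1 by auto
    then have "dist (sgn c) c = h" using c h by (simp add: dist_sgn)
    then have sub: "cball c (4 * h) \<subseteq> cball (sgn c) (5 * h)"
      using dist_triangle_le[of "sgn c" c _ "5 * h"] by (force simp: dist_commute)
    have "prob (cball c (4 * h)) \<le> prob (cball (sgn c) (5 * h))"
      using sub by (intro finite_measure_mono) (auto simp: sets_mu)
    also have "\<dots> \<le> 10 * K * (5 * h) powr (1 + \<beta>)"
      using c1 h by (intro cball_bound_unit) (auto simp: norm_sgn)
    finally show "M.prob {\<omega> \<in> space M. X i \<omega> \<in> cball c (4 * h)} \<le> 10 * K * (5 * h) powr (1 + \<beta>)"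
      if "i \<in> {1..n}" for i using that prob_X[of i "cball c (4 * h)"] by simp
  qed auto
  then show "M.prob (crowd_event n c h m) \<le> exp (2 * real n * (10 * K * (5 * h) powr (1 + \<beta>)) - m)" by simp
qed

definition "net h = (\<lambda>k. complex_of_real (1 + h) * cis (2 * pi * real k / real (nat \<lceil>13 / h\<rceil>))) ` {..<nat \<lceil>13 / h\<rceil>}"

text \<open>Since \<open>4 * pi < 13\<close>, the arguments of neighbouring mesh points differ by less than \<open>h / 2\<close>.\<close>
lemma net:
  assumes h: "0 < h" "h \<le> 1"
  shows "finite (net h)" "real (card (net h)) \<le> 14 / h" "\<And>c. c \<in> net h \<Longrightarrow> norm c = 1 + h"
    "\<And>u. norm u = 1 \<Longrightarrow> \<exists>c\<in>net h. norm c = 1 + h \<and> dist c u \<le> 3 / 2 * h"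
proof -
  define N where "N = nat \<lceil>13 / h\<rceil>"
  note net_def = net_def[of h, folded N_def]
  show "finite (net h)" by (simp add: net_def)
  have N: "13 / h \<le> real N" "real N \<le> 13 / h + 1" "0 < 13 / h"
    using h by (auto simp: N_def real_nat_ceiling_ge of_nat_nat)
  have "card (net h) \<le> N" unfolding net_def using card_image_le[of "{..<N}"] by simp
  then have "real (card (net h)) \<le> 13 / h + 1" using N by linarith
  also have "\<dots> \<le> 14 / h" using h by (simp add: field_simps)
  finally show "real (card (net h)) \<le> 14 / h" .
  show nc: "norm c = 1 + h" if "c \<in> net h" for c
    using that h by (auto simp: net_def norm_mult simp del: of_real_add)
  fix u :: complex assume u: "norm u = 1"
  define a where "a = (if Arg u < 0 then Arg u + 2 * pi else Arg u)"
  have a: "0 \<le> a" "a < 2 * pi" using Arg_bounded[of u] by (auto simp: a_def)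
  have ua: "u = cis a"
  proof -
    have "u \<noteq> 0" using u by auto
    then have "u = cis (Arg u)" using u cis_Arg[of u] by (simp add: sgn_div_norm)
    also have "\<dots> = cis a" by (auto simp: a_def cis_mult[symmetric])
    finally show ?thesis .
  qed
  define k where "k = nat \<lfloor>a * N / (2 * pi)\<rfloor>"
  have Npos: "0 < real N" using N by linarith
  have k: "real k \<le> a * N / (2 * pi)" "a * N / (2 * pi) < real k + 1"
  proof -
    have "0 \<le> a * N / (2 * pi)" using a by simp
    then have "0 \<le> \<lfloor>a * N / (2 * pi)\<rfloor>" by simp
    then have "real k = of_int \<lfloor>a * N / (2 * pi)\<rfloor>" unfolding k_def by (rule of_nat_nat)
    then show "real k \<le> a * N / (2 * pi)" "a * N / (2 * pi) < real k + 1" by linarith+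
  qed
  have "a * N / (2 * pi) < N" using a Npos by (simp add: field_simps)
  then have kN: "k < N" using k by linarith
  let ?b = "2 * pi * real k / N"
  have ba: "?b \<le> a" "a < ?b + 2 * pi / N"
  proof -
    show "?b \<le> a" using k(1) Npos by (simp add: field_simps)
    have "a * N < 2 * pi * (real k + 1)" using k(2) by (simp add: field_simps)
    then have "a < 2 * pi * (real k + 1) / N" using Npos by (simp add: field_simps)
    then show "a < ?b + 2 * pi / N" by (simp add: distrib_left add_divide_distrib)
  qed
  let ?c = "complex_of_real (1 + h) * cis ?b"
  have "?c \<in> net h" using kN by (auto simp: net_def)
  moreover have "dist ?c u \<le> 3 / 2 * h"
  proof -
    have "norm (cis ?b - cis a) \<le> \<bar>?b - a\<bar>"
    proof -
      have "norm (cis ?b - cis a) = norm (cis a) * norm (cis (?b - a) - 1)"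
        unfolding norm_mult[symmetric] by (simp add: right_diff_distrib cis_mult)
      also have "\<dots> = 2 * \<bar>sin ((?b - a) / 2)\<bar>"
        using dist_exp_i_1[of "?b - a"] by (simp add: cis_conv_exp)
      also have "\<dots> \<le> 2 * \<bar>(?b - a) / 2\<bar>" by (intro mult_left_mono abs_sin_x_le_abs_x) auto
      finally show ?thesis by simp
    qed
    also have "\<dots> \<le> 2 * pi / N" using ba by simp
    also have "\<dots> \<le> 2 * pi / (13 / h)" using N Npos by (intro divide_left_mono) auto
    also have "\<dots> \<le> h / 2" using pi_less_4 h by (simp add: field_simps) (use pi_approx in \<open>auto\<close>)
    finally have "norm (cis ?b - cis a) \<le> h / 2" .
    moreover have "?c - u = complex_of_real h * cis ?b + (cis ?b - cis a)" by (simp add: ua algebra_simps)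
    then have "dist ?c u \<le> norm (complex_of_real h * cis ?b) + norm (cis ?b - cis a)"
      by (simp only: dist_norm norm_triangle_ineq)
    ultimately show ?thesis using h by (simp add: norm_mult)
  qed
  ultimately show "\<exists>c\<in>net h. norm c = 1 + h \<and> dist c u \<le> 3 / 2 * h" using nc by blast
qed

end

section \<open>Asymptotics of the scales\<close>

text \<open>The exponents come from the worst case \<open>\<alpha> = -0.095\<close>, with \<open>\<beta> = 1 + \<alpha> = 0.905\<close>. A close pair of
  roots at distance \<open>s\<close> near the edge has expected number \<open>n\<^sup>2 s\<^bsup>1 + 2 \<beta>\<^esup>\<close>, which forces the exponent
  of \<open>sep_crowd\<close> below \<open>-2/2.81\<close>. The union bound over \<open>1/h\<close> mesh points with variance
  \<open>var_cap\<close> needs \<open>-1 + 0.25 + 0.465 + 0.25 < 0\<close>. The field error \<open>n\<^bsup>0.88\<^esup>\<close> must be below \<open>n\<^bsup>2 - 1/\<beta>\<^esup>\<close>, and the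
  gap \<open>g\<close> between the largest moduli must satisfy \<open>n\<^bsup>1 - \<alpha>/\<beta>\<^esup> g \<rightarrow> 0\<close>.\<close>
abbreviation "sep_crowd n \<equiv> real n powr (-0.73)"
abbreviation "sep_edge n \<equiv> real n powr (-0.65)"
abbreviation "mesh n \<equiv> real n powr (-0.465)"
abbreviation "crowd_cap n \<equiv> real n powr 0.12"
abbreviation "field_dev n \<equiv> real n powr 0.875"
abbreviation "energy_cap n \<equiv> real n powr 1.34"
abbreviation "field_err n \<equiv> real n powr 0.88"
abbreviation "energy_bd n \<equiv> real n powr 1.45"
abbreviation "gap_min n \<equiv> real n powr (-1.115)"
abbreviation "var_cap n \<equiv> real n powr 0.25"
abbreviation "crit_err n \<equiv> (4 * field_err n + 3) / (real n)\<^sup>2"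
abbreviation "crit_err1 n \<equiv> 12 * energy_bd n / real n ^ 3 + 2 / (real n)\<^sup>2"

text \<open>Most estimates below reduce to explicit functions of n: l is replaced by sqrt (ln n) and
  1 + \<alpha> by its smallest value 0.905, since powers of numbers at most 1 decrease in the
  exponent.\<close>

locale slow_growth =
  fixes l :: "nat \<Rightarrow> nat" and \<alpha> \<delta> K k \<epsilon> :: real
  assumes alpha: "- 0.095 < \<alpha>" "\<alpha> < 0" and delta: "\<delta> < - \<alpha>"
    and const_pos: "0 < K" "0 < k" "0 < \<epsilon>"
    and l_omega: "filterlim l at_top sequentially"
    and l_less: "\<forall>\<^sub>F n in sequentially. real (l n) < sqrt (ln (real n))"
begin

abbreviation "edge n \<equiv> (real (l n) ^ 2 / real n) powr (1 / (\<alpha> + 1))"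
abbreviation "collar n \<equiv> (1 / (real n * real (l n))) powr (1 / (\<alpha> + 1))"

lemma ev_l: "\<forall>\<^sub>F n in sequentially. c \<le> real (l n)"
proof -
  have "\<forall>\<^sub>F n in sequentially. nat \<lceil>c\<rceil> \<le> l n"
    using l_omega unfolding filterlim_at_top by blast
  then show ?thesis by eventually_elim linarith
qed

lemma l_bounds: "\<forall>\<^sub>F n in sequentially. 1 \<le> n \<and> 3 \<le> real (l n) \<and> real (l n) < sqrt (ln (real n)) \<and> 1 \<le> ln (real n)"
proof -
  have "\<forall>\<^sub>F n in sequentially. 1 \<le> ln (real n)" by real_asymp
  then show ?thesis using ev_l[of 3] l_less eventually_ge_at_top[of 1] by eventually_elim auto
qed

lemma ev_scales:
  "\<forall>\<^sub>F n in sequentially. sep_crowd n \<le> sep_edge n \<and> mesh n \<le> 1 / 10 \<and> sep_crowd n \<le> mesh n \<and>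
     real (l n) / n \<le> sep_crowd n / 3 \<and> 2 * real (l n) / n + 3 / n \<le> mesh n / 2 \<and> 6 / n \<le> sep_edge n \<and>
     2 * real (l n) \<le> n \<and> 2 * real (l n) / n \<le> sep_edge n \<and> sep_edge n < 1 \<and> sep_crowd n < 1"
proof -
  have "\<forall>\<^sub>F n in sequentially. sep_crowd n \<le> sep_edge n" by real_asymp
  moreover have "\<forall>\<^sub>F n in sequentially. mesh n \<le> 1 / 10" by real_asymp
  moreover have "\<forall>\<^sub>F n in sequentially. sep_crowd n \<le> mesh n" by real_asymp
  moreover have "\<forall>\<^sub>F n in sequentially. sqrt (ln (real n)) / n \<le> sep_crowd n / 3" by real_asymp
  moreover have "\<forall>\<^sub>F n in sequentially. 2 * sqrt (ln (real n)) / n + 3 / n \<le> mesh n / 2" by real_asymp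
  moreover have "\<forall>\<^sub>F n in sequentially. 6 / n \<le> sep_edge n" by real_asymp
  moreover have "\<forall>\<^sub>F n in sequentially. 2 * sqrt (ln (real n)) \<le> n" by real_asymp
  moreover have "\<forall>\<^sub>F n in sequentially. 2 * sqrt (ln (real n)) / n \<le> sep_edge n" by real_asymp
  moreover have "\<forall>\<^sub>F n in sequentially. sep_edge n < 1" by real_asymp
  moreover have "\<forall>\<^sub>F n in sequentially. sep_crowd n < 1" by real_asymp
  ultimately show ?thesis using l_bounds
  proof eventually_elim
    case (elim n)
    then have a: "real (l n) / n \<le> sqrt (ln (real n)) / n" "2 * real (l n) / n \<le> 2 * sqrt (ln (real n)) / n"
      by (auto intro!: divide_right_mono)
    show ?case using elim a by (intro conjI) linarith+
  qed
qed

text \<open>The two largest terms, the deviation at the mesh and the passage 4 h e2 to nearby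
  points, are both of order n^0.875, as 1.34 - 0.465 = 0.875.\<close>

lemma ev_field:
  "\<forall>\<^sub>F n in sequentially. field_dev n + 4 * mesh n * energy_cap n + crowd_cap n * (3 / sep_crowd n + 1 / mesh n)
      + 1 / mesh n + 4 * mesh n * n \<le> field_err n \<and> 16 * field_err n \<le> n"
  by (intro eventually_conj; real_asymp)

lemma ev_energy:
  "\<forall>\<^sub>F n in sequentially. 4 * crowd_cap n / (sep_edge n)\<^sup>2 + 4 * energy_cap n \<le> energy_bd n
     \<and> 8 * energy_bd n < (real n)\<^sup>2"
  by (intro eventually_conj; real_asymp)

text \<open>The pairing error is about 4 n^(-1.12); the gap n^(-1.115) is chosen just above
  it.\<close>

lemma ev_err:
  "\<forall>\<^sub>F n in sequentially. crit_err n \<le> 1 / (2 * n) \<and> 5 * crit_err n \<le> gap_min n"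
  by (intro eventually_conj; real_asymp)

text \<open>For \<alpha> < 0 the exponent of the rate is at most 3/2 in size, while 12 n^1.45 / n^3
  = 12 n^(-1.55).\<close>

lemma ev_rate1:
  "\<forall>\<^sub>F n in sequentially. crit_err1 n < real (l n) * real n powr (- ((5 * \<alpha> + 3) / (2 * (\<alpha> + 1))))"
proof -
  have "\<forall>\<^sub>F n in sequentially. crit_err1 n < real n powr (-3/2)" by real_asymp
  then show ?thesis using l_bounds
  proof eventually_elim
    case (elim n)
    have "(5 * \<alpha> + 3) / (2 * (\<alpha> + 1)) \<le> 3 / 2" using alpha by (simp add: field_simps)
    then have "real n powr (-3/2) \<le> real n powr (- ((5 * \<alpha> + 3) / (2 * (\<alpha> + 1))))"
      using elim by (intro powr_mono) auto
    also have "\<dots> \<le> real (l n) * real n powr (- ((5 * \<alpha> + 3) / (2 * (\<alpha> + 1))))"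
      using elim mult_right_mono[of 1 "real (l n)" "real n powr (- ((5 * \<alpha> + 3) / (2 * (\<alpha> + 1))))"] by simp
    finally show ?case using elim by linarith
  qed
qed

text \<open>1.105 exceeds 1/0.905 and hence 1/(1 + \<alpha>); the distance from 1.105 to the error
  exponent 1.12 absorbs the logarithms coming from l^4.\<close>

lemma ev_rate2:
  "\<forall>\<^sub>F n in sequentially. crit_err n < (1 / (real (l n) ^ 4 * real n)) powr (1 / (\<alpha> + 1))"
proof -
  have "\<forall>\<^sub>F n in sequentially. crit_err n < (1 / (sqrt (ln (real n)) ^ 4 * real n)) powr 1.105" by real_asymp
  then show ?thesis using l_bounds
  proof eventually_elim
    case (elim n)
    have l4: "1 \<le> real (l n) ^ 4" using elim by (intro one_le_power) auto
    have "real (l n) ^ 4 * real n \<le> sqrt (ln (real n)) ^ 4 * real n"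
      using elim by (intro mult_right_mono power_mono) auto
    moreover have p: "1 \<le> real (l n) ^ 4 * real n"
      using elim l4 mult_mono[of 1 "real (l n) ^ 4" 1 "real n"] by simp
    ultimately have "1 / (sqrt (ln (real n)) ^ 4 * real n) \<le> 1 / (real (l n) ^ 4 * real n)"
      by (intro divide_left_mono) (auto intro!: mult_pos_pos simp del: of_nat_power)
    then have "(1 / (sqrt (ln (real n)) ^ 4 * real n)) powr 1.105 \<le> (1 / (real (l n) ^ 4 * real n)) powr 1.105"
      using elim by (intro powr_mono2) auto
    also have "\<dots> \<le> (1 / (real (l n) ^ 4 * real n)) powr (1 / (\<alpha> + 1))"
      using p alpha by (intro powr_mono') (auto simp: divide_le_eq field_simps)
    finally show ?case using elim by linarith
  qed
qed

text \<open>Since \<alpha> < 0, (ln n)/n is eventually below (1/n)^(1+\<alpha>). So the top roots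
  lie closer to the circle than 1/n, and their partners remain in the annulus.\<close>

lemma ev_edge:
  "\<forall>\<^sub>F n in sequentially. edge n \<le> 1 / n \<and> edge n + gap_min n \<le> \<epsilon> \<and> 1 / n \<le> \<epsilon>"
proof -
  have "\<forall>\<^sub>F n in sequentially. ln (real n) / real n \<le> (1 / real n) powr (\<alpha> + 1)"
    using alpha by real_asymp
  moreover have "\<forall>\<^sub>F n in sequentially. 1 / real n + gap_min n \<le> \<epsilon>" using const_pos by real_asymp
  ultimately show ?thesis using l_bounds
  proof eventually_elim
    case (elim n)
    have "(real (l n))\<^sup>2 \<le> (sqrt (ln (real n)))\<^sup>2" using elim by (intro power_mono) auto
    then have "(real (l n))\<^sup>2 / n \<le> ln (real n) / n" using elim by (intro divide_right_mono) auto
    then have "edge n \<le> ((1 / real n) powr (\<alpha> + 1)) powr (1 / (\<alpha> + 1))"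
      using elim alpha by (intro powr_mono2) auto
    also have "\<dots> = 1 / n" using alpha elim by (simp add: powr_powr)
    finally have "edge n \<le> 1 / n" .
    moreover have "0 \<le> gap_min n" by simp
    ultimately show ?case using elim by linarith
  qed
qed

lemma edge_powr: "1 \<le> n \<Longrightarrow> edge n powr (1 + \<alpha>) = real (l n) ^ 2 / n"
  using alpha by (simp add: powr_powr add.commute)

lemma collar_powr: "1 \<le> n \<Longrightarrow> collar n powr (1 + \<alpha>) = 1 / (real n * real (l n))"
  using alpha by (simp add: powr_powr add.commute)

text \<open>Thresholds against expected counts: at depth 1/n the mean is at least k n^(-\<alpha>), a
  larger power than n^\<delta>, and at the edge depth at least k l^2, which reaches 2 l once l \<ge>
  2/k.\<close>

lemma ev_counts:
  "\<forall>\<^sub>F n in sequentially. 2 * real n powr \<delta> \<le> n * (k * (1 / n) powr (1 + \<alpha>)) \<and>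
     2 * real (l n) \<le> n * (k * edge n powr (1 + \<alpha>))"
proof -
  have "\<forall>\<^sub>F n in sequentially. 2 * real n powr \<delta> \<le> n * (k * (1 / n) powr (1 + \<alpha>))"
  proof -
    have "\<forall>\<^sub>F n in sequentially. 2 * real n powr (\<delta> + \<alpha>) \<le> k"
      using delta const_pos by real_asymp
    then show ?thesis using l_bounds
    proof eventually_elim
      case (elim n)
      have "2 * real n powr \<delta> = 2 * real n powr (\<delta> + \<alpha>) * real n powr (- \<alpha>)"
        using elim by (simp add: powr_add[symmetric])
      also have "\<dots> \<le> k * real n powr (- \<alpha>)" using elim by (intro mult_right_mono) auto
      also have "\<dots> = n * (k * (1 / n) powr (1 + \<alpha>))"
        using elim by (simp add: powr_divide powr_add powr_minus field_simps)
      finally show ?case .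
    qed
  qed
  then show ?thesis using l_bounds ev_l[of "2 / k"]
  proof eventually_elim
    case (elim n)
    have "2 * real (l n) \<le> k * real (l n) * real (l n)"
      using elim const_pos by (intro mult_right_mono) (auto simp: field_simps)
    also have "\<dots> = n * (k * edge n powr (1 + \<alpha>))"
      using elim by (subst edge_powr) (auto simp: power2_eq_square)
    finally show ?case using elim by simp
  qed
qed

text \<open>The depth u = n^(-0.244) balances the two terms: 1/u = u^\<beta>/h for u =
  h^(1/(1+\<beta>)), and 0.465/1.905 is about 0.244.\<close>

lemma ev_variance:
  "\<forall>\<^sub>F n in sequentially. 1 / real n powr (-0.244) + K * (real n powr (-0.244)) powr (1 + \<alpha>) / mesh n \<le> var_cap n
     \<and> 2 * real n * var_cap n \<le> energy_cap n"
proof -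
  have "\<forall>\<^sub>F n in sequentially. 1 / real n powr (-0.244) + K * (real n powr (-0.244)) powr 0.905 / mesh n \<le> var_cap n"
    using const_pos by real_asymp
  moreover have "\<forall>\<^sub>F n in sequentially. 2 * real n * var_cap n \<le> energy_cap n" by real_asymp
  ultimately show ?thesis using l_bounds
  proof eventually_elim
    case (elim n)
    have "real n powr (-0.244) \<le> 1" using elim powr_mono[of "-0.244" 0 "real n"] by simp
    then have "(real n powr (-0.244)) powr (1 + \<alpha>) \<le> (real n powr (-0.244)) powr 0.905"
      using alpha by (intro powr_mono') auto
    then have "K * (real n powr (-0.244)) powr (1 + \<alpha>) / mesh n \<le> K * (real n powr (-0.244)) powr 0.905 / mesh n"
      using const_pos by (intro divide_right_mono mult_left_mono) auto
    then show ?case using elim by linarith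
  qed
qed

section \<open>Failure probabilities of the exceptional events\<close>

lemma inverse_l: "real (l n) < sqrt (ln (real n)) \<Longrightarrow> 3 \<le> real (l n) \<Longrightarrow> 1 / sqrt (ln (real n)) \<le> 1 / real (l n)"
  by (intro frac_le) auto

text \<open>At \<alpha> = -0.095 the exponents are 2 - 0.905 - 0.65 * 1.905, about -0.14, in the
  thin band of width 2 l / n, and 2 - 0.73 * 2.81, about -0.05, in the band of width
  \<open>sep_crowd\<close>. The thinner band is what permits the larger separation.\<close>

lemma ev_prob_close:
  "\<forall>\<^sub>F n in sequentially.
    (real n)\<^sup>2 * (K * (2 * real (l n) / n) powr (1 + \<alpha>) * (40 * K * sep_edge n powr (1 + (1 + \<alpha>)))) \<le> 1 / real (l n) \<and>
    (real n)\<^sup>2 * (K * sep_crowd n powr (1 + \<alpha>) * (40 * K * sep_crowd n powr (1 + (1 + \<alpha>)))) \<le> 1 / real (l n)"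
proof -
  have "\<forall>\<^sub>F n in sequentially. (real n)\<^sup>2 * (K * (2 * sqrt (ln (real n)) / n) powr 0.905 * (40 * K
    * sep_edge n powr 1.905)) \<le> 1 / sqrt (ln (real n))"
    using const_pos by real_asymp
  moreover have "\<forall>\<^sub>F n in sequentially. (real n)\<^sup>2 * (K * sep_crowd n powr 0.905 * (40 * K
    * sep_crowd n powr 1.905)) \<le> 1 / sqrt (ln (real n))"
    using const_pos by real_asymp
  ultimately show ?thesis using l_bounds ev_scales
  proof eventually_elim
    case (elim n)
    have le1: "sep_edge n \<le> 1" "sep_crowd n \<le> 1" "2 * real (l n) / n \<le> 1" using elim by auto
    have mono: "x powr (1 + \<alpha>) \<le> x powr 0.905" "x powr (1 + (1 + \<alpha>)) \<le> x powr 1.905" if "0 \<le> x" "x \<le> 1" for x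
      using that alpha by (auto intro!: powr_mono')
    have "(2 * real (l n) / n) powr (1 + \<alpha>) \<le> (2 * real (l n) / n) powr 0.905"
      using le1 by (intro mono) auto
    also have "\<dots> \<le> (2 * sqrt (ln (real n)) / n) powr 0.905"
      using elim by (intro powr_mono2 divide_right_mono) auto
    finally have a: "(2 * real (l n) / n) powr (1 + \<alpha>) \<le> (2 * sqrt (ln (real n)) / n) powr 0.905" .
    have "(real n)\<^sup>2 * (K * (2 * real (l n) / n) powr (1 + \<alpha>) * (40 * K * sep_edge n powr (1 + (1 + \<alpha>))))
       \<le> (real n)\<^sup>2 * (K * (2 * sqrt (ln (real n)) / n) powr 0.905 * (40 * K * sep_edge n powr 1.905))"
      using a mono le1 const_pos by (intro mult_left_mono mult_mono) auto
    moreover have "(real n)\<^sup>2 * (K * sep_crowd n powr (1 + \<alpha>) * (40 * K * sep_crowd n powr (1 + (1 + \<alpha>))))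
       \<le> (real n)\<^sup>2 * (K * sep_crowd n powr 0.905 * (40 * K * sep_crowd n powr 1.905))"
      using mono le1 const_pos by (intro mult_left_mono mult_mono) auto
    ultimately show ?case using elim inverse_l[of n] by linarith
  qed
qed

text \<open>Each of the two Chebyshev bounds is of order n^(-0.5), against about n^0.465 mesh
  points. For the crowding the expected count is of order n^(1 - 0.465 * 1.905), about n^0.114, so
  the cap n^0.12 dominates and the bound is below exp(-n^0.11).\<close>

lemma ev_prob_net:
  "\<forall>\<^sub>F n in sequentially.
    14 / mesh n * (8 * real n * var_cap n / (field_dev n)\<^sup>2 + 4 * real n * var_cap n / ((mesh n)\<^sup>2 * (energy_cap n)\<^sup>2)
      + exp (2 * real n * (10 * K * (5 * mesh n) powr (1 + (1 + \<alpha>))) - crowd_cap n)) \<le> 1 / real (l n)"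
proof -
  have "\<forall>\<^sub>F n in sequentially.
    14 / mesh n * (8 * real n * var_cap n / (field_dev n)\<^sup>2 + 4 * real n * var_cap n / ((mesh n)\<^sup>2
      * (energy_cap n)\<^sup>2)) \<le> (1 / 2) * (1 / sqrt (ln (real n)))"
    by real_asymp
  moreover have "\<forall>\<^sub>F n in sequentially. 2 * real n * (10 * K * (5 * mesh n) powr 1.905) - crowd_cap n
    \<le> - (real n powr 0.11)"
    using const_pos by real_asymp
  moreover have "\<forall>\<^sub>F n in sequentially. 14 / mesh n * exp (- (real n powr 0.11)) \<le> (1 / 2) * (1 / sqrt (ln (real n)))"
    by real_asymp
  ultimately show ?thesis using l_bounds ev_scales
  proof eventually_elim
    case (elim n)
    have "(5 * mesh n) powr (1 + (1 + \<alpha>)) \<le> (5 * mesh n) powr 1.905"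
      using elim alpha by (intro powr_mono') auto
    then have "2 * real n * (10 * K * (5 * mesh n) powr (1 + (1 + \<alpha>))) \<le> 2 * real n * (10 * K * (5
      * mesh n) powr 1.905)"
      using const_pos by (intro mult_left_mono) auto
    then have "exp (2 * real n * (10 * K * (5 * mesh n) powr (1 + (1 + \<alpha>))) - crowd_cap n) \<le> exp (- (real n powr 0.11))"
      using elim by (subst exp_le_cancel_iff) linarith
    then have "14 / mesh n * exp (2 * real n * (10 * K * (5 * mesh n) powr (1 + (1 + \<alpha>))) - crowd_cap n)
      \<le> 14 / mesh n * exp (- (real n powr 0.11))"
      by (intro mult_left_mono) auto
    then show ?case using elim inverse_l[of n] unfolding distrib_left by linarith
  qed
qed

lemma ev_prob_few:
  "\<forall>\<^sub>F n in sequentially. 4 / (n * (k * (1 / n) powr (1 + \<alpha>))) \<le> 1 / real (l n) \<and>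
     4 / (n * (k * edge n powr (1 + \<alpha>))) \<le> 4 / k * (1 / real (l n))"
proof -
  have "\<forall>\<^sub>F n in sequentially. 4 / k * real n powr \<alpha> \<le> 1 / sqrt (ln (real n))"
    using alpha const_pos by real_asymp
  then show ?thesis using l_bounds
  proof eventually_elim
    case (elim n)
    have "4 / (n * (k * (1 / n) powr (1 + \<alpha>))) = 4 / k * real n powr \<alpha>"
      using elim const_pos by (simp add: powr_divide powr_add)
    moreover have "4 / (n * (k * edge n powr (1 + \<alpha>))) \<le> 4 / k * (1 / real (l n))"
    proof -
      have "4 / (n * (k * edge n powr (1 + \<alpha>))) = 4 / (k * (real (l n) * real (l n)))"
        using elim by (subst edge_powr) (auto simp: power2_eq_square)
      also have "\<dots> \<le> 4 / (k * (real (l n) * 1))"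
        using elim const_pos by (intro divide_left_mono mult_left_mono mult_pos_pos) auto
      finally show ?thesis by simp
    qed
    ultimately show ?case using elim inverse_l[of n] by linarith
  qed
qed

text \<open>-\<alpha>/(1 + \<alpha>) stays below 0.095/0.905 < 0.105, which bounds the density at
  the collar. The total exponent is 2 - 1 - 1.115 + 0.105 = -0.01, small but enough against the
  logarithms.\<close>

lemma ev_prob_gap:
  "\<forall>\<^sub>F n in sequentially. (real n)\<^sup>2 * (K * edge n powr (1 + \<alpha>) * (K * (2 * gap_min n) * collar n powr \<alpha>))
    \<le> 1 / real (l n)"
proof -
  have "\<forall>\<^sub>F n in sequentially. (real n)\<^sup>2 * (K * (ln (real n) / n) * (K * (2 * gap_min n) * (real n
    * sqrt (ln (real n))) powr 0.105)) \<le> 1 / sqrt (ln (real n))"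
    using const_pos by real_asymp
  then show ?thesis using l_bounds
  proof eventually_elim
    case (elim n)
    have "(real (l n))\<^sup>2 \<le> (sqrt (ln (real n)))\<^sup>2" using elim by (intro power_mono) auto
    then have "(real (l n))\<^sup>2 / n \<le> ln (real n) / n" using elim by (intro divide_right_mono) auto
    then have a: "edge n powr (1 + \<alpha>) \<le> ln (real n) / n" using elim by (subst edge_powr) auto
    let ?y = "real n * real (l n)"
    have y: "1 \<le> ?y" using elim mult_mono[of 1 "real n" 1 "real (l n)"] by simp
    have "collar n powr \<alpha> = ?y powr (- (\<alpha> / (\<alpha> + 1)))"
    proof -
      have "1 / ?y = ?y powr (-1)" using y by (simp add: powr_minus divide_inverse)
      then show ?thesis by (simp only: powr_powr) simp
    qed
    also have "\<dots> \<le> ?y powr 0.105" using y alpha by (intro powr_mono) (auto simp: field_simps)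
    also have "\<dots> \<le> (real n * sqrt (ln (real n))) powr 0.105"
      using elim by (intro powr_mono2 mult_left_mono) auto
    finally have b: "collar n powr \<alpha> \<le> (real n * sqrt (ln (real n))) powr 0.105" .
    have "(real n)\<^sup>2 * (K * edge n powr (1 + \<alpha>) * (K * (2 * gap_min n) * collar n powr \<alpha>))
      \<le> (real n)\<^sup>2 * (K * (ln (real n) / n) * (K * (2 * gap_min n) * (real n * sqrt (ln (real n))) powr 0.105))"
      using a b const_pos elim by (intro mult_left_mono mult_mono) auto
    then show ?case using elim inverse_l[of n] by linarith
  qed
qed

lemma crit_err_smallo: "(\<lambda>n. 2 * crit_err n) \<in> o(\<lambda>n. 1 / real n)"
  by real_asymp

end

section \<open>The main theorem\<close>

locale edge_model = radial_sample \<mu> K "1 + \<alpha>" M X + slow_growth l \<alpha> \<delta> K k \<epsilon>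
  for \<mu> :: "complex measure" and K \<alpha> :: real and M :: "'a measure" and X :: "nat \<Rightarrow> 'a \<Rightarrow> complex"
    and l :: "nat \<Rightarrow> nat" and \<delta> k \<epsilon> :: real +
  assumes ring: "\<And>r1 r2. 1 - \<epsilon> \<le> r1 \<Longrightarrow> r1 \<le> r2 \<Longrightarrow> r2 < 1 \<Longrightarrow>
      prob {z. r1 \<le> norm z \<and> norm z \<le> r2} \<le> K * (r2 - r1) * (1 - r2) powr \<alpha>"
    and tail_lower: "\<And>t. 0 < t \<Longrightarrow> t \<le> \<epsilon> \<Longrightarrow> k * t powr (1 + \<alpha>) \<le> prob {z. 1 - t \<le> norm z}"
begin

definition "net_event n c = field_event n c (field_dev n) \<union> energy_event n c (energy_cap n) \<union> crowd_event n c (mesh n) (crowd_cap n)"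

text \<open>\<open>collar n\<close> and \<open>edge n\<close> are the bounds in part (iv) on the distances of the largest roots from the
  unit circle.\<close>
definition "bad n = edge_event n 0 \<union> close_event n (2 * real (l n) / n) (sep_edge n)
  \<union> close_event n (sep_crowd n) (sep_crowd n) \<union> (\<Union>c\<in>net (mesh n). net_event n c)
  \<union> few_event n (1 / n) (n powr \<delta>) \<union> few_event n (edge n) (l n)
  \<union> edge_event n (collar n) \<union> gap_event n (edge n) (collar n) (gap_min n)"

text \<open>Five events contribute 1/l each, although their estimates are smaller by a power of n.
  The collar event, with K/l, is the one that fixes the rate; too few roots at the edge depth costs
  4/(k l^2), weakened to 4/(k l).\<close>

lemma bad_bound: "\<forall>\<^sub>F n in sequentially. bad n \<in> M.events \<and> M.prob (bad n) \<le> (5 + 4 / k + K) * (1 / real (l n))"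
  using l_bounds ev_scales ev_edge ev_counts ev_variance ev_prob_close ev_prob_net ev_prob_few ev_prob_gap
proof eventually_elim
  case (elim n)
  let ?b = "1 / real (l n)"
  have n: "1 \<le> n" "0 < real n" "0 < real (l n)" using elim by auto
  have h: "0 < mesh n" "mesh n \<le> 1" using n elim by auto
  have pos: "0 < edge n" "0 < collar n" "0 < sep_crowd n" "0 < gap_min n" "0 < 2 * real (l n) / n"
    using n by auto
  have c1: "close_event n (2 * real (l n) / n) (sep_edge n) \<in> M.events"
    "M.prob (close_event n (2 * real (l n) / n) (sep_edge n)) \<le> ?b"
    using close_event[of "2 * real (l n) / n" "sep_edge n" n] pos elim by (auto intro: order_trans)
  have c2: "close_event n (sep_crowd n) (sep_crowd n) \<in> M.events"
    "M.prob (close_event n (sep_crowd n) (sep_crowd n)) \<le> ?b"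
    using close_event[of "sep_crowd n" "sep_crowd n" n] pos elim by (auto intro: order_trans)
  have u: "0 < real n powr (-0.244)" using n by simp
  let ?p = "8 * real n * var_cap n / (field_dev n)\<^sup>2 + 4 * real n * var_cap n / ((mesh n)\<^sup>2 * (energy_cap n)\<^sup>2)
      + exp (2 * real n * (10 * K * (5 * mesh n) powr (1 + (1 + \<alpha>))) - crowd_cap n)"
  have ne: "net_event n c \<in> M.events" "M.prob (net_event n c) \<le> ?p" if "c \<in> net (mesh n)" for c
  proof -
    have "norm c = 1 + mesh n" using net(3)[OF h that] .
    note ev = net_events[OF this h(1) u conjunct1[OF elim(5)], where ?e1.0 = "field_dev n"
      and ?e2.0 = "energy_cap n" and n = n]
    have ev': "field_event n c (field_dev n) \<in> M.events" "energy_event n c (energy_cap n) \<in> M.events"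
        "crowd_event n c (mesh n) (crowd_cap n) \<in> M.events"
        "M.prob (field_event n c (field_dev n)) \<le> 8 * real n * var_cap n / (field_dev n)\<^sup>2"
        "M.prob (energy_event n c (energy_cap n)) \<le> 4 * real n * var_cap n / ((mesh n)\<^sup>2 * (energy_cap n)\<^sup>2)"
        "M.prob (crowd_event n c (mesh n) (crowd_cap n)) \<le> exp (2 * real n * (10 * K * (5 * mesh n) powr (1
          + (1 + \<alpha>))) - crowd_cap n)"
      by (intro ev; use n elim(5) in simp)+
    show "net_event n c \<in> M.events" unfolding net_event_def using ev' by auto
    show "M.prob (net_event n c) \<le> ?p" unfolding net_event_def
      using ev' by (intro order_trans[OF measure_Un_le] add_mono sets.Un) auto
  qed
  have c3: "(\<Union>c\<in>net (mesh n). net_event n c) \<in> M.events" "M.prob (\<Union>c\<in>net (mesh n). net_event n c) \<le> ?b"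
  proof -
    show "(\<Union>c\<in>net (mesh n). net_event n c) \<in> M.events" using ne net(1)[OF h] by (intro sets.finite_UN) auto
    have "M.prob (\<Union>c\<in>net (mesh n). net_event n c) \<le> (\<Sum>c\<in>net (mesh n). M.prob (net_event n c))"
      using ne net(1)[OF h] by (intro measure_UNION_le) auto
    also have "\<dots> \<le> real (card (net (mesh n))) * ?p" using ne by (intro sum_bounded_above) auto
    also have "\<dots> \<le> 14 / mesh n * ?p" using net(2)[OF h] by (intro mult_right_mono) (auto intro!: add_nonneg_nonneg)
    also have "\<dots> \<le> ?b" using elim(7) .
    finally show "M.prob (\<Union>c\<in>net (mesh n). net_event n c) \<le> ?b" .
  qed
  have c4: "few_event n (1 / n) (n powr \<delta>) \<in> M.events" "M.prob (few_event n (1 / n) (n powr \<delta>)) \<le> ?b"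
    using few_event[OF tail_lower, of "1 / n" n "n powr \<delta>"] elim n const_pos by (auto intro: order_trans)
  have "edge n \<le> \<epsilon>" using elim(3) by auto
  then have c5: "few_event n (edge n) (l n) \<in> M.events" "M.prob (few_event n (edge n) (l n)) \<le> 4 / k * ?b"
    using few_event[OF tail_lower, of "edge n" n "l n"] elim(4,8) n pos const_pos by (auto intro: order_trans)
  have c6: "edge_event n (collar n) \<in> M.events" "M.prob (edge_event n (collar n)) \<le> K * ?b"
  proof -
    show "edge_event n (collar n) \<in> M.events" by (rule edge_event)
    have "M.prob (edge_event n (collar n)) \<le> n * (K * collar n powr (1 + \<alpha>))" using pos(2) by (rule edge_event(2))
    also have "\<dots> = K * ?b" unfolding collar_powr[OF n(1)] using n by simp
    finally show "M.prob (edge_event n (collar n)) \<le> K * ?b" .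
  qed
  have c7: "gap_event n (edge n) (collar n) (gap_min n) \<in> M.events"
    "M.prob (gap_event n (edge n) (collar n) (gap_min n)) \<le> ?b"
  proof -
    note ge = gap_event[where n = n and \<epsilon> = \<epsilon>, OF pos(1,2,4) _ ring]
    show "gap_event n (edge n) (collar n) (gap_min n) \<in> M.events" using elim(3) alpha by (intro ge) auto
    have "M.prob (gap_event n (edge n) (collar n) (gap_min n))
      \<le> (real n)\<^sup>2 * (K * edge n powr (1 + \<alpha>) * (K * (2 * gap_min n) * collar n powr \<alpha>))"
      using elim(3) alpha by (intro ge) auto
    with elim(9) show "M.prob (gap_event n (edge n) (collar n) (gap_min n)) \<le> ?b" by linarith
  qed
  have un: "A \<union> B \<in> M.events \<and> M.prob (A \<union> B) \<le> a + b"
    if "A \<in> M.events \<and> M.prob A \<le> a" "B \<in> M.events \<and> M.prob B \<le> b" for A B a b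
    using that measure_Un_le[of A M B] by auto
  have c0: "edge_event n 0 \<in> M.events" "M.prob (edge_event n 0) \<le> 0"
    using edge_event(1,3)[of n] by auto
  have "bad n \<in> M.events \<and> M.prob (bad n) \<le> 0 + ?b + ?b + ?b + ?b + 4 / k * ?b + K * ?b + ?b"
    unfolding bad_def by (intro un conjI[OF c0] conjI[OF c1] conjI[OF c2] conjI[OF c3] conjI[OF c4]
      conjI[OF c5] conjI[OF c6] conjI[OF c7])
  moreover have "0 + ?b + ?b + ?b + ?b + 4 / k * ?b + K * ?b + ?b = (5 + 4 / k + K) * ?b"
    by (simp add: algebra_simps)
  ultimately show ?case by simp
qed

text \<open>What remains after this is deterministic: the exceptional events are cut so that
  avoiding them yields the hypotheses of the pairing together with the counts and gaps for parts (i)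
  and (iv).\<close>

lemma good_sample: "\<forall>\<^sub>F n in sequentially. \<forall>\<omega>\<in>space M - bad n.
   separated_roots n (\<lambda>i. X i \<omega>) (real (l n)) (net (mesh n)) (sep_crowd n) (sep_edge n) (mesh n) (crowd_cap n)
     (field_dev n) (energy_cap n) (field_err n) (energy_bd n) \<and>
   real n powr \<delta> \<le> real (card {i \<in> {1..n}. 1 - 1 / n \<le> norm (X i \<omega>)}) \<and>
   l n \<le> card {i \<in> {1..n}. 1 - edge n \<le> norm (X i \<omega>)} \<and>
   (\<forall>i\<in>{1..n}. norm (X i \<omega>) \<le> 1 - collar n) \<and>
   (\<forall>i\<in>{1..n}. \<forall>j\<in>{1..n}. i \<noteq> j \<longrightarrow> 1 - edge n \<le> norm (X i \<omega>) \<longrightarrow> gap_min n < \<bar>norm (X i \<omega>) - norm (X j \<omega>)\<bar>)"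
  using l_bounds ev_scales ev_field ev_energy
proof eventually_elim
  case (elim n)
  have n: "1 \<le> n" "0 < real n" "0 < real (l n)" using elim by auto
  have h: "0 < mesh n" "mesh n \<le> 1" using n elim by auto
  show ?case
  proof (intro ballI, goal_cases)
    case \<omega>: (1 \<omega>)
    then have sp: "\<omega> \<in> space M" by simp
    have avoid: "\<omega> \<notin> edge_event n 0" "\<omega> \<notin> close_event n (2 * real (l n) / n) (sep_edge n)"
      "\<omega> \<notin> close_event n (sep_crowd n) (sep_crowd n)" "\<And>c. c \<in> net (mesh n) \<Longrightarrow> \<omega> \<notin> net_event n c"
      "\<omega> \<notin> few_event n (1 / n) (n powr \<delta>)" "\<omega> \<notin> few_event n (edge n) (l n)"
      "\<omega> \<notin> edge_event n (collar n)" "\<omega> \<notin> gap_event n (edge n) (collar n) (gap_min n)"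
      using \<omega> unfolding bad_def by blast+
    have disk1: "norm (X j \<omega>) \<le> 1" if "j \<in> {1..n}" for j
      using edge_event_avoided[OF sp avoid(1) that] by simp
    have res: "resolvent c (X j \<omega>) = 1 / (c - X j \<omega>)" if "j \<in> {1..n}" for c j
      using disk1[OF that] by (simp add: resolvent_def)
    have "separated_roots n (\<lambda>i. X i \<omega>) (real (l n)) (net (mesh n)) (sep_crowd n) (sep_edge n) (mesh n) (crowd_cap n)
     (field_dev n) (energy_cap n) (field_err n) (energy_bd n)"
    proof unfold_locales
      fix c assume c: "c \<in> net (mesh n)"
      note av = avoid(4)[OF c, unfolded net_event_def]
      have "norm ((\<Sum>i\<in>{1..n}. resolvent c (X i \<omega>)) - of_nat (card {1..n}) * (1 / c)) < field_dev n"
        using av sp by (auto simp: field_event_def not_le)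
      moreover have "(\<Sum>i\<in>{1..n}. resolvent c (X i \<omega>)) = (\<Sum>j\<in>{1..n}. 1 / (c - X j \<omega>))"
        by (intro sum.cong refl res)
      ultimately show "norm ((\<Sum>j\<in>{1..n}. 1 / (c - X j \<omega>)) - of_nat n / c) \<le> field_dev n" by simp
      have "(\<Sum>i\<in>{1..n}. (norm (resolvent c (X i \<omega>)))\<^sup>2) < energy_cap n"
        using av sp by (auto simp: energy_event_def not_le)
      moreover have "(\<Sum>i\<in>{1..n}. (norm (resolvent c (X i \<omega>)))\<^sup>2) = (\<Sum>j\<in>{1..n}. 1 / (norm (c - X j \<omega>))\<^sup>2)"
        by (intro sum.cong refl) (simp only: res norm_divide power_divide norm_one power_one)
      ultimately show "(\<Sum>j\<in>{1..n}. 1 / (norm (c - X j \<omega>))\<^sup>2) \<le> energy_cap n" by simp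
      show "real (card {j \<in> {1..n}. dist c (X j \<omega>) \<le> 4 * mesh n}) \<le> crowd_cap n"
        using av sp by (simp add: crowd_event_def not_le)
    qed (use n h elim disk1 net(4)[OF h] close_event_avoided[OF sp avoid(2) disk1] close_event_avoided[OF sp avoid(3) disk1] in \<open>simp_all\<close>)
    moreover have "real n powr \<delta> \<le> real (card {i \<in> {1..n}. 1 - 1 / n \<le> norm (X i \<omega>)})"
      using avoid(5) sp by (simp add: few_event_def)
    moreover have "l n \<le> card {i \<in> {1..n}. 1 - edge n \<le> norm (X i \<omega>)}"
      using avoid(6) sp by (simp add: few_event_def)
    moreover have col: "norm (X i \<omega>) \<le> 1 - collar n" if "i \<in> {1..n}" for i
      using edge_event_avoided[OF sp avoid(7) that] .
    moreover have "gap_min n < \<bar>norm (X i \<omega>) - norm (X j \<omega>)\<bar>"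
      if "i \<in> {1..n}" "j \<in> {1..n}" "i \<noteq> j" "1 - edge n \<le> norm (X i \<omega>)" for i j
      by (rule gap_event_avoided[OF sp avoid(8) col _ that]) auto
    ultimately show ?case by blast
  qed
qed

end

text \<open>For the finitely many n at which the estimates have not yet set in, the whole space
  serves as exceptional set; the O-bound does not see them.\<close>

lemma with_prob_1_minus_OI:
  assumes "prob_space M" and "\<forall>\<^sub>F n in sequentially. B n \<in> sets M \<and> measure M (B n) \<le> c * a n"
    and "\<forall>\<^sub>F n in sequentially. \<forall>\<omega>\<in>space M - B n. P n \<omega>" and "\<And>n. 0 \<le> a n"
  shows "with_prob_1_minus_O M a P"
proof -
  let ?ok = "\<lambda>n. B n \<in> sets M \<and> (\<forall>\<omega>\<in>space M - B n. P n \<omega>)"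
  define E where "E = (\<lambda>n. if ?ok n then B n else space M)"
  have "E n \<in> sets M \<and> {\<omega> \<in> space M. \<not> P n \<omega>} \<subseteq> E n" for n
    by (auto simp: E_def)
  moreover have "(\<lambda>n. measure M (E n)) \<in> O(a)"
  proof (rule bigoI)
    show "\<forall>\<^sub>F n in sequentially. norm (measure M (E n)) \<le> c * norm (a n)"
      using assms(2,3) by eventually_elim (simp add: E_def assms(4))
  qed
  ultimately show ?thesis unfolding with_prob_1_minus_O_def by blast
qed

theorem theorem2p7:
  fixes \<alpha> \<delta> :: real
    and \<mu> :: "complex measure"
    and M :: "'a measure"
    and X :: "nat \<Rightarrow> 'a \<Rightarrow> complex"
    and l :: "nat \<Rightarrow> nat"
  assumes mu: "assumption_A \<alpha> \<mu>"
    and alpha: "- 0.095 < \<alpha>" "\<alpha> < 0"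
    and prob: "prob_space M"
    and indep: "prob_space.indep_vars M (\<lambda>_. borel) X {1..}"
    and distr: "\<And>i. 1 \<le> i \<Longrightarrow> distr M borel (X i) = \<mu>"
    and l_pos: "\<And>n. 1 \<le> n \<Longrightarrow> 0 < l n"
    and l_omega: "filterlim l at_top sequentially"
    and l_less: "\<forall>\<^sub>F n in sequentially. real (l n) < sqrt (ln (real n))"
    and delta: "0 < \<delta>" "\<delta> < - \<alpha>"
  shows "\<exists>C > 0. \<exists>\<eta> :: nat \<Rightarrow> real. \<eta> \<in> o(\<lambda>n. 1 / real n) \<and>
    with_prob_1_minus_O M (\<lambda>n. 1 / real (l n)) (\<lambda>n \<omega>.
      let x = (\<lambda>i. X i \<omega>);
          p = root_poly x n;
          A = annulus (l n) n;
          rate1 = C * real (l n) * real n powr (- ((5 * \<alpha> + 3) / (2 * (\<alpha> + 1))));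
          rate2 = C * (1 / (real (l n) ^ 4 * real n)) powr (1 / (\<alpha> + 1))
      in
        \<comment> \<open>(i)\<close>
        real n powr \<delta> \<le> real (card {w \<in> A. w \<in># crit_pts p}) \<and>
        \<comment> \<open>(ii)\<close>
        (\<exists>W :: nat \<Rightarrow> complex. \<forall>i \<in> {1..n}. x i \<in> A \<longrightarrow>
           only_crit_within p (3 / real n) (x i) (W i) \<and>
           norm (W i - x i + (1 / of_nat n) * (1 / root_mean x n i)) < rate1 \<and>
           norm (W i - x i * (1 - 1 / of_nat n)) < rate2) \<and>
        \<comment> \<open>(iii)\<close>
        (\<exists>\<iota> :: complex \<Rightarrow> nat. inj_on \<iota> {w \<in> A. w \<in># crit_pts p} \<and>
           (\<forall>w \<in> {w \<in> A. w \<in># crit_pts p}.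
              {i \<in> {1..n}. x i \<in> A \<and>
                 (\<exists>e. norm e \<le> \<eta> n \<and> w = x i * (1 - 1 / of_nat n + e))} = {\<iota> w} \<and>
              norm (w - x (\<iota> w) * (1 - 1 / of_nat n)) < rate2)) \<and>
        \<comment> \<open>(iv)\<close>
        (\<forall>i \<in> {1..l n}.
           1 - (real (l n) ^ 2 / real n) powr (1 / (\<alpha> + 1)) \<le> norm (roots_desc x n i) \<and>
           norm (roots_desc x n i) \<le> 1 - (1 / (real n * real (l n))) powr (1 / (\<alpha> + 1)) \<and>
           norm (crit_desc x n i - roots_desc x n i * (1 - 1 / of_nat n)) < rate2 \<and>
           norm (crit_desc x n i - roots_desc x n i
                   + (1 / of_nat n) * (1 / root_mean (roots_desc x n) n i)) < rate1 \<and>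
           only_crit_within p (3 / real n) (roots_desc x n i) (crit_desc x n i)))"
proof -
  obtain \<epsilon> K k where const: "0 < \<epsilon>" "0 < K" "0 < k"
    and ring: "\<And>r1 r2. 1 - \<epsilon> \<le> r1 \<Longrightarrow> r1 \<le> r2 \<Longrightarrow> r2 < 1 \<Longrightarrow>
      measure \<mu> {z. r1 \<le> norm z \<and> norm z \<le> r2} \<le> K * (r2 - r1) * (1 - r2) powr \<alpha>"
    and tail: "\<And>t. 0 < t \<Longrightarrow> measure \<mu> {z. 1 - t \<le> norm z} \<le> K * t powr (1 + \<alpha>)"
    and low: "\<And>t. 0 < t \<Longrightarrow> t \<le> \<epsilon> \<Longrightarrow> k * t powr (1 + \<alpha>) \<le> measure \<mu> {z. 1 - t \<le> norm z}"
    by (rule assumption_A_radial_bounds[OF mu alpha(2)]) (rule that)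
  from mu have mu': "prob_space \<mu> \<and> sets \<mu> = sets borel \<and> (\<forall>\<theta>. distr \<mu> borel (\<lambda>z. cis \<theta> * z) = \<mu>) \<and>
    (AE z in \<mu>. norm z \<le> 1)"
    unfolding assumption_A_def by (elim conjE) (intro conjI)
  interpret prob_space \<mu> using mu' by blast
  interpret edge_model \<mu> K \<alpha> M X l \<delta> k \<epsilon>
  proof (intro edge_model.intro radial_sample.intro radial_disk.intro radial_disk_axioms.intro
      radial_sample_axioms.intro slow_growth.intro edge_model_axioms.intro)
  qed (use mu' const ring tail low assms in auto)
  show ?thesis
  \<comment> \<open>The errors are smaller than the required rates by a power of n, so C = 1 works.
    The radius in part (iii) is twice the pairing error, because of the division by a root of
    modulus at least 1/2.\<close>
  proof (intro exI[of _ "1::real"] conjI exI[of _ "\<lambda>n. 2 * crit_err n"] with_prob_1_minus_OI[OF prob bad_bound],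
      goal_cases)
    case 2
    show ?case by (rule crit_err_smallo)
  next
    case 3
    show ?case
      using good_sample ev_err ev_rate1 ev_rate2 ev_edge ev_scales
    proof eventually_elim
      case (elim n)
      show ?case
      proof (intro ballI, goal_cases)
        case (1 \<omega>)
        note good = elim(1)[rule_format, OF 1]
        define x where "x = (\<lambda>i. X i \<omega>)"
        interpret separated_roots n x "real (l n)" "net (mesh n)" "sep_crowd n" "sep_edge n" "mesh n" "crowd_cap n"
          "field_dev n" "energy_cap n" "field_err n" "energy_bd n"
          using good unfolding x_def by blast
        have err: "err = crit_err n" "err1 = crit_err1 n" by (rule err_def err1_def)+
        have small: "err \<le> 1 / (2 * n)" "2 * real (l n) \<le> n" and gap5: "5 * err \<le> gap_min n"
          using elim(2,6) unfolding err by blast+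
        define r1 where "r1 = real (l n) * real n powr (- ((5 * \<alpha> + 3) / (2 * (\<alpha> + 1))))"
        define r2 where "r2 = (1 / (real (l n) ^ 4 * real n)) powr (1 / (\<alpha> + 1))"
        have rates: "err1 < r1" "err < r2" using elim(3,4) unfolding err r1_def r2_def by blast+
        have i: "real n powr \<delta> \<le> real (card {w \<in> annulus (l n) n. w \<in># crit_pts p})"
          using good crit_count[OF refl small] unfolding x_def by (meson of_nat_le_iff order_trans)
        have ii: "\<exists>W :: nat \<Rightarrow> complex. \<forall>i \<in> {1..n}. x i \<in> annulus (l n) n \<longrightarrow>
             only_crit_within p (3 / real n) (x i) (W i) \<and>
             norm (W i - x i + (1 / of_nat n) * (1 / root_mean x n i)) < r1 \<and>
             norm (W i - x i * (1 - 1 / of_nat n)) < r2"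
          using roots_paired[OF refl small] rates by (meson le_less_trans)
        have iii: "\<exists>\<iota> :: complex \<Rightarrow> nat. inj_on \<iota> {w \<in> annulus (l n) n. w \<in># crit_pts p} \<and>
             (\<forall>w \<in> {w \<in> annulus (l n) n. w \<in># crit_pts p}.
                {i \<in> {1..n}. x i \<in> annulus (l n) n \<and>
                   (\<exists>e. norm e \<le> 2 * crit_err n \<and> w = x i * (1 - 1 / of_nat n + e))} = {\<iota> w} \<and>
                norm (w - x (\<iota> w) * (1 - 1 / of_nat n)) < r2)"
          using crit_paired[OF refl small refl] rates unfolding err(1) by (meson le_less_trans)
        have iv: "1 - edge n \<le> norm (roots_desc x n k) \<and> norm (roots_desc x n k) \<le> 1 - collar n \<and>
             norm (crit_desc x n k - roots_desc x n k * (1 - 1 / of_nat n)) < r2 \<and>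
             norm (crit_desc x n k - roots_desc x n k
                     + (1 / of_nat n) * (1 / root_mean (roots_desc x n) n k)) < r1 \<and>
             only_crit_within p (3 / real n) (roots_desc x n k) (crit_desc x n k)"
          if k: "k \<in> {1..l n}" for k
        proof -
          obtain i where i: "i \<in> {1..n}" "1 - edge n \<le> norm (x i)" "roots_desc x n k = x i" "crit_desc x n k = W i"
            "1 - 2 * real (l n) / n \<le> norm (x i)" "root_mean (roots_desc x n) n k = root_mean x n i"
          proof (rule largest_paired[OF refl small _ _ _ k])
            show "edge n \<le> 1 / n" using elim(5) by blast
            show "l n \<le> card {i \<in> {1..n}. 1 - edge n \<le> norm (x i)}" using good unfolding x_def by blast
            show "5 * err < \<bar>norm (x i) - norm (x j)\<bar>"
              if "i \<in> {1..n}" "j \<in> {1..n}" "i \<noteq> j" "1 - edge n \<le> norm (x i)" for i j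
              using good that gap5 unfolding x_def by (meson le_less_trans)
          qed
          have "norm (x i) \<le> 1 - collar n" using good i(1) unfolding x_def by blast
          then show ?thesis
            using W[OF i(1,5)] i(2) rates unfolding i(3,4,6) by (meson le_less_trans)
        qed
        from i ii iii ballI[OF iv] show ?case
          unfolding x_def r1_def r2_def Let_def mult_1 by (intro conjI)
      qed
    qed
  qed simp_all
qed

end
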